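(* For all integers $k\ge 2$ and $n\ge 3$, $GR_k(\Theta_{2n})=(n-1)k+n+1$.
   Context: A Gallai $k$-coloring of a complete graph is an edge-coloring with colors from $\{1,\dots,k\}$ with no rainbow triangle (a triangle whose three edges receive three distinct colors). For $m\ge 4$, $\Theta_m$ is the family of graphs obtained from the cycle $C_m$ on $m$ vertices by adding one edge joining two non-consecutive vertices. $GR_k(\Theta_{2n})$ is the least positive integer $N$ such that every Gallai $k$-coloring of the complete graph $K_N$ contains a monochromatic copy of some graph in $\Theta_{2n}$ (a subgraph isomorphic to a member of $\Theta_{2n}$ all of whose edges have the same color). *)

theory Defs
  imports "HOL-Library.Ramsey"
begin

text \<open>A simple undirected graph is a pair of a vertex set and a set of two-element subsets of it.\<close>

type_synonym 'a graph = "'a set \<times> 'a set set"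

abbreviation verts :: "'a graph \<Rightarrow> 'a set" where
  "verts \<equiv> fst"

abbreviation edges :: "'a graph \<Rightarrow> 'a set set" where
  "edges \<equiv> snd"

definition complete_graph :: "nat \<Rightarrow> nat graph" where
  "complete_graph N = ({..<N}, [{..<N}]\<^bsup>2\<^esup>)"

definition subgraph :: "'a graph \<Rightarrow> 'a graph \<Rightarrow> bool" where
  "subgraph H G \<longleftrightarrow>
     verts H \<subseteq> verts G \<and> edges H \<subseteq> edges G \<and> edges H \<subseteq> [verts H]\<^bsup>2\<^esup>"

definition isomorphic :: "'a graph \<Rightarrow> 'b graph \<Rightarrow> bool" where
  "isomorphic G H \<longleftrightarrow>
     (\<exists>f. bij_betw f (verts G) (verts H) \<and> edges H = (\<lambda>e. f ` e) ` edges G)"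

text \<open>The following is the cycle on \<open>m\<close> vertices only for \<open>m \<ge> 3\<close>.\<close>

definition cycle_graph :: "nat \<Rightarrow> nat graph" where
  "cycle_graph m = ({..<m}, {{i, (i + 1) mod m} | i. i < m})"

definition Theta :: "nat \<Rightarrow> nat graph set" where
  "Theta m = {(verts (cycle_graph m), insert {a, b} (edges (cycle_graph m))) | a b.
     a \<in> verts (cycle_graph m) \<and> b \<in> verts (cycle_graph m) \<and> a \<noteq> b \<and>
     {a, b} \<notin> edges (cycle_graph m)}"

text \<open>Not all of the colors \<open>1, \<dots>, k\<close> need to occur in a coloring.\<close>

definition gallai_coloring :: "nat \<Rightarrow> 'a graph \<Rightarrow> ('a set \<Rightarrow> nat) \<Rightarrow> bool" where
  "gallai_coloring k G c \<longleftrightarrow>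
     c \<in> edges G \<rightarrow> {1..k} \<and>
     (\<nexists>x y z. {x, y} \<in> edges G \<and> {y, z} \<in> edges G \<and> {x, z} \<in> edges G \<and>
        x \<noteq> y \<and> y \<noteq> z \<and> x \<noteq> z \<and>
        c {x, y} \<noteq> c {y, z} \<and> c {y, z} \<noteq> c {x, z} \<and> c {x, y} \<noteq> c {x, z})"

definition has_mono_copy :: "'a graph \<Rightarrow> ('a set \<Rightarrow> nat) \<Rightarrow> 'b graph \<Rightarrow> bool" where
  "has_mono_copy G c H \<longleftrightarrow>
     (\<exists>S i. subgraph S G \<and> isomorphic H S \<and> (\<forall>e \<in> edges S. c e = i))"

definition gallai_arrows :: "nat \<Rightarrow> nat \<Rightarrow> 'b graph set \<Rightarrow> bool" where
  "gallai_arrows N k \<H> \<longleftrightarrow>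
     (\<forall>c. gallai_coloring k (complete_graph N) c \<longrightarrow>
        (\<exists>H \<in> \<H>. has_mono_copy (complete_graph N) c H))"

definition GR :: "nat \<Rightarrow> 'b graph set \<Rightarrow> nat" where
  "GR k \<H> = (LEAST N. 0 < N \<and> gallai_arrows N k \<H>)"

text \<open>By Ramsey's theorem the \<open>LEAST\<close> above ranges over a nonempty set in the case of interest.\<close>

lemma Theta_nonempty:
  assumes "m \<ge> 4"
  shows "Theta m \<noteq> {}"
proof -
  have "{0, 2} \<noteq> {i, (i + 1) mod m}" for i
  proof
    assume "{0, 2} = {i, (i + 1) mod m}"
    then have "i = 0 \<and> (i + 1) mod m = 2 \<or> i = 2 \<and> (i + 1) mod m = 0"
      by (metis doubleton_eq_iff)
    then show False
      using assms by (elim disjE conjE) simp_all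
  qed
  then have "{0, 2} \<notin> edges (cycle_graph m)"
    unfolding cycle_graph_def snd_conv by blast
  moreover have "0 \<in> verts (cycle_graph m)" "2 \<in> verts (cycle_graph m)"
    using assms by (simp_all add: cycle_graph_def)
  moreover have "(0::nat) \<noteq> 2"
    by simp
  ultimately show ?thesis
    unfolding Theta_def by blast
qed

lemma Theta_wf:
  assumes "m \<ge> 4" "H \<in> Theta m"
  shows "verts H = {..<m}" "edges H \<subseteq> [{..<m}]\<^bsup>2\<^esup>"
proof -
  obtain a b where H: "H = (verts (cycle_graph m), insert {a, b} (edges (cycle_graph m)))"
    "a \<in> verts (cycle_graph m)" "b \<in> verts (cycle_graph m)" "a \<noteq> b"
    using assms(2) unfolding Theta_def by blast
  have "{i, (i + 1) mod m} \<in> [{..<m}]\<^bsup>2\<^esup>" if "i < m" for i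
    using assms(1) that by (simp add: mod_Suc)
  then have cyc: "edges (cycle_graph m) \<subseteq> [{..<m}]\<^bsup>2\<^esup>"
    unfolding cycle_graph_def by auto
  show "verts H = {..<m}"
    unfolding H(1) by (simp add: cycle_graph_def)
  have "{a, b} \<in> [{..<m}]\<^bsup>2\<^esup>"
    using H(2-4) by (simp add: cycle_graph_def)
  then show "edges H \<subseteq> [{..<m}]\<^bsup>2\<^esup>"
    unfolding H(1) snd_conv using cyc by blast
qed

lemma ex_gallai_arrows_Theta:
  assumes m: "m \<ge> 4"
  shows "\<exists>N>0. gallai_arrows N k (Theta m)"
proof -
  obtain M :: nat where "partn_lst {..<M} (replicate k m) 2"
    using ramsey_full[of "replicate k m" 2] by blast
  then have part: "partn_lst {..<Suc M} (replicate k m) 2"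
    using partn_lst_greater_resource by (metis le_Suc_eq order_refl)
  obtain T where T: "T \<in> Theta m"
    using Theta_nonempty[OF m] by blast
  have "has_mono_copy (complete_graph (Suc M)) c T"
    if c: "gallai_coloring k (complete_graph (Suc M)) c" for c
  proof -
    have col: "c e \<in> {1..k}" if "e \<in> [{..<Suc M}]\<^bsup>2\<^esup>" for e
      using c that by (auto simp: gallai_coloring_def complete_graph_def)
    have "(\<lambda>e. c e - 1) \<in> [{..<Suc M}]\<^bsup>2\<^esup> \<rightarrow> {..<k}"
    proof
      fix e assume "e \<in> [{..<Suc M}]\<^bsup>2\<^esup>"
      from col[OF this] show "c e - 1 \<in> {..<k}"
        by auto
    qed
    then obtain i W where i: "i < k" and W: "W \<in> [{..<Suc M}]\<^bsup>(replicate k m ! i)\<^esup>"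
      and mono: "(\<lambda>e. c e - 1) ` [W]\<^bsup>2\<^esup> \<subseteq> {i}"
      using partn_lstE[OF part, of "\<lambda>e. c e - 1" k] by auto
    have W': "W \<subseteq> {..<Suc M}" "finite W" "card W = m"
      using W i by (auto simp: nsets_def)
    obtain f where f: "bij_betw f {..<m} W"
      using finite_same_card_bij[of "{..<m}" W] W' by auto
    have sub2: "(\<lambda>e. f ` e) ` edges T \<subseteq> [W]\<^bsup>2\<^esup>"
      using Theta_wf[OF m T] bij_betw_nsets[OF f, of 2] by (auto simp: bij_betw_def)
    have sub: "[W]\<^bsup>2\<^esup> \<subseteq> [{..<Suc M}]\<^bsup>2\<^esup>"
      using W' by (intro nsets_mono)
    have mono': "c e = Suc i" if "e \<in> [W]\<^bsup>2\<^esup>" for e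
    proof -
      have "c e - 1 = i" "1 \<le> c e"
        using mono that col[of e] sub by auto
      then show ?thesis
        by simp
    qed
    let ?S = "(W, (\<lambda>e. f ` e) ` edges T)"
    have "subgraph ?S (complete_graph (Suc M))"
      unfolding subgraph_def complete_graph_def fst_conv snd_conv
      using sub sub2 W' by blast
    moreover have "isomorphic T ?S"
      unfolding isomorphic_def fst_conv snd_conv Theta_wf(1)[OF m T]
      using f by blast
    moreover have "\<forall>e \<in> edges ?S. c e = Suc i"
      unfolding snd_conv using sub2 mono' by blast
    ultimately show ?thesis
      unfolding has_mono_copy_def by blast
  qed
  then show ?thesis
    using T unfolding gallai_arrows_def by blast
qed

end

theory Submission
  imports Defs
begin

text \<open>A monochromatic cycle of length \<open>2 n\<close> in a Gallai coloring forces a member of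
  \<open>Theta (2 * n)\<close>: either a chord has the color of the cycle, or all chords have the same color. To
  find such a cycle, take a minimal set \<open>R\<close> of at least \<open>n\<close> vertices to which every other vertex is
  joined in a single color. For each color at most \<open>n - 1\<close> vertices are joined to \<open>R\<close> in it, and by
  Gallai's theorem \<open>R\<close> has a cut in two colors. Restricting to \<open>R\<close> and the vertices joined to
  \<open>R\<close> in these two colors leaves \<open>3 n - 1\<close> vertices, on which the pairs in other colors generate
  an equivalence relation with classes of at most \<open>n - 1\<close> twins.

  For such two-colorings the monochromatic cycle is found by induction on \<open>n\<close>. If a red cycle of
  length \<open>2 n - 2\<close> cannot be extended, then two vertices outside have few red neighbours on it,
  hence many common blue ones, and Hall's theorem yields a blue cycle of length \<open>2 n\<close> that
  alternates between the cycle and the rest. Classes of size \<open>n - 1\<close> serve as one side of a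
  red bipartite graph instead.\<close>

section \<open>Cycles as lists\<close>

text \<open>Put \<open>m = n - 1\<close>. The \<open>k - 2\<close> colors outside the cut cost at
  most \<open>m\<close> vertices each, which leaves \<open>3 * m + 2\<close> of the
  \<open>m * k + m + 2\<close> vertices. This is the two-color Ramsey number of the cycle of length
  \<open>2 * m + 2\<close>, so the reduction loses nothing. Minimality of \<open>R\<close> bounds
  the classes inside \<open>R\<close>: a class with more than \<open>m\<close> vertices would be a
  smaller set of the same kind. The obstacle is that the two-colored graph is not complete. Passing
  from \<open>m - 1\<close> to \<open>m\<close> frees exactly three vertices, which are spent on one
  of two twins and on a neighbour in each color. It also asks for classes of at most
  \<open>m - 1\<close> vertices, whence the separate case of a class of size \<open>m\<close>. In
  the critical cases Hall's condition is short by just one, and then all sets involved coincide.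
  Reordering the vertices spreads this equality to a triple of vertices, one of which can be
  inserted into the red cycle. The induction starts at \<open>m = 2\<close> with a four-cycle on 8
  vertices: for \<open>m = 1\<close> the pentagon and its complement have no monochromatic
  four-cycle.\<close>

definition cyc :: "('a \<Rightarrow> 'a \<Rightarrow> bool) \<Rightarrow> 'a list \<Rightarrow> bool" where
  "cyc E xs \<longleftrightarrow> distinct xs \<and> 3 \<le> length xs \<and> successively E xs \<and> E (last xs) (hd xs)"

text \<open>The cyclic successor. \<open>hd xs\<close> closes the cycle after the last entry and is
  also the default value for a \<open>v\<close> that does not occur.\<close>

definition nxt :: "'a list \<Rightarrow> 'a \<Rightarrow> 'a" where
  "nxt xs v = (case dropWhile (\<lambda>u. u \<noteq> v) xs of (_ # y # _) \<Rightarrow> y | _ \<Rightarrow> hd xs)"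

lemma cycI: "distinct xs \<Longrightarrow> 3 \<le> length xs \<Longrightarrow> successively E xs \<Longrightarrow> E (last xs) (hd xs) \<Longrightarrow> cyc E xs"
  by (simp add: cyc_def)

lemma cycD: "cyc E xs \<Longrightarrow> distinct xs" "cyc E xs \<Longrightarrow> 3 \<le> length xs" "cyc E xs \<Longrightarrow> xs \<noteq> []"
  "cyc E xs \<Longrightarrow> successively E xs" "cyc E xs \<Longrightarrow> E (last xs) (hd xs)"
  by (auto simp: cyc_def)

lemma cyc_rotate: "cyc E (A @ B) \<Longrightarrow> cyc E (B @ A)"
  unfolding cyc_def by (cases "A = []"; cases "B = []") (auto simp: successively_append_iff)

lemma cyc_conv_nth:
  "cyc E xs \<longleftrightarrow> distinct xs \<and> 3 \<le> length xs \<and>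
     (\<forall>i < length xs. E (xs ! i) (xs ! (Suc i mod length xs)))"
proof (cases "3 \<le> length xs")
  case True
  then have ne: "xs \<noteq> []" by auto
  have "(\<forall>i < length xs. E (xs ! i) (xs ! (Suc i mod length xs))) \<longleftrightarrow>
    (\<forall>i. Suc i < length xs \<longrightarrow> E (xs ! i) (xs ! Suc i)) \<and> E (xs ! (length xs - 1)) (xs ! 0)"
    (is "?l \<longleftrightarrow> ?r")
  proof
    assume l: ?l
    have "E (xs ! i) (xs ! Suc i)" if "Suc i < length xs" for i
      using l[rule_format, of i] that by simp
    moreover have "E (xs ! (length xs - 1)) (xs ! 0)"
      using l[rule_format, of "length xs - 1"] ne by simp
    ultimately show ?r by blast
  next
    assume r: ?r
    show ?l
    proof (intro allI impI)
      fix i assume i: "i < length xs"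
      show "E (xs ! i) (xs ! (Suc i mod length xs))"
      proof (cases "Suc i < length xs")
        case True
        then show ?thesis using r by simp
      next
        case False
        then have "i = length xs - 1" "Suc i = length xs" using i by auto
        then show ?thesis using r by simp
      qed
    qed
  qed
  then show ?thesis
    unfolding cyc_def using ne by (simp add: successively_conv_nth hd_conv_nth last_conv_nth)
qed (simp add: cyc_def)

lemma nxt_append:
  assumes "v \<notin> set A"
  shows "nxt (A @ v # B) v = (if B = [] then hd (A @ [v]) else hd B)"
proof -
  have "dropWhile (\<lambda>u. u \<noteq> v) (A @ v # B) = v # B"
    using assms by (subst dropWhile_append2) auto
  then show ?thesis
    by (cases B) (auto simp: nxt_def)
qed

lemma nxt_nth:
  assumes "distinct xs" "i < length xs"
  shows "nxt xs (xs ! i) = xs ! (Suc i mod length xs)"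
proof -
  have eq: "xs = take i xs @ xs ! i # drop (Suc i) xs"
    using assms by (simp add: id_take_nth_drop)
  have "xs ! i \<notin> set (take i xs)"
    using assms by (auto simp: in_set_conv_nth nth_eq_iff_index_eq)
  from nxt_append[OF this, of "drop (Suc i) xs"] eq
  have "nxt xs (xs ! i) = (if drop (Suc i) xs = [] then hd (take i xs @ [xs ! i]) else hd (drop (Suc i) xs))"
    by simp
  also have "\<dots> = xs ! (Suc i mod length xs)"
  proof (cases "Suc i < length xs")
    case True
    then show ?thesis by (simp add: hd_drop_conv_nth)
  next
    case False
    then have *: "Suc i = length xs" using assms by simp
    then have "xs \<noteq> []" by auto
    have "hd (take i xs @ [xs ! i]) = xs ! 0"
      using assms(2) by (cases i) (auto simp: hd_append hd_conv_nth)
    then show ?thesis using * by simp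
  qed
  finally show ?thesis .
qed

lemma nxt_in: "distinct xs \<Longrightarrow> v \<in> set xs \<Longrightarrow> nxt xs v \<in> set xs"
  by (metis in_set_conv_nth mod_less_divisor nxt_nth length_pos_if_in_set nth_mem)

lemma cyc_nxt: "cyc E xs \<Longrightarrow> v \<in> set xs \<Longrightarrow> E v (nxt xs v)"
  unfolding cyc_conv_nth by (metis in_set_conv_nth nxt_nth)

lemma bij_nxt:
  assumes "distinct xs"
  shows "bij_betw (nxt xs) (set xs) (set xs)"
proof -
  let ?n = "length xs"
  have "inj_on (nxt xs) (set xs)"
  proof (rule inj_onI)
    fix u v assume "u \<in> set xs" "v \<in> set xs" and eq: "nxt xs u = nxt xs v"
    then obtain i j where ij: "i < ?n" "j < ?n" "u = xs ! i" "v = xs ! j"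
      by (metis in_set_conv_nth)
    have "Suc i mod ?n < ?n" "Suc j mod ?n < ?n"
      using ij by (auto intro!: mod_less_divisor)
    then have "Suc i mod ?n = Suc j mod ?n"
      using eq ij assms by (simp add: nxt_nth nth_eq_iff_index_eq)
    then have "i = j"
      using ij(1,2) by (auto simp: mod_Suc split: if_splits)
    then show "u = v" using ij by simp
  qed
  moreover have "nxt xs ` set xs \<subseteq> set xs"
    using assms nxt_in by fastforce
  ultimately show ?thesis
    by (simp add: bij_betw_def endo_inj_surj)
qed

lemma nxt_rotate:
  assumes "distinct (A @ B)" "u \<in> set (A @ B)"
  shows "nxt (B @ A) u = nxt (A @ B) u"
proof -
  have *: "nxt (B @ A) u = nxt (A @ B) u" if "distinct (A @ B)" "u \<in> set A" for A B :: "'a list"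
  proof -
    obtain P Q where A: "A = P @ u # Q" using \<open>u \<in> set A\<close> by (meson split_list)
    have "u \<notin> set P" "u \<notin> set B" using that A by auto
    then show ?thesis
      using nxt_append[of u P "Q @ B"] nxt_append[of u "B @ P" Q] A by (auto simp: hd_append)
  qed
  consider "u \<in> set A" | "u \<in> set B" using assms(2) by auto
  then show ?thesis
  proof cases
    case 1
    then show ?thesis using *[of A B] assms(1) by blast
  next
    case 2
    have "distinct (B @ A)" using assms(1) by auto
    then show ?thesis using *[of B A] 2 by simp
  qed
qed

text \<open>Rotating the cycle so that \<open>v\<close> comes last turns an insertion behind
  \<open>v\<close> into an append. Successors do not depend on the starting point, so statements
  about \<open>nxt xs\<close> survive the rotation.\<close>

lemma cyc_split:
  assumes "cyc E xs" "v \<in> set xs"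
  obtains A where "cyc E A" "set A = set xs" "length A = length xs" "last A = v" "hd A = nxt xs v"
    "\<And>u. u \<in> set xs \<Longrightarrow> nxt A u = nxt xs u"
proof -
  obtain P Q where xs: "xs = P @ v # Q" using assms(2) by (meson split_list)
  then have v: "v \<notin> set P" "v \<notin> set Q" using cycD(1)[OF assms(1)] by auto
  have "cyc E (Q @ P @ [v])"
    using assms(1) xs cyc_rotate[of E "P @ [v]" Q] by simp
  moreover have "hd (Q @ P @ [v]) = nxt xs v"
    using nxt_append[OF v(1), of Q] xs by (auto simp: hd_append)
  moreover have "nxt (Q @ P @ [v]) u = nxt xs u" if "u \<in> set xs" for u
    using nxt_rotate[of "P @ [v]" Q u] xs that cycD(1)[OF assms(1)] by simp
  ultimately show thesis
    using that[of "Q @ P @ [v]"] xs by auto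
qed

lemma cyc_split2:
  assumes "cyc E xs" "v \<in> set xs" "v' \<in> set xs" "v \<noteq> v'"
  obtains A B where "A \<noteq> []" "B \<noteq> []" "cyc E (A @ B)" "set (A @ B) = set xs"
    "length (A @ B) = length xs" "last A = v" "last B = v'" "hd B = nxt xs v" "hd A = nxt xs v'"
proof -
  note res = that
  have *: thesis
    if "xs = P @ u # Q @ u' # R" and "u = v \<and> u' = v' \<or> u = v' \<and> u' = v" for P Q R u u'
  proof -
    have d: "distinct xs" using assms(1) by (simp add: cyc_def)
    let ?A = "R @ P @ [u]" and ?B = "Q @ [u']"
    have c1: "cyc E (?A @ ?B)"
      using assms(1) that(1) cyc_rotate[of E "P @ [u] @ Q @ [u']" R] by simp
    then have c2: "cyc E (?B @ ?A)" by (rule cyc_rotate)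
    have h1: "hd ?B = nxt xs u"
      using d that(1) nxt_append[of u P "Q @ u' # R"] by (auto simp: hd_append)
    have h2: "hd ?A = nxt xs u'"
      using d that(1) nxt_append[of u' "P @ u # Q" R] by (auto simp: hd_append)
    show thesis
      using that(2)
    proof
      assume "u = v \<and> u' = v'"
      then show thesis using c1 h1 h2 that(1) by (intro res[of ?A ?B]) auto
    next
      assume "u = v' \<and> u' = v"
      then show thesis using c2 h1 h2 that(1) by (intro res[of ?B ?A]) auto
    qed
  qed
  obtain P Q where xs: "xs = P @ v # Q" using assms(2) by (meson split_list)
  then consider "v' \<in> set P" | "v' \<in> set Q" using assms(3,4) by auto
  then show thesis
  proof cases
    case 1
    then obtain P1 P2 where "P = P1 @ v' # P2" by (meson split_list)
    then show thesis using *[of P1 v' P2 v Q] xs by simp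
  next
    case 2
    then obtain P1 P2 where "Q = P1 @ v' # P2" by (meson split_list)
    then show thesis using *[of P v P1 v' P2] xs by simp
  qed
qed

text \<open>The list is \<open>u0, x0, u1, x1, ...\<close>: this is how distinct common neighbours
  \<open>xs\<close> of the consecutive vertices \<open>us\<close> become a path.\<close>

lemma alternating_list:
  assumes "length us = Suc (length xs)" "distinct us" "distinct xs" "set us \<inter> set xs = {}"
    and "\<And>i. i < length xs \<Longrightarrow> E (us ! i) (xs ! i)" "\<And>i. i < length xs \<Longrightarrow> E (xs ! i) (us ! Suc i)"
  shows "\<exists>ps. distinct ps \<and> set ps = set us \<union> set xs \<and> length ps = 2 * length xs + 1 \<and>
    successively E ps \<and> ps \<noteq> [] \<and> hd ps = hd us \<and> last ps = last us"
  using assms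
proof (induction xs arbitrary: us)
  case Nil
  then show ?case by (intro exI[of _ us]) (auto simp: length_Suc_conv)
next
  case (Cons x xs)
  then obtain u us' where us: "us = u # us'" "length us' = Suc (length xs)" by (cases us) auto
  have E: "E (us' ! i) (xs ! i)" "E (xs ! i) (us' ! Suc i)" if "i < length xs" for i
    using Cons.prems(5,6)[of "Suc i"] us(1) that by auto
  obtain ps where ps: "distinct ps" "set ps = set us' \<union> set xs" "length ps = 2 * length xs + 1"
    "successively E ps" "ps \<noteq> []" "hd ps = hd us'" "last ps = last us'"
    using Cons.IH[of us'] Cons.prems(2-4) us E by auto
  have "us' \<noteq> []" using us(2) by auto
  then have "E u x" "E x (hd ps)" using Cons.prems(5,6)[of 0] us(1) ps(6) by (auto simp: hd_conv_nth)
  then show ?case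
    using ps us(1) Cons.prems(2-4) \<open>us' \<noteq> []\<close>
    by (intro exI[of _ "u # x # ps"]) (auto simp: successively_Cons)
qed

lemma alternating_cycle:
  assumes r: "2 \<le> r" "length us = r" "length xs = r" and "distinct us" "distinct xs"
    "set us \<inter> set xs = {}"
    and E: "\<And>i. i < r \<Longrightarrow> E (us ! i) (xs ! i)" "\<And>i. i < r \<Longrightarrow> E (xs ! i) (us ! (Suc i mod r))"
  obtains ys where "cyc E ys" "set ys = set us \<union> set xs" "length ys = 2 * r"
proof -
  \<comment> \<open>The last entry of \<open>xs\<close> is held back to close the path from
    \<open>last us\<close> to \<open>hd us\<close>.\<close>
  define zs where "zs = butlast xs"
  have ne: "xs \<noteq> []" "us \<noteq> []" using r by auto
  then have xs: "xs = zs @ [last xs]" by (simp add: zs_def)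
  then have "distinct (zs @ [last xs])" "set xs = insert (last xs) (set zs)"
    using assms(5) by (metis, metis Un_insert_right list.set(2) set_append sup_bot.right_neutral list.set(1))
  then have d: "distinct zs" "last xs \<notin> set zs" "set xs = insert (last xs) (set zs)" by auto
  have l: "length zs = r - 1" using r by (simp add: zs_def)
  have nth: "zs ! i = xs ! i" if "i < r - 1" for i using that l by (simp add: zs_def nth_butlast)
  have "\<exists>ps. distinct ps \<and> set ps = set us \<union> set zs \<and> length ps = 2 * length zs + 1 \<and>
    successively E ps \<and> ps \<noteq> [] \<and> hd ps = hd us \<and> last ps = last us"
  proof (rule alternating_list)
    show "E (zs ! i) (us ! Suc i)" if "i < length zs" for i
      using E(2)[of i] nth[of i] that l by simp
  qed (use assms(4,6) d l r nth E(1) in auto)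
  then obtain ps where ps: "distinct ps" "set ps = set us \<union> set zs" "length ps = 2 * length zs + 1"
    "successively E ps" "ps \<noteq> []" "hd ps = hd us" "last ps = last us" by blast
  have "E (last us) (last xs)" "E (last xs) (hd us)"
    using E[of "r - 1"] r ne by (simp_all add: last_conv_nth hd_conv_nth)
  then have "cyc E (ps @ [last xs])"
    using ps d assms(6) l r(1) by (intro cycI) (auto simp: successively_append_iff)
  then show thesis using that[of "ps @ [last xs]"] ps d l r(1) by auto
qed

lemma alternating_path:
  assumes r: "1 \<le> r" "length us = Suc r" "length xs = r" and "distinct us" "distinct xs"
    "set us \<inter> set xs = {}"
    and E: "\<And>i. i < r \<Longrightarrow> E (us ! i) (xs ! i)" "\<And>i. i < r \<Longrightarrow> E (xs ! i) (us ! Suc i)"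
    and close: "E (us ! r) (us ! 0)"
  obtains ys where "cyc E ys" "set ys = set us \<union> set xs" "length ys = 2 * r + 1"
proof -
  have "\<exists>ps. distinct ps \<and> set ps = set us \<union> set xs \<and> length ps = 2 * length xs + 1 \<and>
    successively E ps \<and> ps \<noteq> [] \<and> hd ps = hd us \<and> last ps = last us"
    by (rule alternating_list) (use assms in auto)
  then obtain ps where ps: "distinct ps" "set ps = set us \<union> set xs" "length ps = 2 * r + 1"
    "successively E ps" "hd ps = hd us" "last ps = last us" using r(3) by blast
  have "us \<noteq> []" using r by auto
  then have "E (last ps) (hd ps)" using ps close r(2) by (simp add: last_conv_nth hd_conv_nth)
  then have "cyc E ps" using ps r(1) by (intro cycI) auto
  then show thesis using that[of ps] ps by simp
qed

section \<open>Hall's theorem and maximal non-Hamiltonian graphs\<close>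

text \<open>Rado's proof: a set with two elements \<open>x\<close> and \<open>y\<close> can lose one
  of them. If both removals broke the condition, at index sets \<open>K\<close> and \<open>L\<close>
  together with \<open>i0\<close>, then submodularity of the cardinality of unions would contradict
  the condition for \<open>insert i0 (K \<union> L)\<close> and \<open>K \<inter> L\<close>. The
  removals end with singletons, which the condition makes distinct.\<close>

theorem hall:
  fixes A :: "'i \<Rightarrow> 'a set"
  assumes "finite I" "\<And>i. i \<in> I \<Longrightarrow> finite (A i)"
    and "\<And>J. J \<subseteq> I \<Longrightarrow> card J \<le> card (\<Union>(A ` J))"
  shows "\<exists>f. inj_on f I \<and> (\<forall>i\<in>I. f i \<in> A i)"
  using assms
proof (induction "\<Sum>i\<in>I. card (A i)" arbitrary: A rule: less_induct)
  case less
  note fin = less.prems(1,2) and H = less.prems(3)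
  show ?case
  proof (cases "\<forall>i\<in>I. card (A i) \<le> 1")
    case True
    have sing: "\<exists>a. A i = {a}" if "i \<in> I" for i
    proof -
      have "1 \<le> card (A i)" using H[of "{i}"] that by simp
      then show ?thesis using True that by (metis card_1_singletonE le_antisym)
    qed
    then obtain f where f: "\<And>i. i \<in> I \<Longrightarrow> A i = {f i}" by metis
    have "inj_on f I"
    proof (rule inj_onI, rule ccontr)
      fix i j assume ij: "i \<in> I" "j \<in> I" "f i = f j" "i \<noteq> j"
      then have "card {i, j} \<le> card (\<Union>(A ` {i, j}))" by (intro H) auto
      then show False using ij f by simp
    qed
    then show ?thesis using f by blast
  next
    case False
    then obtain i0 where i0: "i0 \<in> I" "card (A i0) > 1" by (auto simp: not_le)
    then obtain x y where xy: "x \<in> A i0" "y \<in> A i0" "x \<noteq> y"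
      using card_le_Suc0_iff_eq[OF fin(2)[OF i0(1)]] by (metis One_nat_def not_le)
    have red: "\<exists>f. inj_on f I \<and> (\<forall>i\<in>I. f i \<in> A i)"
      if z: "z \<in> A i0" and Hz: "\<And>J. J \<subseteq> I \<Longrightarrow> card J \<le> card (\<Union>((A(i0 := A i0 - {z})) ` J))" for z
    proof -
      let ?B = "A(i0 := A i0 - {z})"
      have "card (?B i0) < card (A i0)" using z i0 fin(2) by (simp add: card_Diff1_less)
      then have "(\<Sum>i\<in>I. card (?B i)) < (\<Sum>i\<in>I. card (A i))"
        using i0(1) fin(1) by (intro sum_strict_mono_ex1) (auto intro: less_imp_le)
      moreover have "finite (?B i)" if "i \<in> I" for i using fin(2) that i0 by auto
      ultimately obtain f where "inj_on f I" "\<forall>i\<in>I. f i \<in> ?B i"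
        using less.hyps[of ?B] fin(1) Hz by blast
      then show ?thesis by (intro exI[of _ f]) (auto split: if_splits)
    qed
    show ?thesis
    proof (rule ccontr)
      assume no: "\<not> ?thesis"
      have viol: "\<exists>K. K \<subseteq> I \<and> i0 \<notin> K \<and> card (\<Union>(A ` K) \<union> (A i0 - {z})) \<le> card K" if z: "z \<in> A i0" for z
      proof -
        obtain J where J: "J \<subseteq> I" "card (\<Union>((A(i0 := A i0 - {z})) ` J)) < card J"
          using red[OF z] no by (meson not_le)
        have fJ: "finite J" using J(1) fin(1) finite_subset by blast
        have "i0 \<in> J"
        proof (rule ccontr)
          assume "i0 \<notin> J"
          then have "(A(i0 := A i0 - {z})) ` J = A ` J" by auto
          then show False using J H[of J] by simp
        qed
        then have "card J = Suc (card (J - {i0}))" using card.remove[OF fJ \<open>i0 \<in> J\<close>] by simp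
        moreover have "(\<Union>((A(i0 := A i0 - {z})) ` J)) = \<Union>(A ` (J - {i0})) \<union> (A i0 - {z})"
        proof -
          have "J = insert i0 (J - {i0})" using \<open>i0 \<in> J\<close> by blast
          then have "(A(i0 := A i0 - {z})) ` J = insert (A i0 - {z}) (A ` (J - {i0}))"
            by (metis (no_types, lifting) Diff_iff fun_upd_other fun_upd_same image_cong image_insert insertI1)
          then show ?thesis by auto
        qed
        ultimately have "card (\<Union>(A ` (J - {i0})) \<union> (A i0 - {z})) \<le> card (J - {i0})"
          using J(2) by simp
        then show ?thesis using J(1) by (intro exI[of _ "J - {i0}"]) blast
      qed
      obtain K where K: "K \<subseteq> I" "i0 \<notin> K" "card (\<Union>(A ` K) \<union> (A i0 - {x})) \<le> card K"
        using viol[OF xy(1)] by blast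
      obtain L where L: "L \<subseteq> I" "i0 \<notin> L" "card (\<Union>(A ` L) \<union> (A i0 - {y})) \<le> card L"
        using viol[OF xy(2)] by blast
      let ?U = "\<Union>(A ` K) \<union> (A i0 - {x})" and ?V = "\<Union>(A ` L) \<union> (A i0 - {y})"
      have fKL: "finite K" "finite L" using K L fin(1) finite_subset by blast+
      have fU: "finite ?U" "finite ?V" using K L fKL fin(2) i0 by auto
      have "card (insert i0 (K \<union> L)) \<le> card (\<Union>(A ` insert i0 (K \<union> L)))"
        using K L i0 by (intro H) auto
      moreover have "\<Union>(A ` insert i0 (K \<union> L)) \<subseteq> ?U \<union> ?V" using xy by auto
      ultimately have 1: "card (insert i0 (K \<union> L)) \<le> card (?U \<union> ?V)"
        using fU by (meson card_mono finite_UnI order_trans)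
      have "card (K \<inter> L) \<le> card (\<Union>(A ` (K \<inter> L)))" using K by (intro H) auto
      moreover have "\<Union>(A ` (K \<inter> L)) \<subseteq> ?U \<inter> ?V" by auto
      ultimately have 2: "card (K \<inter> L) \<le> card (?U \<inter> ?V)"
        using fU by (meson card_mono finite_Int order_trans)
      have "card (insert i0 (K \<union> L)) = Suc (card (K \<union> L))" using K L fKL by simp
      moreover have "card K + card L = card (K \<union> L) + card (K \<inter> L)"
        using fKL by (rule card_Un_Int)
      moreover have "card ?U + card ?V = card (?U \<union> ?V) + card (?U \<inter> ?V)"
        using fU by (rule card_Un_Int)
      ultimately show False using 1 2 K(3) L(3) by linarith
    qed
  qed
qed

lemma hall_list:
  fixes A :: "nat \<Rightarrow> 'a set"
  assumes "\<And>i. i < r \<Longrightarrow> finite (A i)"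
    and "\<And>J. J \<subseteq> {..<r} \<Longrightarrow> J \<noteq> {} \<Longrightarrow> card J \<le> card (\<Union>(A ` J))"
  obtains xs where "length xs = r" "distinct xs" "\<And>i. i < r \<Longrightarrow> xs ! i \<in> A i"
proof -
  have "card J \<le> card (\<Union>(A ` J))" if "J \<subseteq> {..<r}" for J
    using assms(2)[of J] that by (cases "J = {}") auto
  then obtain f where "inj_on f {..<r}" "\<forall>i\<in>{..<r}. f i \<in> A i"
    using hall[of "{..<r}" A] assms(1) by auto
  then show thesis
    using that[of "map f [0..<r]"] by (auto simp: distinct_map atLeast0LessThan)
qed

definition ham :: "('a \<Rightarrow> 'a \<Rightarrow> bool) \<Rightarrow> 'a set \<Rightarrow> bool" where
  "ham E Y \<longleftrightarrow> (\<exists>xs. cyc E xs \<and> set xs = Y)"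

text \<open>Deleting the new edge from a Hamiltonian cycle that needs it leaves a Hamiltonian path
  between its ends, the starting point of the crossing argument.\<close>

lemma cyc_add_edge:
  assumes c: "cyc (\<lambda>x y. E x y \<or> x = u \<and> y = v \<or> x = v \<and> y = u) xs" and sym: "symp E" and "\<not> cyc E xs"
  obtains ps where "distinct ps" "set ps = set xs" "successively E ps" "ps \<noteq> []" "hd ps = u" "last ps = v"
proof -
  let ?F = "\<lambda>x y. E x y \<or> x = u \<and> y = v \<or> x = v \<and> y = u"
  obtain w where w: "w \<in> set xs" "\<not> E w (nxt xs w)"
    using assms c unfolding cyc_conv_nth by (metis nth_mem nxt_nth)
  have wu: "w = u \<and> nxt xs w = v \<or> w = v \<and> nxt xs w = u" using cyc_nxt[OF c w(1)] w(2) by blast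
  obtain A where A: "cyc ?F A" "set A = set xs" "length A = length xs" "last A = w" "hd A = nxt xs w"
    by (rule cyc_split[OF c w(1)]) blast
  have dA: "distinct A" "3 \<le> length A" "successively ?F A" using A(1) by (auto simp: cyc_def)
  have ne: "A \<noteq> []" using dA by auto
  \<comment> \<open>The new edge already joins the last entry to the first; a second use inside the
    list would force a cycle of two vertices.\<close>
  have "E (A ! i) (A ! Suc i)" if i: "Suc i < length A" for i
  proof (rule ccontr)
    assume "\<not> ?thesis"
    then have "A ! i = u \<and> A ! Suc i = v \<or> A ! i = v \<and> A ! Suc i = u"
      using successively_nth[OF dA(3) i] by blast
    moreover have "A ! 0 = nxt xs w" "A ! (length A - 1) = w"
      using A ne by (simp_all add: hd_conv_nth last_conv_nth)
    moreover have "A ! k = A ! l \<Longrightarrow> k = l" if "k < length A" "l < length A" for k l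
      using dA(1) that nth_eq_iff_index_eq by blast
    ultimately have "(i = 0 \<and> Suc i = length A - 1) \<or> (i = length A - 1 \<and> Suc i = 0)"
      using wu i ne by (metis Suc_lessD diff_less length_greater_0_conv zero_less_one)
    then show False using dA(2) by linarith
  qed
  then have s: "successively E A" by (simp add: successively_conv_nth)
  show thesis
  proof (cases "w = v")
    case True
    then have "hd A = u" "last A = v" using wu A by auto
    then show thesis
      by (intro that[of A]) (simp_all add: dA A(2) s ne)
  next
    case False
    then have w': "last A = u" "hd A = v" using wu A by auto
    have "successively (\<lambda>x y. E y x) A" by (rule successively_mono[OF s]) (rule sympD[OF sym])
    then have "successively E (rev A)" by simp
    then show thesis
      by (intro that[of "rev A"]) (simp_all add: dA A(2) ne w' hd_rev last_rev)
  qed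
qed

text \<open>Ore's crossing argument.\<close>

lemma maximal_nonham:
  assumes fin: "finite Y" and sym: "symp E" and no: "\<not> ham E Y"
  obtains F where "symp F" "\<And>x y. E x y \<Longrightarrow> F x y" "\<not> ham F Y"
    "\<And>u v. u \<in> Y \<Longrightarrow> v \<in> Y \<Longrightarrow> u \<noteq> v \<Longrightarrow> \<not> F u v \<Longrightarrow>
       card {y \<in> Y. F u y \<and> y \<noteq> u} + card {y \<in> Y. F v y \<and> y \<noteq> v} < card Y"
proof -
  let ?P = "\<lambda>F. symp F \<and> (\<forall>x y. E x y \<longrightarrow> F x y) \<and> \<not> ham F Y"
  let ?m = "\<lambda>F. card {(x, y) \<in> Y \<times> Y. F x y}"
  have bd: "?m F \<le> card (Y \<times> Y)" for F
    using fin by (intro card_mono) auto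
  have "?P E" using sym no by blast
  \<comment> \<open>A graph with the greatest number of adjacent pairs in \<open>Y\<close> is
    edge-maximal: any further edge inside \<open>Y\<close> makes it Hamiltonian.\<close>
  then obtain F where F: "?P F" "\<forall>G. ?P G \<longrightarrow> ?m G \<le> ?m F"
    using ex_has_greatest_nat[of ?P E ?m "Suc (card (Y \<times> Y))"] bd[THEN le_imp_less_Suc] by blast
  have "card {y \<in> Y. F u y \<and> y \<noteq> u} + card {y \<in> Y. F v y \<and> y \<noteq> v} < card Y"
    if uv: "u \<in> Y" "v \<in> Y" "u \<noteq> v" "\<not> F u v" for u v
  proof -
    let ?G = "\<lambda>x y. F x y \<or> x = u \<and> y = v \<or> x = v \<and> y = u"
    have "{(x, y) \<in> Y \<times> Y. F x y} \<subset> {(x, y) \<in> Y \<times> Y. ?G x y}" using uv by auto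
    moreover have "finite {(x, y) \<in> Y \<times> Y. ?G x y}"
      by (rule finite_subset[of _ "Y \<times> Y"]) (use fin in auto)
    ultimately have "?m F < ?m ?G" by (rule psubset_card_mono[rotated])
    have sF: "F a b \<Longrightarrow> F b a" for a b using F(1) by (blast dest: sympD)
    have "symp ?G" by (rule sympI) (use sF in blast)
    have "ham ?G Y"
    proof (rule ccontr)
      assume "\<not> ham ?G Y"
      then have "?m ?G \<le> ?m F" using F \<open>symp ?G\<close> by blast
      then show False using \<open>?m F < ?m ?G\<close> by linarith
    qed
    then obtain xs where xs: "cyc ?G xs" "set xs = Y" by (auto simp: ham_def)
    have nF: "\<not> cyc F xs" using F(1) xs by (auto simp: ham_def)
    obtain ps where ps: "distinct ps" "set ps = Y" "successively F ps" "ps \<noteq> []" "hd ps = u" "last ps = v"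
      using cyc_add_edge[OF xs(1) _ nF] F(1) xs(2) by auto
    have N: "length ps = card Y" using distinct_card[OF ps(1)] ps(2) by simp
    have dx: "distinct xs" "3 \<le> length xs" using xs(1) unfolding cyc_def by blast+
    then have N3: "3 \<le> card Y" using xs(2) distinct_card[OF dx(1)] by simp
    let ?n = "card Y - 1"
    \<comment> \<open>The path \<open>ps\<close> runs from \<open>u\<close> to \<open>v\<close>. An
      index \<open>i\<close> in both sets would close the cycle that follows \<open>ps\<close> up to
      \<open>ps ! i\<close> and then runs through the rest backwards from \<open>v\<close>.\<close>
    define I where "I = {i. i < ?n \<and> F u (ps ! Suc i)}"
    define J where "J = {i. i < ?n \<and> F (ps ! i) v}"
    have "I \<inter> J = {}"
    proof (rule ccontr)
      assume "I \<inter> J \<noteq> {}"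
      then obtain i where i: "i < ?n" "F u (ps ! Suc i)" "F (ps ! i) v" by (auto simp: I_def J_def)
      let ?A = "take (Suc i) ps" and ?B = "drop (Suc i) ps"
      have AB: "ps = ?A @ ?B" by simp
      have ne: "?A \<noteq> []" "?B \<noteq> []" using i N by auto
      have l: "last ?A = ps ! i" "hd ?B = ps ! Suc i" "hd ?A = u" "last ?B = v"
      proof -
        have "Suc i < length ps" using i N by simp
        then show "last ?A = ps ! i" "hd ?B = ps ! Suc i" "hd ?A = u" "last ?B = v"
          using ps(5,6) by (simp add: take_Suc_conv_app_nth, simp add: hd_drop_conv_nth, simp add: hd_take, simp)
      qed
      have s: "successively F ?A" "successively F ?B"
        using ps(3) AB by (metis (no_types) successively_append_iff)+
      have "successively (\<lambda>x y. F y x) ?B" by (rule successively_mono[OF s(2)]) (rule sF)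
      then have "successively F (?A @ rev ?B)"
        using s ne l i(3) by (simp add: successively_append_iff hd_rev)
      moreover have "F (last (?A @ rev ?B)) (hd (?A @ rev ?B))"
        using ne l i(2) sF by (simp add: last_rev)
      moreover have "distinct (?A @ rev ?B)" "set (?A @ rev ?B) = Y" "length (?A @ rev ?B) = card Y"
      proof -
        have "distinct (?A @ ?B)" "set (?A @ ?B) = Y" "length (?A @ ?B) = card Y"
          using ps N by (simp_all only: AB[symmetric])
        then show "distinct (?A @ rev ?B)" "set (?A @ rev ?B) = Y" "length (?A @ rev ?B) = card Y"
          unfolding distinct_append set_append set_rev distinct_rev length_append length_rev by blast+
      qed
      ultimately have "cyc F (?A @ rev ?B)" using N3 by (simp add: cyc_def)
      then show False using F(1) \<open>set (?A @ rev ?B) = Y\<close> by (auto simp: ham_def)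
    qed
    have fIJ: "finite I" "finite J" by (auto simp: I_def J_def)
    have "{y \<in> Y. F u y \<and> y \<noteq> u} \<subseteq> (\<lambda>i. ps ! Suc i) ` I"
    proof
      fix y assume y: "y \<in> {y \<in> Y. F u y \<and> y \<noteq> u}"
      then obtain k where k: "k < card Y" "y = ps ! k" using ps(2) N by (auto simp: in_set_conv_nth)
      have "k \<noteq> 0"
      proof
        assume "k = 0"
        then show False using y k ps(4,5) by (simp add: hd_conv_nth)
      qed
      then obtain i where "k = Suc i" by (cases k) auto
      then show "y \<in> (\<lambda>i. ps ! Suc i) ` I" using k y by (auto simp: I_def)
    qed
    then have 1: "card {y \<in> Y. F u y \<and> y \<noteq> u} \<le> card I"
      using fIJ by (meson card_image_le card_mono finite_imageI order_trans)
    have "{y \<in> Y. F v y \<and> y \<noteq> v} \<subseteq> (\<lambda>i. ps ! i) ` J"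
    proof
      fix y assume y: "y \<in> {y \<in> Y. F v y \<and> y \<noteq> v}"
      then obtain k where k: "k < card Y" "y = ps ! k" using ps(2) N by (auto simp: in_set_conv_nth)
      have "k \<noteq> ?n" using y k ps(4,6) N by (auto simp: last_conv_nth)
      moreover have "F y v" using y sF by blast
      ultimately show "y \<in> (\<lambda>i. ps ! i) ` J" using k by (auto simp: J_def)
    qed
    then have 2: "card {y \<in> Y. F v y \<and> y \<noteq> v} \<le> card J"
      using fIJ by (meson card_image_le card_mono finite_imageI order_trans)
    have "card I + card J = card (I \<union> J)" using fIJ \<open>I \<inter> J = {}\<close> by (simp add: card_Un_disjoint)
    also have "\<dots> \<le> card {..<?n}" by (intro card_mono) (auto simp: I_def J_def)
    finally show ?thesis using 1 2 N3 by simp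
  qed
  then show thesis using that[of F] F(1) by blast
qed

lemma ham_complete:
  assumes "finite Y" "3 \<le> card Y" "\<And>x y. x \<in> Y \<Longrightarrow> y \<in> Y \<Longrightarrow> x \<noteq> y \<Longrightarrow> E x y"
  shows "ham E Y"
proof -
  obtain xs where xs: "set xs = Y" "distinct xs" using finite_distinct_list[OF assms(1)] by blast
  then have l: "length xs = card Y" using distinct_card by metis
  have "cyc E xs"
    unfolding cyc_conv_nth
  proof (intro conjI allI impI)
    fix i assume i: "i < length xs"
    have "Suc i mod length xs < length xs" "Suc i mod length xs \<noteq> i"
      using i l assms(2) by (auto simp: mod_Suc)
    then show "E (xs ! i) (xs ! (Suc i mod length xs))"
      using xs i assms(3) nth_mem[of _ xs] by (metis nth_eq_iff_index_eq)
  qed (use xs l assms in auto)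
  then show ?thesis using xs by (auto simp: ham_def)
qed

section \<open>Extending cycles\<close>

lemma cyc_insert1:
  assumes c: "cyc E xs" and v: "v \<in> set xs" and w: "w \<notin> set xs" and e: "E v w" "E w (nxt xs v)"
  obtains ys where "cyc E ys" "set ys = insert w (set xs)" "length ys = length xs + 1"
proof -
  obtain A where A: "cyc E A" "set A = set xs" "length A = length xs" "last A = v" "hd A = nxt xs v"
    by (rule cyc_split[OF c v]) blast
  have "cyc E (A @ [w])"
    using cycD[OF A(1)] A(2,4,5) w e by (intro cycI) (auto simp: successively_append_iff successively_Cons)
  then show thesis using A by (intro that[of "A @ [w]"]) auto
qed

lemma cyc_insert_edge:
  assumes c: "cyc E xs" and v: "v \<in> set xs" and w: "w \<notin> set xs" "w' \<notin> set xs" "w \<noteq> w'"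
    and e: "E v w" "E w w'" "E w' (nxt xs v)"
  obtains ys where "cyc E ys" "set ys = insert w (insert w' (set xs))" "length ys = length xs + 2"
proof -
  obtain A where A: "cyc E A" "set A = set xs" "length A = length xs" "last A = v" "hd A = nxt xs v"
    by (rule cyc_split[OF c v]) blast
  have "cyc E (A @ [w, w'])"
    using cycD[OF A(1)] A(2,4,5) w e by (intro cycI) (auto simp: successively_append_iff successively_Cons)
  then show thesis using A by (intro that[of "A @ [w, w']"]) auto
qed

lemma cyc_insert2:
  assumes c: "cyc E xs" and v: "v \<in> set xs" "v' \<in> set xs" "v \<noteq> v'"
    and w: "w \<notin> set xs" "w' \<notin> set xs" "w \<noteq> w'"
    and e: "E v w" "E w (nxt xs v)" "E v' w'" "E w' (nxt xs v')"
  obtains ys where "cyc E ys" "set ys = insert w (insert w' (set xs))" "length ys = length xs + 2"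
proof -
  obtain A B where A: "A \<noteq> []" "B \<noteq> []" "cyc E (A @ B)" "set (A @ B) = set xs"
    "length (A @ B) = length xs" "last A = v" "last B = v'" "hd B = nxt xs v" "hd A = nxt xs v'"
    by (rule cyc_split2[OF c v])
  have "successively E A" "successively E B" "distinct A" "distinct B" "set A \<inter> set B = {}"
    using cycD[OF A(3)] by (simp_all add: successively_append_iff)
  moreover have "w \<notin> set A" "w \<notin> set B" "w' \<notin> set A" "w' \<notin> set B" using A(4) w by auto
  ultimately have "cyc E (A @ [w] @ B @ [w'])"
    using A w e cycD(2)[OF c] by (intro cycI) (auto simp: successively_append_iff successively_Cons)
  then show thesis using A(4,5) by (intro that[of "A @ [w] @ B @ [w']"]) auto
qed

text \<open>Traversing one of the two arcs backwards lets \<open>w\<close> join \<open>v\<close> to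
  \<open>v'\<close> and lets \<open>w'\<close> join their two successors.\<close>

lemma cyc_insert_cross:
  assumes c: "cyc E xs" and sym: "symp E" and v: "v \<in> set xs" "v' \<in> set xs" "v \<noteq> v'"
    and w: "w \<notin> set xs" "w' \<notin> set xs" "w \<noteq> w'"
    and e: "E w v" "E w v'" "E w' (nxt xs v)" "E w' (nxt xs v')"
  obtains ys where "cyc E ys" "set ys = insert w (insert w' (set xs))" "length ys = length xs + 2"
proof -
  obtain A B where A: "A \<noteq> []" "B \<noteq> []" "cyc E (A @ B)" "set (A @ B) = set xs"
    "length (A @ B) = length xs" "last A = v" "last B = v'" "hd B = nxt xs v" "hd A = nxt xs v'"
    by (rule cyc_split2[OF c v])
  have s: "E a b \<Longrightarrow> E b a" for a b using sym by (rule sympD)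
  have AB: "successively E A" "successively E B" "distinct A" "distinct B" "set A \<inter> set B = {}"
    using cycD[OF A(3)] by (simp_all add: successively_append_iff)
  moreover have "successively E (rev B)"
    unfolding successively_rev by (rule successively_mono[OF AB(2)]) (rule s)
  moreover have "w \<notin> set A" "w \<notin> set B" "w' \<notin> set A" "w' \<notin> set B" using A(4) w by auto
  ultimately have "cyc E (A @ [w] @ rev B @ [w'])"
    using A w e[THEN s] e cycD(2)[OF c]
    by (intro cycI) (auto simp: successively_append_iff successively_Cons hd_rev last_rev)
  then show thesis using A(4,5) by (intro that[of "A @ [w] @ rev B @ [w']"]) auto
qed

text \<open>The path \<open>p, q, p'\<close> takes the place of the vertex behind \<open>v\<close>:
  three vertices in, one out.\<close>

lemma cyc_replace:
  assumes c: "cyc E xs" and v: "v \<in> set xs"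
    and w: "p \<notin> set xs" "q \<notin> set xs" "p' \<notin> set xs" "distinct [p, q, p']"
    and e: "E v p" "E p q" "E q p'" "E p' (nxt xs (nxt xs v))" and len: "4 \<le> length xs"
  obtains ys where "cyc E ys" "set ys \<subseteq> {p, q, p'} \<union> set xs" "length ys = length xs + 2"
proof -
  obtain A where A: "cyc E A" "set A = set xs" "length A = length xs" "last A = v" "hd A = nxt xs v"
    and nA: "\<And>u. u \<in> set xs \<Longrightarrow> nxt A u = nxt xs u"
    by (rule cyc_split[OF c v]) blast
  define x where "x = nxt xs v"
  obtain C where C: "A = x # C" using cycD(3)[OF A(1)] A(5) x_def by (cases A) auto
  have lC: "3 \<le> length C" "C \<noteq> []" using C A(3) len by auto
  have "nxt xs x = nxt A x" using nA[of x] A(2) C by (metis list.set_intros(1))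
  also have "\<dots> = hd C" using nxt_append[of x "[]" C] C lC by simp
  finally have hC: "hd C = nxt xs x" by simp
  have sC: "successively E C" "distinct C" "last C = v" "x \<notin> set C" "set C \<subseteq> set xs"
    using cycD[OF A(1)] C lC A(2,4) by (auto simp: successively_Cons)
  have pq: "p \<notin> set C" "q \<notin> set C" "p' \<notin> set C" using w sC(5) by auto
  have "cyc E (C @ [p, q, p'])"
    using sC(1-3) lC hC w(4) e x_def pq by (intro cycI) (auto simp: successively_append_iff successively_Cons)
  then show thesis using sC(5) C A(3) by (intro that[of "C @ [p, q, p']"]) auto
qed

section \<open>Alternating cycles from Hall's theorem, and counting along a cycle\<close>

lemma cyc_complete_bipartite:
  assumes "finite A" "finite B" "A \<inter> B = {}" "r \<le> card A" "r \<le> card B" "2 \<le> r"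
    and E: "\<And>a b. a \<in> A \<Longrightarrow> b \<in> B \<Longrightarrow> E a b" "\<And>a b. a \<in> A \<Longrightarrow> b \<in> B \<Longrightarrow> E b a"
  obtains ys where "cyc E ys" "set ys \<subseteq> A \<union> B" "length ys = 2 * r"
proof -
  obtain A' where A': "A' \<subseteq> A" "card A' = r" using assms(4) by (rule obtain_subset_with_card_n) 
  obtain B' where B': "B' \<subseteq> B" "card B' = r" using assms(5) by (rule obtain_subset_with_card_n)
  obtain us where us: "set us = A'" "distinct us" using finite_distinct_list[of A'] A' assms(1) finite_subset by blast
  obtain xs where xs: "set xs = B'" "distinct xs" using finite_distinct_list[of B'] B' assms(2) finite_subset by blast
  have l: "length us = r" "length xs = r" using us xs A' B' distinct_card[of us] distinct_card[of xs] by auto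
  have m: "us ! i \<in> A" "xs ! i \<in> B" if "i < r" for i
    using that l us xs A' B' nth_mem[of i us] nth_mem[of i xs] by auto
  have md: "Suc i mod r < r" for i using assms(6) by simp
  have d: "set us \<inter> set xs = {}" using us xs A' B' assms(3) by auto
  obtain ys where "cyc E ys" "set ys = set us \<union> set xs" "length ys = 2 * r"
    by (rule alternating_cycle[where E=E, OF assms(6) l us(2) xs(2) d]) (use E m md in blast)+
  then show thesis using that us xs A' B' by blast
qed

text \<open>The order of \<open>us\<close> is fixed in advance, and Hall's theorem picks distinct
  common neighbours of cyclically consecutive vertices. The later proofs exploit the freedom in
  choosing this order.\<close>

lemma hall_cycle:
  assumes us: "distinct us" "length us = r" "2 \<le> r" and X: "finite X" "set us \<inter> X = {}"
    and H: "\<And>J. J \<subseteq> {..<r} \<Longrightarrow> J \<noteq> {} \<Longrightarrow>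
      card J \<le> card (\<Union>i\<in>J. {x \<in> X. E (us ! i) x \<and> E x (us ! (Suc i mod r))})"
  obtains ys where "cyc E ys" "set ys \<subseteq> set us \<union> X" "length ys = 2 * r"
proof -
  let ?A = "\<lambda>i. {x \<in> X. E (us ! i) x \<and> E x (us ! (Suc i mod r))}"
  obtain xs where xs: "length xs = r" "distinct xs" "\<And>i. i < r \<Longrightarrow> xs ! i \<in> ?A i"
    by (rule hall_list[of r ?A]) (use X H in auto)
  have sX: "set xs \<subseteq> X" using xs(1,3) by (auto simp: in_set_conv_nth)
  then have d: "set us \<inter> set xs = {}" using X(2) by auto
  obtain ys where "cyc E ys" "set ys = set us \<union> set xs" "length ys = 2 * r"
    by (rule alternating_cycle[where E=E, OF us(3,2) xs(1) us(1) xs(2) d]) (use xs(3) in auto)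
  then show thesis using that sX by blast
qed

text \<open>For odd cycles the ends of \<open>us\<close> are joined by an edge, so only
  \<open>r\<close> pairs among the \<open>r + 1\<close> vertices ask for a common neighbour.\<close>

lemma hall_path:
  assumes us: "distinct us" "length us = Suc r" "1 \<le> r" and X: "finite X" "set us \<inter> X = {}"
    and H: "\<And>J. J \<subseteq> {..<r} \<Longrightarrow> J \<noteq> {} \<Longrightarrow>
      card J \<le> card (\<Union>i\<in>J. {x \<in> X. E (us ! i) x \<and> E x (us ! Suc i)})"
    and close: "E (us ! r) (us ! 0)"
  obtains ys where "cyc E ys" "set ys \<subseteq> set us \<union> X" "length ys = 2 * r + 1"
proof -
  let ?A = "\<lambda>i. {x \<in> X. E (us ! i) x \<and> E x (us ! Suc i)}"
  obtain xs where xs: "length xs = r" "distinct xs" "\<And>i. i < r \<Longrightarrow> xs ! i \<in> ?A i"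
    by (rule hall_list[of r ?A]) (use X H in auto)
  have sX: "set xs \<subseteq> X" using xs(1,3) by (auto simp: in_set_conv_nth)
  then have d: "set us \<inter> set xs = {}" using X(2) by auto
  obtain ys where "cyc E ys" "set ys = set us \<union> set xs" "length ys = 2 * r + 1"
    by (rule alternating_path[where E=E, OF us(3,2) xs(1) us(1) xs(2) d]) (use xs(3) close in auto)
  then show thesis using that sX by blast
qed

text \<open>A union with fewer than \<open>card J \<le> r\<close> elements has no room beyond a
  single set with \<open>r - 1\<close> elements, so it equals each of the sets.\<close>

lemma hall_deficit_one:
  assumes "finite J" "J \<noteq> {}" "\<And>i. i \<in> J \<Longrightarrow> finite (A i)" "\<And>i. i \<in> J \<Longrightarrow> r - 1 \<le> card (A i)"
    and "card J \<le> r" "card (\<Union>(A ` J)) < card J"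
  shows "card J = r" "\<And>i j. i \<in> J \<Longrightarrow> j \<in> J \<Longrightarrow> A i = A j \<and> card (A i) = r - 1"
proof -
  have fin: "finite (\<Union>(A ` J))" using assms by auto
  have le: "card (A i) \<le> card (\<Union>(A ` J))" if "i \<in> J" for i
    using that fin by (intro card_mono) auto
  obtain i0 where "i0 \<in> J" using assms(2) by blast
  then have ge: "r - 1 \<le> card (\<Union>(A ` J))" using le assms(4) order_trans by blast
  show r: "card J = r" using ge assms(5,6) by linarith
  then have U: "card (\<Union>(A ` J)) = r - 1" using ge assms(6) by linarith
  have "A i = \<Union>(A ` J)" if "i \<in> J" for i
    using that fin U assms(4)[OF that] by (intro card_seteq) auto
  then show "A i = A j \<and> card (A i) = r - 1" if "i \<in> J" "j \<in> J" for i j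
    using that U by metis
qed

text \<open>\<open>U\<close> and its image under the cyclic shift both lie in \<open>set zs\<close>,
  so they overlap in at least \<open>2 * card U - length zs\<close> vertices.\<close>

lemma consecutive_pairs:
  assumes zs: "distinct zs" and U: "U \<subseteq> set zs" and c: "length zs + k \<le> 2 * card U"
  shows "k \<le> card {v \<in> U. nxt zs v \<in> U}"
proof -
  let ?f = "nxt zs"
  have bij: "bij_betw ?f (set zs) (set zs)" using zs by (rule bij_nxt)
  have fU: "finite U" using U finite_subset by auto
  have inj: "inj_on ?f U" using bij U by (auto simp: bij_betw_def intro: inj_on_subset)
  have im: "?f ` U \<subseteq> set zs" using bij U by (auto simp: bij_betw_def)
  have "card U + card (?f ` U) = card (U \<union> ?f ` U) + card (U \<inter> ?f ` U)"
    using fU by (intro card_Un_Int) auto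
  moreover have "card (?f ` U) = card U" using inj by (rule card_image)
  moreover have "card (U \<union> ?f ` U) \<le> length zs"
    using card_mono[of "set zs" "U \<union> ?f ` U"] U im card_length[of zs] by auto
  moreover have "card (U \<inter> ?f ` U) \<le> card {v \<in> U. ?f v \<in> U}"
  proof -
    have "U \<inter> ?f ` U \<subseteq> ?f ` {v \<in> U. ?f v \<in> U}" by auto
    then have "card (U \<inter> ?f ` U) \<le> card (?f ` {v \<in> U. ?f v \<in> U})"
      using fU by (intro card_mono) auto
    also have "\<dots> \<le> card {v \<in> U. ?f v \<in> U}" using fU by (intro card_image_le) auto
    finally show ?thesis .
  qed
  ultimately show ?thesis using c by linarith
qed

text \<open>A consecutive pair inside the union crosses from one set to the other, in one of two
  directions, or lies within one set. The kinds are bounded separately because different insertions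
  into a cycle exclude them.\<close>

lemma union_bound:
  assumes zs: "distinct zs" and S: "S \<subseteq> set zs" "S' \<subseteq> set zs"
    and "card {v \<in> S. nxt zs v \<in> S'} \<le> a" "card {v \<in> S'. nxt zs v \<in> S} \<le> b"
    and "card {v \<in> set zs. v \<in> S \<and> nxt zs v \<in> S \<or> v \<in> S' \<and> nxt zs v \<in> S'} \<le> c"
  shows "2 * card (S \<union> S') \<le> length zs + a + b + c"
proof (cases "length zs \<le> 2 * card (S \<union> S')")
  case True
  let ?X = "{v \<in> S. nxt zs v \<in> S'}" and ?Y = "{v \<in> S'. nxt zs v \<in> S}"
    and ?Z = "{v \<in> set zs. v \<in> S \<and> nxt zs v \<in> S \<or> v \<in> S' \<and> nxt zs v \<in> S'}"
  have "2 * card (S \<union> S') - length zs \<le> card {v \<in> S \<union> S'. nxt zs v \<in> S \<union> S'}"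
    using True S by (intro consecutive_pairs[OF zs]) auto
  also have "\<dots> \<le> card (?X \<union> ?Y \<union> ?Z)"
    using S finite_subset[OF S(1)] finite_subset[OF S(2)] by (intro card_mono) auto
  also have "\<dots> \<le> a + b + c"
    using card_Un_le[of "?X \<union> ?Y" ?Z] card_Un_le[of ?X ?Y] assms(4-6) by linarith
  finally show ?thesis by linarith
qed simp

section \<open>Two-colored complete multipartite graphs\<close>

lemma ex_two_if_card_ge_2:
  assumes "2 \<le> card A"
  obtains a b where "a \<in> A" "b \<in> A" "a \<noteq> b"
proof -
  obtain B where "B \<subseteq> A" "card B = 2" using assms by (rule obtain_subset_with_card_n)
  then show thesis using that by (auto simp: card_2_iff)
qed

text \<open>The reduced colorings: pairs with neither color form the parts of a complete multipartite
  graph, and the vertices of a part are twins.\<close>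

locale bicol =
  fixes V :: "'a set" and red blue :: "'a \<Rightarrow> 'a \<Rightarrow> bool"
  assumes fin: "finite V"
    and symr: "red x y \<Longrightarrow> red y x" and symb: "blue x y \<Longrightarrow> blue y x"
    and irr: "\<not> red x x" "\<not> blue x x"
    and disj: "red x y \<Longrightarrow> \<not> blue x y"
    and twin: "x \<in> V \<Longrightarrow> y \<in> V \<Longrightarrow> \<not> red x y \<Longrightarrow> \<not> blue x y \<Longrightarrow> z \<in> V \<Longrightarrow>
      red x z = red y z \<and> blue x z = blue y z"
begin

lemma swap: "bicol V blue red"
  by unfold_locales (use fin symr symb irr disj twin in blast)+

definition part :: "'a \<Rightarrow> 'a set" where
  "part x = {y \<in> V. \<not> red x y \<and> \<not> blue x y}"

definition mono_cyc :: "nat \<Rightarrow> bool" where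
  "mono_cyc L \<longleftrightarrow> (\<exists>xs. set xs \<subseteq> V \<and> length xs = L \<and> (cyc red xs \<or> cyc blue xs))"

lemma swap_part: "bicol.part V blue red x = part x"
  using bicol.part_def[OF swap] by (auto simp: part_def)

lemma swap_mono: "bicol.mono_cyc V blue red L = mono_cyc L"
  using bicol.mono_cyc_def[OF swap] by (auto simp: mono_cyc_def)

lemma sympr: "symp red" and sympb: "symp blue"
  using symr symb by (auto intro: sympI)

lemma monoI: "cyc red xs \<Longrightarrow> set xs \<subseteq> V \<Longrightarrow> mono_cyc (length xs)"
  "cyc blue xs \<Longrightarrow> set xs \<subseteq> V \<Longrightarrow> mono_cyc (length xs)"
  by (auto simp: mono_cyc_def)

end

section \<open>Complete two-colored graphs: shortening odd cycles, and four-cycles\<close>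

lemma cyc_map_upt:
  assumes "3 \<le> n" "inj_on g {..<n}" "\<And>j. Suc j < n \<Longrightarrow> E (g j) (g (Suc j))" "E (g (n - 1)) (g 0)"
  shows "cyc E (map g [0..<n])"
proof (rule cycI)
  show "distinct (map g [0..<n])" using assms(2) by (simp add: distinct_map atLeast0LessThan)
  show "successively E (map g [0..<n])" using assms(3) by (auto simp: successively_conv_nth)
  show "E (last (map g [0..<n])) (hd (map g [0..<n]))"
    using assms(1,4) by (simp add: last_map hd_map)
qed (use assms in auto)

text \<open>2 is invertible modulo an odd number, so steps of length two along an odd cycle visit
  every vertex once.\<close>

lemma odd_double_mod_inj:
  fixes L :: nat
  assumes "odd L" "j < L" "k < L" "(a + 2 * j) mod L = (a + 2 * k) mod L"
  shows "j = k"
proof -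
  have *: "k = j" if "k \<le> j" "j < L" "(a + 2 * j) mod L = (a + 2 * k) mod L" for j k
  proof -
    have "L dvd (a + 2 * j) - (a + 2 * k)" using that by (subst mod_eq_dvd_iff_nat[symmetric]) auto
    then have "L dvd 2 * (j - k)" by (simp add: diff_mult_distrib2)
    moreover have "coprime L 2" using assms(1) by simp
    ultimately have "L dvd j - k" by (simp add: coprime_dvd_mult_right_iff)
    then show ?thesis using that by (meson dvd_imp_le less_imp_diff_less not_less zero_less_diff nat_less_le)
  qed
  show ?thesis using *[of j k] *[of k j] assms by (cases "k \<le> j") auto
qed

context bicol
begin

text \<open>If no cycle is one shorter, the chords of length two are all blue, so they form a blue
  Hamiltonian cycle, and by the same argument the chords of length four are red.\<close>

lemma odd_descent_red:
  assumes pure: "\<And>x y. x \<in> V \<Longrightarrow> y \<in> V \<Longrightarrow> x \<noteq> y \<Longrightarrow> red x y \<or> blue x y"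
    and xs: "cyc red xs" "set xs \<subseteq> V" and L: "odd (length xs)" "7 \<le> length xs"
  shows "mono_cyc (length xs - 1)"
proof (rule ccontr)
  assume no: "\<not> mono_cyc (length xs - 1)"
  define L where "L = length xs"
  define c where "c i = xs ! (i mod L)" for i
  have L7: "7 \<le> L" "odd L" using L by (auto simp: L_def)
  have d: "distinct xs" using cycD[OF xs(1)] by simp
  have cV: "c i \<in> V" for i
  proof -
    have "i mod L < L" using L7 by auto
    then show ?thesis using xs(2) nth_mem[of "i mod L" xs] by (auto simp: c_def L_def)
  qed
  have ceq: "c i = c j \<longleftrightarrow> i mod L = j mod L" for i j
  proof -
    have "i mod L < L" "j mod L < L" using L7 by auto
    then show ?thesis using d by (simp add: c_def L_def nth_eq_iff_index_eq)
  qed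
  have cper: "c (i + L) = c i" "c (i + 2 * L) = c i" for i by (auto simp: ceq)
  have c1: "red (c i) (c (Suc i))" for i
  proof -
    have "i mod L < L" using L7 by auto
    then have "red (xs ! (i mod L)) (xs ! (Suc (i mod L) mod L))"
      using xs(1) unfolding cyc_conv_nth L_def by blast
    then show ?thesis by (simp add: c_def mod_Suc_eq)
  qed
  have ne: "c i \<noteq> c (i + k)" if "0 < k" "k < L" for i k
  proof
    assume "c i = c (i + k)"
    then have "L dvd i + k - i" using ceq by (subst mod_eq_dvd_iff_nat[symmetric]) auto
    then show False using that by (simp add: nat_dvd_not_less)
  qed
  have nocyc: False if "cyc E (map g [0..<L - 1])" "E = red \<or> E = blue" "\<And>j. g j \<in> V" for E g
  proof -
    have "set (map g [0..<L - 1]) \<subseteq> V" "length (map g [0..<L - 1]) = length xs - 1"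
      using that(3) by (auto simp: L_def)
    then show False using that(1,2) no unfolding mono_cyc_def by blast
  qed
  \<comment> \<open>A red chord would let the red cycle skip \<open>c (i + 1)\<close>.\<close>
  have c2: "blue (c i) (c (i + 2))" for i
  proof (rule ccontr)
    assume "\<not> ?thesis"
    then have r: "red (c i) (c (i + 2))" using pure[OF cV cV] ne[of 2 i] L7 by auto
    let ?g = "\<lambda>j. c (i + 2 + j)"
    have "cyc red (map ?g [0..<L - 1])"
    proof (rule cyc_map_upt)
      show "inj_on ?g {..<L - 1}"
      proof (rule linorder_inj_onI)
        fix j k assume jk: "j < k" "j \<in> {..<L - 1}" "k \<in> {..<L - 1}"
        then show "?g j \<noteq> ?g k" using ne[of "k - j" "i + 2 + j"] by auto
      qed auto
      have "i + 2 + (L - 1 - 1) = i + L" using L7 by simp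
      then have "?g (L - 1 - 1) = c i" by (simp only: cper)
      then show "red (?g (L - 1 - 1)) (?g 0)" using r by simp
    qed (use L7 c1 in auto)
    then show False by (rule nocyc) (use cV in auto)
  qed
  \<comment> \<open>A blue chord would let the blue cycle of steps of length two skip
    \<open>c (i + 2)\<close>.\<close>
  have c4: "red (c i) (c (i + 4))" for i
  proof (rule ccontr)
    assume "\<not> ?thesis"
    then have r: "blue (c i) (c (i + 4))" using pure[OF cV cV] ne[of 4 i] L7 by auto
    let ?g = "\<lambda>j. c (i + 4 + 2 * j)"
    have "cyc blue (map ?g [0..<L - 1])"
    proof (rule cyc_map_upt)
      show "inj_on ?g {..<L - 1}"
      proof (rule inj_onI)
        fix j k assume jk: "j \<in> {..<L - 1}" "k \<in> {..<L - 1}" "?g j = ?g k"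
        have "j < L" "k < L" using jk by auto
        moreover have "(i + 4 + 2 * j) mod L = (i + 4 + 2 * k) mod L" using jk(3) by (simp only: ceq)
        ultimately show "j = k" by (rule odd_double_mod_inj[OF L7(2)])
      qed
      have "i + 4 + 2 * (L - 1 - 1) = i + 2 * L" using L7 by simp
      then have "?g (L - 1 - 1) = c i" by (simp only: cper)
      then show "blue (?g (L - 1 - 1)) (?g 0)" using r by simp
      show "blue (?g j) (?g (Suc j))" for j using c2[of "i + 4 + 2 * j"] by (simp add: algebra_simps)
    qed (use L7 in auto)
    then show False by (rule nocyc) (use cV in auto)
  qed
  \<comment> \<open>The vertex 6 is left out. The steps 0-4, 5-1 and 3-7 are red chords of length
    four, the others edges of the cycle. For \<open>L = 7\<close> the step 3-7 already returns to
    the start.\<close>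
  let ?is = "[0, 4, 5, 1, 2, 3] @ [7..<L]"
  have lis: "length ?is = L - 1" using L7 by simp
  have "cyc red (map c ?is)"
  proof (rule cycI)
    have "inj_on c (set ?is)"
    proof (rule linorder_inj_onI)
      fix j k assume jk: "j < k" "j \<in> set ?is" "k \<in> set ?is"
      then have "k < L" using L7 by auto
      then show "c j \<noteq> c k" using jk ne[of "k - j" j] by auto
    qed auto
    then show "distinct (map c ?is)" by (simp add: distinct_map)
    have c3: "red (c 0) (c 4)" "red (c 4) (c 5)" "red (c 5) (c 1)" "red (c 1) (c 2)" "red (c 2) (c 3)" "red (c 3) (c 7)"
      using c4[of 0] c1[of 4] symr[OF c4[of 1]] c1[of 1] c1[of 2] c4[of 3]
      by (simp_all add: numeral_eq_Suc)
    have "red (c (7 + i)) (c (8 + i))" for i using c1[of "7 + i"] by simp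
    then have s: "successively red (map c [7..<L])" by (simp add: successively_conv_nth)
    have h: "hd (map c [7..<L]) = c 7" if "7 < L" using that by (simp add: hd_map)
    show "successively red (map c ?is)"
    proof (cases "L = 7")
      case True
      then show ?thesis using c3 by (simp add: successively_Cons)
    next
      case False
      then have "7 < L" using L7 by simp
      then show ?thesis using c3 s h by (simp add: successively_Cons hd_map)
    qed
    have c0: "c L = c 0" using cper(1)[of 0] by simp
    show "red (last (map c ?is)) (hd (map c ?is))"
    proof (cases "L = 7")
      case True
      then show ?thesis using c3(6) c0 by simp
    next
      case False
      then have "last (map c ?is) = c (L - 1)" using L7 by (simp add: last_map)
      then show ?thesis using c1[of "L - 1"] c0 L7 by simp
    qed
  qed (use lis L7 in simp)
  moreover have "set (map c ?is) \<subseteq> V" using cV by auto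
  ultimately show False using no lis unfolding mono_cyc_def L_def by (metis length_map)
qed

lemma odd_descent:
  assumes pure: "\<And>x y. x \<in> V \<Longrightarrow> y \<in> V \<Longrightarrow> x \<noteq> y \<Longrightarrow> red x y \<or> blue x y"
    and L: "odd L" "7 \<le> L" "mono_cyc L"
  shows "mono_cyc (L - 1)"
proof -
  interpret S: bicol V blue red by (rule swap)
  obtain xs where "set xs \<subseteq> V" "length xs = L" "cyc red xs \<or> cyc blue xs"
    using L(3) by (auto simp: mono_cyc_def)
  then show ?thesis
    using odd_descent_red[of xs] S.odd_descent_red[of xs] pure L swap_mono by blast
qed

text \<open>A further vertex with two red neighbours in \<open>A\<close> closes a red four-cycle
  through \<open>v\<close>. Otherwise two further vertices have three blue neighbours each among the
  four of \<open>A\<close>, hence two in common.\<close>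

lemma mono4_red:
  assumes pure: "\<And>x y. x \<in> V \<Longrightarrow> y \<in> V \<Longrightarrow> x \<noteq> y \<Longrightarrow> red x y \<or> blue x y"
    and v: "v \<in> V" and A: "A \<subseteq> {x \<in> V. red v x}" "card A = 4" and V: "7 \<le> card V"
  shows "mono_cyc 4"
proof (rule ccontr)
  assume no: "\<not> mono_cyc 4"
  have fA: "finite A" using A(2) card.infinite by force
  have ne: "v \<notin> A" using A irr by auto
  have le1: "card {x \<in> A. red u x} \<le> 1" if u: "u \<in> V" "u \<notin> A" "u \<noteq> v" for u
  proof (rule ccontr)
    assume "\<not> ?thesis"
    then obtain a b where ab: "a \<in> A" "b \<in> A" "red u a" "red u b" "a \<noteq> b"
      using card_le_Suc0_iff_eq[of "{x \<in> A. red u x}"] fA by auto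
    have "cyc red [v, a, u, b]"
      using ab A u ne symr by (intro cycI) (auto simp: successively_Cons)
    moreover have "set [v, a, u, b] \<subseteq> V" using ab A u v by auto
    ultimately show False using no unfolding mono_cyc_def by force
  qed
  have "card (insert v A) = 5" using fA ne A by simp
  then have "2 \<le> card (V - insert v A)"
    using V A v fA by (subst card_Diff_subset) auto
  then obtain u u' where u: "u \<in> V - insert v A" "u' \<in> V - insert v A" "u \<noteq> u'"
    by (rule ex_two_if_card_ge_2)
  have b3: "3 \<le> card {x \<in> A. blue w x}" if w: "w \<in> V - insert v A" for w
  proof -
    have "A = {x \<in> A. red w x} \<union> {x \<in> A. blue w x}" using pure[of w] w A by auto
    then have "4 \<le> card {x \<in> A. red w x} + card {x \<in> A. blue w x}"
      using card_Un_le[of "{x \<in> A. red w x}" "{x \<in> A. blue w x}"] A(2) by simp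
    then show ?thesis using le1[of w] w by auto
  qed
  let ?B = "{x \<in> A. blue u x}" and ?C = "{x \<in> A. blue u' x}"
  have "card ?B + card ?C = card (?B \<union> ?C) + card (?B \<inter> ?C)"
    using fA by (intro card_Un_Int) auto
  moreover have "card (?B \<union> ?C) \<le> 4" using card_mono[OF fA, of "?B \<union> ?C"] A(2) by auto
  ultimately have "2 \<le> card (?B \<inter> ?C)" using b3[OF u(1)] b3[OF u(2)] by linarith
  then obtain a b where ab: "a \<in> ?B \<inter> ?C" "b \<in> ?B \<inter> ?C" "a \<noteq> b"
    by (rule ex_two_if_card_ge_2)
  have "cyc blue [u, a, u', b]"
    using ab u symb by (intro cycI) (auto simp: successively_Cons)
  moreover have "set [u, a, u', b] \<subseteq> V" using ab A u by auto
  ultimately show False using no unfolding mono_cyc_def by force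
qed

lemma mono4:
  assumes pure: "\<And>x y. x \<in> V \<Longrightarrow> y \<in> V \<Longrightarrow> x \<noteq> y \<Longrightarrow> red x y \<or> blue x y" and V: "8 \<le> card V"
  shows "mono_cyc 4"
proof -
  interpret S: bicol V blue red by (rule swap)
  obtain v where v: "v \<in> V" using V by (metis card.empty ex_in_conv not_numeral_le_zero)
  let ?R = "{x \<in> V. red v x}" and ?B = "{x \<in> V. blue v x}"
  have "V - {v} \<subseteq> ?R \<union> ?B" using pure[OF v] by auto
  then have "card (V - {v}) \<le> card ?R + card ?B"
    using fin card_mono[of "?R \<union> ?B" "V - {v}"] card_Un_le[of ?R ?B] by auto
  then have "4 \<le> card ?R \<or> 4 \<le> card ?B" using v V fin by (simp, linarith)
  then show ?thesis
  proof
    assume "4 \<le> card ?R"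
    then obtain A where "A \<subseteq> ?R" "card A = 4" by (rule obtain_subset_with_card_n)
    then show ?thesis using mono4_red[OF pure v] V by auto
  next
    assume "4 \<le> card ?B"
    then obtain A where "A \<subseteq> ?B" "card A = 4" by (rule obtain_subset_with_card_n)
    then show ?thesis using S.mono4_red[of v A] pure v V swap_mono by auto
  qed
qed

end

section \<open>Singleton parts\<close>

locale redcycle = bicol +
  fixes zs
  assumes cz: "cyc red zs" and zV: "set zs \<subseteq> V"
    and no2: "cyc red ys \<Longrightarrow> set ys \<subseteq> V \<Longrightarrow> length ys = length zs + 2 \<Longrightarrow> False"
begin

definition S :: "'a \<Rightarrow> 'a set" where
  "S w = {v \<in> set zs. red w v}"

definition T :: "'a \<Rightarrow> 'a \<Rightarrow> 'a set" where
  "T w w' = {x \<in> set zs. blue w x \<and> blue x w'}"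

lemma S_sub: "S w \<subseteq> set zs" by (auto simp: S_def)

lemma finS: "finite (S w)" by (simp add: S_def)

lemma finT: "finite (T w w')" by (simp add: T_def)

lemma T_commute: "T w w' = T w' w" using symb by (auto simp: T_def)

text \<open>Two such pairs would allow the insertion of \<open>w\<close> and \<open>w'\<close> with
  one arc reversed.\<close>

lemma cross_le_1:
  assumes "w \<in> V - set zs" "w' \<in> V - set zs" "w \<noteq> w'"
  shows "card {v \<in> S w. nxt zs v \<in> S w'} \<le> 1"
proof (rule ccontr)
  assume "\<not> ?thesis"
  then have "2 \<le> card {v \<in> S w. nxt zs v \<in> S w'}" by simp
  then obtain v v' where v: "v \<in> {v \<in> S w. nxt zs v \<in> S w'}" "v' \<in> {v \<in> S w. nxt zs v \<in> S w'}" "v \<noteq> v'"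
    by (rule ex_two_if_card_ge_2)
  obtain ys where "cyc red ys" "set ys = insert w (insert w' (set zs))" "length ys = length zs + 2"
    by (rule cyc_insert_cross[OF cz sympr, of v v' w w']) (use v assms in \<open>auto simp: S_def\<close>)
  then show False using no2[of ys] assms zV by auto
qed

lemma insert_same:
  assumes "w \<in> V - set zs" "w' \<in> V - set zs" "w \<noteq> w'"
    and "v \<in> S w" "nxt zs v \<in> S w" "v' \<in> S w'" "nxt zs v' \<in> S w'"
  shows "v = v'"
proof (rule ccontr)
  assume "v \<noteq> v'"
  then obtain ys where "cyc red ys" "set ys = insert w (insert w' (set zs))" "length ys = length zs + 2"
    by (rule cyc_insert2[OF cz, of v v' w w', rotated 2]) (use assms symr in \<open>auto simp: S_def\<close>)
  then show False using no2[of ys] assms zV by auto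
qed

lemma insert_edge:
  assumes "w \<in> V - set zs" "w' \<in> V - set zs" "red w w'" "v \<in> S w" "nxt zs v \<in> S w'"
  shows False
proof -
  have "w \<noteq> w'" using assms(3) irr by auto
  obtain ys where "cyc red ys" "set ys = insert w (insert w' (set zs))" "length ys = length zs + 2"
    by (rule cyc_insert_edge[OF cz, of v w w']) (use assms symr \<open>w \<noteq> w'\<close> in \<open>auto simp: S_def\<close>)
  then show False using no2[of ys] assms zV by auto
qed

lemma no_insert:
  assumes "\<not> mono_cyc (length zs + 1)" "w \<in> V - set zs" "v \<in> S w" "nxt zs v \<in> S w"
  shows False
proof -
  obtain ys where "cyc red ys" "set ys = insert w (set zs)" "length ys = length zs + 1"
    by (rule cyc_insert1[OF cz, of v w]) (use assms symr in \<open>auto simp: S_def\<close>)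
  then show False using monoI(1)[of ys] assms zV by auto
qed

lemma card_union_S:
  assumes "w \<in> V - set zs" "w' \<in> V - set zs" "w \<noteq> w'"
    and "card {v \<in> set zs. v \<in> S w \<and> nxt zs v \<in> S w \<or> v \<in> S w' \<and> nxt zs v \<in> S w'} \<le> c"
  shows "2 * card (S w \<union> S w') \<le> length zs + 2 + c"
  using union_bound[OF cycD(1)[OF cz] S_sub S_sub cross_le_1[OF assms(1-3)] cross_le_1[OF assms(2,1) assms(3)[symmetric]] assms(4)]
  by simp

lemma T_pure:
  assumes pure: "\<And>x y. x \<in> V \<Longrightarrow> y \<in> V \<Longrightarrow> x \<noteq> y \<Longrightarrow> red x y \<or> blue x y"
    and "w \<in> V - set zs" "w' \<in> V - set zs"
  shows "T w w' = set zs - (S w \<union> S w')"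
proof -
  have "blue u x \<longleftrightarrow> \<not> red u x" if "x \<in> set zs" "u \<in> V - set zs" for x u
    using pure[of u x] disj[of u x] that zV by blast
  then show ?thesis using assms(2,3) symb unfolding T_def S_def by blast
qed

text \<open>Each vertex of \<open>U\<close> lies in at least two of the three sets, so any two
  vertices of \<open>U\<close> share one of them. For consecutive vertices this is an insertion
  place.\<close>

lemma three_cover:
  assumes eq: "S x \<union> S y = U" "S y \<union> S z = U" "S x \<union> S z = U"
    and v: "v \<in> U" "nxt zs v \<in> U"
    and no: "\<And>w. w \<in> {x, y, z} \<Longrightarrow> v \<in> S w \<Longrightarrow> nxt zs v \<in> S w \<Longrightarrow> False"
  shows False
  using assms by blast

end

lemma distinct_list_in:
  assumes "finite A" "t \<le> card A"
  obtains us where "distinct us" "set us \<subseteq> A" "length us = t"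
proof -
  obtain B where B: "B \<subseteq> A" "card B = t" using assms(2) by (rule obtain_subset_with_card_n)
  obtain us where "set us = B" "distinct us"
    using finite_distinct_list[of B] B assms(1) finite_subset by blast
  then show thesis using that[of us] B distinct_card[of us] by auto
qed

section \<open>Complete two-colored graphs with a red cycle of length \<open>2 * m\<close> or
  \<open>2 * m + 1\<close> that cannot be extended\<close>

locale pure_redcycle = redcycle +
  fixes m :: nat
  assumes pure: "x \<in> V \<Longrightarrow> y \<in> V \<Longrightarrow> x \<noteq> y \<Longrightarrow> red x y \<or> blue x y"
    and V: "card V = 3 * m + 2" and m2: "2 \<le> m"
    and nom: "\<not> mono_cyc (2 * m + 2)"
    and noi: "w \<in> V - set zs \<Longrightarrow> v \<in> S w \<Longrightarrow> nxt zs v \<in> S w \<Longrightarrow> False"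
begin

abbreviation W where "W \<equiv> V - set zs"

lemma card_zs: "card (set zs) = length zs" using cycD(1)[OF cz] distinct_card by blast

lemma card_W: "card W = 3 * m + 2 - length zs"
  using fin zV V card_zs by (simp add: card_Diff_subset)

lemma card_union: "w \<in> W \<Longrightarrow> w' \<in> W \<Longrightarrow> w \<noteq> w' \<Longrightarrow> 2 * card (S w \<union> S w') \<le> length zs + 2"
proof -
  assume w: "w \<in> W" "w' \<in> W" "w \<noteq> w'"
  have "{v \<in> set zs. v \<in> S w \<and> nxt zs v \<in> S w \<or> v \<in> S w' \<and> nxt zs v \<in> S w'} = {}"
    using noi w by blast
  then show ?thesis using card_union_S[OF w, of 0] by simp
qed

lemma card_T: "w \<in> W \<Longrightarrow> w' \<in> W \<Longrightarrow> card (T w w') = length zs - card (S w \<union> S w')"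
  using T_pure[OF pure, of w w'] S_sub finS card_zs by (simp add: card_Diff_subset)

text \<open>Equal common blue neighbourhoods mean that the red neighbourhoods cover, in pairs, the
  same set. By \<open>c\<close> this is more than half of the cycle, so it contains two consecutive
  vertices and \<open>three_cover\<close> applies.\<close>

lemma equal_T_contra:
  assumes xyz: "x \<in> W" "y \<in> W" "z \<in> W"
    and eq: "T x y = T y z" "T y x = T x z" and c: "length zs + 1 \<le> 2 * (length zs - card (T x y))"
  shows False
proof -
  let ?U = "S x \<union> S y"
  have T: "T u w = set zs - (S u \<union> S w)" if "u \<in> W" "w \<in> W" for u w
    using T_pure[OF pure, of u w] that by simp
  have U: "S u \<union> S w = set zs - T u w" if "u \<in> W" "w \<in> W" for u w
    using T[OF that] S_sub[of u] S_sub[of w] by blast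
  have "S y \<union> S z = ?U" "S x \<union> S z = ?U" using U xyz eq T_commute by auto
  moreover have "card ?U = length zs - card (T x y)"
    using U[OF xyz(1,2)] finT card_zs by (simp add: card_Diff_subset T_def)
  then have "1 \<le> card {v \<in> ?U. nxt zs v \<in> ?U}"
    using c S_sub by (intro consecutive_pairs[OF cycD(1)[OF cz]]) auto
  then obtain v where "v \<in> ?U" "nxt zs v \<in> ?U"
    by (metis (no_types, lifting) card.empty ex_in_conv mem_Collect_eq not_one_le_zero)
  ultimately show False using three_cover[of x y ?U z v] noi xyz by blast
qed

text \<open>Outside an odd red cycle of length \<open>2 m + 1\<close> there are \<open>m + 1\<close> vertices; Hall's theorem
  closes them up to a blue cycle through common blue neighbours, unless the red neighbourhoods of any
  two of them cover the same set.\<close>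

lemma odd_contra:
  assumes L: "length zs = 2 * m + 1"
  shows False
proof -
  have cW: "card W = m + 1" using card_W L by simp
  \<comment> \<open>One short of the \<open>m + 1\<close> that would give Hall's condition at
    once.\<close>
  have Tge: "m \<le> card (T w w')" if "w \<in> W" "w' \<in> W" "w \<noteq> w'" for w w'
    using card_T[OF that(1,2)] card_union[OF that] L by linarith
  have all: "T (us ! 0) (us ! 1) = T (us ! 1) (us ! 2) \<and> card (T (us ! 0) (us ! 1)) = m"
    if us: "distinct us" "set us = W" "length us = m + 1" for us
  proof (rule ccontr)
    assume neg: "\<not> ?thesis"
    let ?A = "\<lambda>i. T (us ! i) (us ! (Suc i mod (m + 1)))"
    have in_W: "us ! i \<in> W" if "i < m + 1" for i using us that nth_mem by metis
    have md: "Suc i mod (m + 1) < m + 1" for i by simp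
    have dist: "us ! i \<noteq> us ! (Suc i mod (m + 1))" if "i < m + 1" for i
      using us that m2 by (simp add: nth_eq_iff_index_eq mod_Suc)
    obtain ys where "cyc blue ys" "set ys \<subseteq> set us \<union> set zs" "length ys = 2 * (m + 1)"
    proof (rule hall_cycle[OF us(1,3), of "set zs" blue])
      fix J assume J: "J \<subseteq> {..<m + 1}" "J \<noteq> {}"
      show "card J \<le> card (\<Union>i\<in>J. {x \<in> set zs. blue (us ! i) x \<and> blue x (us ! (Suc i mod (m + 1)))})"
      proof (rule ccontr)
        assume viol: "\<not> ?thesis"
        have fJ: "finite J" using J(1) finite_subset by blast
        have cJ: "card J \<le> m + 1" using J(1) by (metis card_lessThan card_mono finite_lessThan)
        have v: "card (\<Union>(?A ` J)) < card J" using viol by (simp add: T_def)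
        have ge: "m + 1 - 1 \<le> card (?A i)" if "i \<in> J" for i
          using Tge[OF in_W in_W[OF md] dist] that J(1) by auto
        have "card J = m + 1" by (rule hall_deficit_one(1)[OF fJ J(2) finT ge cJ v])
        then have "J = {..<m + 1}" using J(1) by (intro card_subset_eq) auto
        then have J01: "0 \<in> J" "1 \<in> J" using m2 by auto
        have "?A 0 = ?A 1 \<and> card (?A 0) = m + 1 - 1"
          by (rule hall_deficit_one(2)[OF fJ J(2) finT ge cJ v J01])
        moreover have "Suc 0 mod (m + 1) = 1" "Suc 1 mod (m + 1) = 2" using m2 by auto
        ultimately show False using neg by auto
      qed
    qed (use m2 us in auto)
    then show False using nom monoI(2)[of ys] us zV by auto
  qed
  obtain us where us: "distinct us" "set us = W" using finite_distinct_list[of W] fin by auto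
  then have l: "length us = m + 1" using cW distinct_card by metis
  have "Suc (Suc (Suc 0)) \<le> length us" using l m2 by simp
  then obtain x y z rest where u: "us = x # y # z # rest" by (auto simp: Suc_le_length_iff)
  have "T x y = T y z \<and> card (T x y) = m" using all[OF us l] u by (auto simp: numeral_2_eq_2)
  \<comment> \<open>\<open>all\<close> holds for every order of \<open>W\<close>; exchanging the
    first two vertices brings in the pair of \<open>x\<close> and \<open>z\<close>.\<close>
  moreover have "T y x = T x z \<and> card (T y x) = m"
    using all[of "y # x # z # rest"] us l u by (auto simp: numeral_2_eq_2)
  moreover have "x \<in> set us" "y \<in> set us" "z \<in> set us" using u by simp_all
  ultimately show False using equal_T_contra[of x y z] L unfolding us(2) by auto
qed

text \<open>Of an arc \<open>B\<close> with at most \<open>m\<close> vertices only the end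
  \<open>v'\<close> is kept. Its other \<open>length B - 1\<close> vertices give way to a path of
  \<open>length B + 1\<close> clique vertices from \<open>w\<close> to \<open>w'\<close>, a gain of
  two; the \<open>m + 2\<close> vertices of the clique suffice.\<close>

lemma red_clique_chord:
  assumes L: "length zs = 2 * m" and clique: "\<And>a b. a \<in> W \<Longrightarrow> b \<in> W \<Longrightarrow> a \<noteq> b \<Longrightarrow> red a b"
    and w: "w \<in> W" "w' \<in> W" "w \<noteq> w'" and v: "v \<in> S w" "v' \<in> S w'" "v \<noteq> v'"
  shows False
proof -
  have *: False
    if w: "w \<in> W" "w' \<in> W" "w \<noteq> w'" and r: "red w v" "red w' v'"
      and A: "A \<noteq> []" "B \<noteq> []" "cyc red (A @ B)" "set (A @ B) = set zs"
        "length (A @ B) = length zs" "last A = v" "last B = v'" and B: "length B \<le> m"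
    for A B w w' v v'
  proof -
    have cW: "card W = m + 2" using card_W L by simp
    have "card (W - {w, w'}) = m" using w cW fin by (subst card_Diff_subset) auto
    then have le: "length B - 1 \<le> card (W - {w, w'})" using B by simp
    have fW: "finite (W - {w, w'})" using fin by simp
    obtain us where us: "distinct us" "set us \<subseteq> W - {w, w'}" "length us = length B - 1"
      by (rule distinct_list_in[OF fW le])
    let ?ws = "w # us @ [w']"
    have ws: "distinct ?ws" "set ?ws \<subseteq> W" using us w by auto
    have sw: "successively red ?ws"
    proof -
      have "red (?ws ! i) (?ws ! Suc i)" if i: "Suc i < length ?ws" for i
      proof (rule clique)
        show "?ws ! i \<in> W" "?ws ! Suc i \<in> W"
          using ws(2) i nth_mem[of i ?ws] nth_mem[of "Suc i" ?ws] by (meson Suc_lessD subsetD)+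
        show "?ws ! i \<noteq> ?ws ! Suc i"
          using ws(1) i nth_eq_iff_index_eq[of ?ws i "Suc i"] by simp
      qed
      then show ?thesis unfolding successively_conv_nth by blast
    qed
    have AB: "successively red A" "distinct A" "set A \<inter> set B = {}" "red (last B) (hd A)"
      using cycD[OF A(3)] A(1,2) by (simp_all add: successively_append_iff)
    have v'B: "v' \<in> set B" using A(2,7) by auto
    have sub: "set A \<subseteq> set zs" "set B \<subseteq> set zs" using A(4) by auto
    have "cyc red (v' # A @ ?ws)"
    proof (rule cycI)
      show "distinct (v' # A @ ?ws)"
        using AB(2,3) v'B sub ws by auto
      show "successively red (v' # A @ ?ws)"
        using AB(1,4) A(1,6,7) sw symr[OF r(1)] by (simp add: successively_append_iff successively_Cons)
      show "red (last (v' # A @ ?ws)) (hd (v' # A @ ?ws))" using r(2) by simp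
    qed simp
    moreover have "set (v' # A @ ?ws) \<subseteq> V" using sub v'B ws(2) zV by auto
    moreover have "length (v' # A @ ?ws) = 2 * m + 2"
    proof -
      have "1 \<le> length B" using A(2) by (cases B) auto
      then show ?thesis using us(3) A(5) L by simp
    qed
    ultimately show False using nom monoI(1)[of "v' # A @ ?ws"] by simp
  qed
  have v1: "v \<in> set zs" "v' \<in> set zs" using v S_sub by auto
  have r: "red w v" "red w' v'" using v by (auto simp: S_def)
  obtain A B where A: "A \<noteq> []" "B \<noteq> []" "cyc red (A @ B)" "set (A @ B) = set zs"
    "length (A @ B) = length zs" "last A = v" "last B = v'"
    using cyc_split2[OF cz v1 v(3)] by metis
  show False
  proof (cases "length B \<le> m")
    case True
    show False by (rule *[OF w r A True])
  next
    case False
    then have "length A \<le> m" using A(5) L by simp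
    moreover have "cyc red (B @ A)" using A(3) by (rule cyc_rotate)
    ultimately show False
      using *[OF w(2,1) w(3)[symmetric] r(2,1) A(2,1)] A by (simp add: Un_commute add.commute)
  qed
qed

text \<open>If \<open>W\<close> is a red clique, \<open>red_clique_chord\<close> forbids two
  disjoint red edges between \<open>W\<close> and the cycle, so these edges form a star. Without its
  center all edges between the two sides are blue, and each side still has \<open>m + 1\<close>
  vertices.\<close>

lemma ex_blue_outside:
  assumes L: "length zs = 2 * m"
  obtains a b where "a \<in> W" "b \<in> W" "a \<noteq> b" "blue a b"
proof -
  have cW: "card W = m + 2" using card_W L by simp
  have Wne: "W \<noteq> {}"
  proof
    assume "W = {}"
    then have "card W = 0" by (simp only: card.empty)
    then show False using cW by simp
  qed
  note res = that
  show thesis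
  proof (rule ccontr)
    assume "\<not> thesis"
    then have clique: "red a b" if "a \<in> W" "b \<in> W" "a \<noteq> b" for a b
      using that pure[of a b] res[of a b] by blast
    have chord: False if "w \<in> W" "w' \<in> W" "w \<noteq> w'" "v \<in> S w" "v' \<in> S w'" "v \<noteq> v'" for w w' v v'
      using red_clique_chord[OF L _ that] clique by blast
    have bl: "blue w x" "blue x w" if "w \<in> W" "x \<in> set zs" "x \<notin> S w" for w x
    proof -
      show "blue w x" using that pure[of w x] zV by (auto simp: S_def)
      then show "blue x w" by (rule symb)
    qed
    have "(\<exists>w0\<in>W. \<forall>w\<in>W - {w0}. S w = {}) \<or> (\<exists>v0. \<forall>w\<in>W. S w \<subseteq> {v0})"
    proof (rule ccontr)
      assume neg: "\<not> ?thesis"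
      obtain w0 where w0: "w0 \<in> W" "S w0 \<noteq> {}" using neg Wne by blast
      then obtain v0 where v0: "v0 \<in> S w0" by blast
      obtain w1 where w1: "w1 \<in> W" "w1 \<noteq> w0" "S w1 \<noteq> {}" using neg w0 by blast
      then have S1: "S w1 = {v0}" using chord[OF w0(1) w1(1) _ v0] by blast
      have "S w \<subseteq> {v0}" if "w \<in> W" for w
      proof (cases "w = w0")
        case True
        then show ?thesis using chord[OF w1(1) w0(1) w1(2), of v0] S1 by blast
      next
        case False
        then show ?thesis using chord[OF w0(1) that _ v0] by blast
      qed
      then show False using neg by blast
    qed
    then show False
    proof
      assume "\<exists>w0\<in>W. \<forall>w\<in>W - {w0}. S w = {}"
      then obtain w0 where w0: "w0 \<in> W" "\<And>w. w \<in> W - {w0} \<Longrightarrow> S w = {}" by blast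
      have c1: "m + 1 \<le> card (W - {w0})" using w0(1) cW fin by simp
      have c2: "m + 1 \<le> card (set zs)" using card_zs L m2 by simp
      have fW: "finite (W - {w0})" using fin by auto
      obtain ys where "cyc blue ys" "set ys \<subseteq> (W - {w0}) \<union> set zs" "length ys = 2 * (m + 1)"
      proof (rule cyc_complete_bipartite[OF fW finite_set _ c1 c2, of blue])
        show "blue a b" "blue b a" if "a \<in> W - {w0}" "b \<in> set zs" for a b
          using bl[of a b] w0(2)[OF that(1)] that by simp_all
      qed (use m2 in auto)
      then show False using nom monoI(2)[of ys] zV by auto
    next
      assume "\<exists>v0. \<forall>w\<in>W. S w \<subseteq> {v0}"
      then obtain v0 where v0: "\<And>w. w \<in> W \<Longrightarrow> S w \<subseteq> {v0}" by blast
      have c1: "m + 1 \<le> card W" using cW by simp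
      have "card (set zs) - 1 \<le> card (set zs - {v0})" by (simp add: card_Diff1_le card_Diff_singleton_if)
      then have c2: "m + 1 \<le> card (set zs - {v0})" using card_zs L m2 by simp
      have fW: "finite W" "finite (set zs - {v0})" using fin by auto
      obtain ys where "cyc blue ys" "set ys \<subseteq> W \<union> (set zs - {v0})" "length ys = 2 * (m + 1)"
      proof (rule cyc_complete_bipartite[OF fW _ c1 c2, of blue])
        show "blue a b" "blue b a" if "a \<in> W" "b \<in> set zs - {v0}" for a b
        proof -
          have "b \<notin> S a" using v0[OF that(1)] that(2) by blast
          then show "blue a b" "blue b a" using bl[of a b] that by simp_all
        qed
      qed (use m2 in auto)
      then show False using nom monoI(2)[of ys] zV by auto
    qed
  qed
qed

text \<open>On an even cycle the common blue neighbourhoods are only known to have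
  \<open>m - 1\<close> vertices, two short of what \<open>m + 1\<close> cyclic pairs ask for. A blue
  edge in place of one common neighbour lowers the demand to \<open>m\<close> and aims at length
  \<open>2 * m + 1\<close>.\<close>

lemma path_T_equal:
  assumes L: "length zs = 2 * m" and no1: "\<not> mono_cyc (2 * m + 1)"
    and us: "distinct us" "set us \<subseteq> W" "length us = Suc m" and bl: "blue (us ! m) (us ! 0)"
  shows "T (us ! 0) (us ! 1) = T (us ! 1) (us ! 2)" "card (T (us ! 0) (us ! 1)) = m - 1"
proof -
  let ?A = "\<lambda>i. T (us ! i) (us ! Suc i)"
  have in_W: "us ! i \<in> W" if "i < Suc m" for i using us that nth_mem[of i us] by (metis subsetD)
  have ge: "m - 1 \<le> card (?A i)" if "i < m" for i
  proof -
    have "us ! i \<in> W" "us ! Suc i \<in> W" using that by (intro in_W; simp)+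
    moreover have "us ! i \<noteq> us ! Suc i" using us that by (simp add: nth_eq_iff_index_eq)
    ultimately show ?thesis
      using card_T[of "us ! i" "us ! Suc i"] card_union[of "us ! i" "us ! Suc i"] L by linarith
  qed
  have "T (us ! 0) (us ! 1) = T (us ! 1) (us ! 2) \<and> card (T (us ! 0) (us ! 1)) = m - 1"
  proof (rule ccontr)
    assume neg: "\<not> ?thesis"
    have d: "set us \<inter> set zs = {}" using us by auto
    have m1: "1 \<le> m" using m2 by simp
    obtain ys where "cyc blue ys" "set ys \<subseteq> set us \<union> set zs" "length ys = 2 * m + 1"
    proof (rule hall_path[OF us(1,3) m1 finite_set d, of blue])
      fix J assume J: "J \<subseteq> {..<m}" "J \<noteq> {}"
      show "card J \<le> card (\<Union>i\<in>J. {x \<in> set zs. blue (us ! i) x \<and> blue x (us ! Suc i)})"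
      proof (rule ccontr)
        assume viol: "\<not> ?thesis"
        have fJ: "finite J" using J(1) finite_subset by blast
        have cJ: "card J \<le> m" using J(1) by (metis card_lessThan card_mono finite_lessThan)
        have v: "card (\<Union>(?A ` J)) < card J" using viol by (simp add: T_def)
        have geJ: "m - 1 \<le> card (?A i)" if "i \<in> J" for i using ge that J(1) by auto
        have "card J = m" by (rule hall_deficit_one(1)[OF fJ J(2) finT geJ cJ v])
        then have "J = {..<m}" using J(1) by (intro card_subset_eq) auto
        then have J01: "0 \<in> J" "1 \<in> J" using m2 by auto
        have "?A 0 = ?A 1 \<and> card (?A 0) = m - 1"
          by (rule hall_deficit_one(2)[OF fJ J(2) finT geJ cJ v J01])
        then show False using neg by (auto simp: numeral_2_eq_2)
      qed
    qed (use bl in auto)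
    then show False using no1 monoI(2)[of ys] us zV by auto
  qed
  then show "T (us ! 0) (us ! 1) = T (us ! 1) (us ! 2)" "card (T (us ! 0) (us ! 1)) = m - 1" by auto
qed

text \<open>With the ends \<open>a\<close> and \<open>b\<close> of the blue edge kept, exchanging
  the inner vertices \<open>z\<close> and \<open>z'\<close> equates the three common neighbourhoods
  among \<open>a\<close>, \<open>z\<close> and \<open>z'\<close>.\<close>

lemma even_contra_large:
  assumes L: "length zs = 2 * m" and no1: "\<not> mono_cyc (2 * m + 1)" and m3: "3 \<le> m"
  shows False
proof -
  have cW: "card W = m + 2" using card_W L by simp
  obtain a b where ab: "a \<in> W" "b \<in> W" "a \<noteq> b" "blue a b" by (rule ex_blue_outside[OF L])
  have "card (W - {a, b}) = m" using ab cW fin by (subst card_Diff_subset) auto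
  then have le: "m - 1 \<le> card (W - {a, b})" by simp
  have fW: "finite (W - {a, b})" using fin by simp
  obtain us where us: "distinct us" "set us \<subseteq> W - {a, b}" "length us = m - 1"
    by (rule distinct_list_in[OF fW le])
  have "Suc (Suc 0) \<le> length us" using us m3 by simp
  then obtain z z' rest where u: "us = z # z' # rest" by (auto simp: Suc_le_length_iff)
  have l: "length rest = m - 3" using u us(3) by simp
  let ?p = "a # z # z' # rest @ [b]" and ?q = "a # z' # z # rest @ [b]"
  have nth: "?p ! m = b" "?q ! m = b" using l m3 by (auto simp: nth_Cons' nth_append)
  have d: "distinct ?p" "set ?p \<subseteq> W" "length ?p = Suc m" "distinct ?q" "set ?q \<subseteq> W" "length ?q = Suc m"
    using us u ab l m3 by auto
  have p: "T a z = T z z'" "card (T a z) = m - 1"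
    using path_T_equal[OF L no1 d(1-3)] nth(1) symb[OF ab(4)] by (simp_all add: numeral_2_eq_2)
  have q: "T a z' = T z' z"
    using path_T_equal(1)[OF L no1 d(4-6)] nth(2) symb[OF ab(4)] by (simp add: numeral_2_eq_2)
  have "T z a = T a z'" using p q T_commute by metis
  then show False
    using equal_T_contra[of a z z'] p L ab us u m3 T_commute[of z a] by auto
qed

text \<open>For \<open>m = 2\<close> the path \<open>a, y, b\<close> has a single inner vertex and
  nothing can be exchanged. Instead the common blue neighbourhoods of size one determine enough red
  edges to the four-cycle to exhibit a blue six-cycle.\<close>

lemma even_contra_two:
  assumes L: "length zs = 4" and m: "m = 2" and no1: "\<not> mono_cyc 5"
  shows False
proof -
  have L': "length zs = 2 * m" "\<not> mono_cyc (2 * m + 1)" using L m no1 by auto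
  have cW: "card W = 4" using card_W L m by simp
  obtain a b where ab: "a \<in> W" "b \<in> W" "a \<noteq> b" "blue a b" by (rule ex_blue_outside[OF L'(1)])
  have "2 \<le> card (W - {a, b})" using ab cW fin by (subst card_Diff_subset) auto
  then obtain z z' where z: "z \<in> W - {a, b}" "z' \<in> W - {a, b}" "z \<noteq> z'"
    by (rule ex_two_if_card_ge_2)
  have p: "T a y = T y b" "card (T a y) = 1" if "y \<in> W - {a, b}" for y
  proof -
    have "distinct [a, y, b]" "set [a, y, b] \<subseteq> W" "length [a, y, b] = Suc m"
      using ab that m by auto
    moreover have "blue ([a, y, b] ! m) ([a, y, b] ! 0)" using symb[OF ab(4)] m by simp
    ultimately show "T a y = T y b" "card (T a y) = 1"
      using path_T_equal[OF L', of "[a, y, b]"] m by (simp_all add: numeral_2_eq_2)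
  qed
  obtain t where t: "T a z = {t}" using p(2)[OF z(1)] by (rule card_1_singletonE)
  obtain t' where t': "T a z' = {t'}" using p(2)[OF z(2)] by (rule card_1_singletonE)
  have "t \<in> set zs" using t by (auto simp: T_def)
  \<comment> \<open>The rotation makes \<open>t\<close>, the only common blue neighbour of
    \<open>z\<close> with \<open>a\<close> and with \<open>b\<close>, the vertex \<open>c3\<close>.
    Each other cycle vertex is then red to \<open>z\<close> or red to both \<open>a\<close> and
    \<open>b\<close>.\<close>
  then obtain A where A: "cyc red A" "set A = set zs" "length A = length zs" "last A = t"
    "\<And>u. u \<in> set zs \<Longrightarrow> nxt A u = nxt zs u"
    using cyc_split[OF cz] by metis
  obtain c0 c1 c2 c3 where c: "A = [c0, c1, c2, c3]"
    using A(3) L by (auto simp: numeral_eq_Suc length_Suc_conv)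
  have dc: "distinct [c0, c1, c2, c3]" using cycD(1)[OF A(1)] c by simp
  have zs: "set zs = {c0, c1, c2, c3}" using A(2) c by simp
  have n: "nxt zs c0 = c1" "nxt zs c1 = c2" "nxt zs c2 = c3" "nxt zs c3 = c0"
  proof -
    have "nxt A (A ! i) = A ! (Suc i mod 4)" if "i < 4" for i
      using nxt_nth[OF cycD(1)[OF A(1)], of i] that A(3) L by simp
    from this[of 0] this[of 1] this[of 2] this[of 3]
    have *: "nxt A c0 = c1" "nxt A c1 = c2" "nxt A c2 = c3" "nxt A c3 = c0"
      unfolding c by simp_all
    show "nxt zs c0 = c1" using A(5)[of c0] *(1) zs by simp
    show "nxt zs c1 = c2" using A(5)[of c1] *(2) zs by simp
    show "nxt zs c2 = c3" using A(5)[of c2] *(3) zs by simp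
    show "nxt zs c3 = c0" using A(5)[of c3] *(4) zs by simp
  qed
  have inS: "x \<in> S u \<longleftrightarrow> red u x" if "x \<in> {c0, c1, c2, c3}" for u x
    using that zs by (auto simp: S_def)
  have Sr: "\<not> (red u c0 \<and> red u c1)" "\<not> (red u c1 \<and> red u c2)" "\<not> (red u c2 \<and> red u c3)"
    "\<not> (red u c3 \<and> red u c0)" if "u \<in> W" for u
    using noi[OF that, of c0] noi[OF that, of c1] noi[OF that, of c2] noi[OF that, of c3] n inS by auto
  have bl: "blue u x \<longleftrightarrow> \<not> red u x" if "u \<in> W" "x \<in> {c0, c1, c2, c3}" for u x
    using pure[of u x] disj that zs zV by blast
  have inT: "x \<in> T u w \<longleftrightarrow> \<not> red u x \<and> \<not> red w x" if "x \<in> {c0, c1, c2, c3}" "u \<in> W" "w \<in> W" for x u w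
    using that bl[of u x] bl[of w x] zs symb unfolding T_def by blast
  have edge: "blue u w" if "u \<in> W" "w \<in> W" "u \<noteq> w" "x \<in> {c0, c1, c2, c3}" "red u x" "red w (nxt zs x)" for u w x
  proof -
    have "nxt zs x \<in> {c0, c1, c2, c3}" using that n by auto
    then have "\<not> red u w" using insert_edge[of u w x] that inS by blast
    then show ?thesis using pure[of u w] that by blast
  qed
  have W: "a \<in> W" "b \<in> W" "z \<in> W" "z' \<in> W" "distinct [a, b, z, z']" using ab z by auto
  have ne: "a \<noteq> b" "a \<noteq> z" "a \<noteq> z'" "b \<noteq> z" "b \<noteq> z'" "z \<noteq> z'" "b \<noteq> a" "z \<noteq> a" "z' \<noteq> a" "z \<noteq> b" "z' \<noteq> b" "z' \<noteq> z"
    using W(5) by auto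
  have t3: "t = c3" using A(4) c by simp
  have Taz: "T a z = {c3}" "T b z = {c3}" using t t3 p(1)[OF z(1)] T_commute by auto
  have Taz': "T b z' = {t'}" using t' p(1)[OF z(2)] T_commute by auto
  have cyc6: False if "cyc blue ys" "set ys \<subseteq> {a, b, z, z', c0, c1, c2, c3}" "length ys = 6" for ys
  proof -
    have "set ys \<subseteq> V" using that(2) W zs zV by auto
    then show False using monoI(2)[OF that(1)] nom m that(3) by simp
  qed
  have nW: "a \<notin> {c0, c1, c2, c3}" "b \<notin> {c0, c1, c2, c3}" "z \<notin> {c0, c1, c2, c3}" "z' \<notin> {c0, c1, c2, c3}"
    using W(1-4) zs by blast+
  have r1: "red a x \<or> red z x" "red b x \<or> red z x" if "x \<in> {c0, c1, c2}" for x
    using inT[of x a z] inT[of x b z] that Taz W dc by auto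
  show False
  proof (cases "red z c1")
    case True
    then have z0: "\<not> red z c0" "\<not> red z c2" using Sr W by blast+
    then have a0: "red a c0" "red a c2" "red b c0" "red b c2" using r1 by auto
    then have a1: "\<not> red a c1" "\<not> red b c1" "\<not> red a c3" "\<not> red b c3" using Sr W by blast+
    have "red z' c1 \<or> red z' c3"
    proof (rule ccontr)
      assume "\<not> ?thesis"
      then have "c1 \<in> T a z'" "c3 \<in> T a z'" using inT W a1 by auto
      then show False using t' dc by auto
    qed
    then have z'0: "\<not> red z' c0" using Sr(1,4)[OF W(4)] by blast
    have "blue a z'" using \<open>red z' c1 \<or> red z' c3\<close>
    proof
      assume "red z' c1"
      show ?thesis by (rule edge[of _ _ c0]) (use ne W a0 n \<open>red z' c1\<close> in simp_all)
    next
      assume "red z' c3"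
      show ?thesis by (rule edge[of _ _ c2]) (use ne W a0 n \<open>red z' c3\<close> in simp_all)
    qed
    moreover have "blue b z" by (rule edge[of _ _ c0]) (use ne W a0 n True in simp_all)
    moreover have b6: "blue a c1" "blue b c1" "blue z c0" "blue z' c0" using bl W a1 z0 z'0 by simp_all
    ultimately have "cyc blue [a, c1, b, z, c0, z']"
      by (intro cycI) (use nW dc ne b6 symb in \<open>auto simp: successively_Cons\<close>)
    then show False by (rule cyc6) auto
  next
    case False
    then have a1: "red a c1" "red b c1" using r1 by auto
    then have a0: "\<not> red a c0" "\<not> red a c2" "\<not> red b c0" "\<not> red b c2" using Sr W by blast+
    then have z0: "red z c0" "red z c2" using r1 by auto
    then have z3: "\<not> red z c3" using Sr W by blast
    have a3: "\<not> red a c3" using inT[of c3 a z] Taz W by auto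
    have two: "x = y" if "x \<in> {c0, c2, c3}" "y \<in> {c0, c2, c3}" "\<not> red z' x" "\<not> red z' y" for x y
    proof -
      have "x \<in> T a z'" "y \<in> T a z'" using that inT[of x a z'] inT[of y a z'] W a0 a3 by auto
      then show ?thesis using t' by auto
    qed
    have z'0: "red z' c0" using two[of c0 c2] two[of c0 c3] Sr(3)[OF W(4)] dc by auto
    then have z'3: "\<not> red z' c3" using Sr W by blast
    have "blue z' a" by (rule edge[of _ _ c0]) (use ne W a1 n z'0 in simp_all)
    moreover have "blue z b" by (rule edge[of _ _ c0]) (use ne W a1 n z0 in simp_all)
    moreover have b6: "blue z c3" "blue z' c3" "blue a c0" "blue b c0" using bl W a0 z3 z'3 by simp_all
    ultimately have "cyc blue [z, c3, z', a, c0, b]"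
      by (intro cycI) (use nW dc ne b6 symb in \<open>auto simp: successively_Cons\<close>)
    then show False by (rule cyc6) auto
  qed
qed

lemma even_contra: "length zs = 2 * m \<Longrightarrow> \<not> mono_cyc (2 * m + 1) \<Longrightarrow> False"
  using even_contra_large even_contra_two m2 by (cases "m = 2") auto

end

context bicol
begin

lemma pure_cycle_contra_red:
  assumes pure: "\<And>x y. x \<in> V \<Longrightarrow> y \<in> V \<Longrightarrow> x \<noteq> y \<Longrightarrow> red x y \<or> blue x y"
    and V: "card V = 3 * m + 2" "2 \<le> m" and zs: "cyc red zs" "set zs \<subseteq> V"
    and L: "length zs = 2 * m \<or> length zs = 2 * m + 1"
    and no: "\<not> mono_cyc (length zs + 1)" "\<not> mono_cyc (length zs + 2)" "\<not> mono_cyc (2 * m + 2)"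
  shows False
proof -
  interpret redcycle V red blue zs
  proof unfold_locales
    show "cyc red zs" "set zs \<subseteq> V" by (rule zs)+
    show False if "cyc red ys" "set ys \<subseteq> V" "length ys = length zs + 2" for ys
      using monoI(1)[OF that(1,2)] that(3) no(2) by simp
  qed
  interpret pure_redcycle V red blue zs m
    by unfold_locales (use pure V no no_insert in auto)
  show False using L even_contra odd_contra no(1) by auto
qed

text \<open>A cycle of length \<open>2 * m\<close> leads to length \<open>2 * m + 1\<close> or
  \<open>2 * m + 2\<close>, and length \<open>2 * m + 1\<close> leads to \<open>2 * m + 2\<close> or
  \<open>2 * m + 3\<close>. The last value overshoots, but it is odd and descends by one.\<close>

theorem pure_step:
  assumes pure: "\<And>x y. x \<in> V \<Longrightarrow> y \<in> V \<Longrightarrow> x \<noteq> y \<Longrightarrow> red x y \<or> blue x y"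
    and V: "card V = 3 * m + 2" "2 \<le> m" and mono_cyc: "mono_cyc (2 * m)"
  shows "mono_cyc (2 * m + 2)"
proof (rule ccontr)
  assume no: "\<not> mono_cyc (2 * m + 2)"
  interpret S: bicol V blue red by (rule swap)
  have contra: False
    if "mono_cyc L" "L = 2 * m \<or> L = 2 * m + 1" "\<not> mono_cyc (L + 1)" "\<not> mono_cyc (L + 2)" for L
  proof -
    note h = that
    obtain zs where "set zs \<subseteq> V" "length zs = L" "cyc red zs \<or> cyc blue zs"
      using h(1) unfolding mono_cyc_def by blast
    then show False
      using pure_cycle_contra_red[of m zs] S.pure_cycle_contra_red[of m zs] pure V no h swap_mono by blast
  qed
  have "mono_cyc (2 * m + 1)" using contra[of "2 * m"] mono_cyc no by auto
  moreover have "\<not> mono_cyc (2 * m + 1 + 2)"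
  proof
    assume "mono_cyc (2 * m + 1 + 2)"
    moreover have "2 * m + 1 + 2 = 2 * m + 3" by simp
    ultimately have "mono_cyc (2 * m + 3)" by metis
    then have "mono_cyc (2 * m + 3 - 1)" by (intro odd_descent[OF pure]) (use V(2) in auto)
    then show False using no by simp
  qed
  ultimately show False using contra[of "2 * m + 1"] no by auto
qed

end

section \<open>A part of maximal size\<close>

text \<open>The interface to the closure argument, with \<open>d\<close> as the degree in
  \<open>F\<close>. For a blue Hamiltonian cycle, lower bounds on \<open>d\<close> are raised until
  all pairs are adjacent in \<open>F\<close>, which the last conclusion excludes.\<close>

lemma maximal_nonham_degrees:
  assumes fin: "finite Y" and sym: "symp E" and no: "\<not> ham E Y" and "3 \<le> card Y"
  obtains F d where "symp F" "\<And>x y. E x y \<Longrightarrow> F x y"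
    "\<And>u N. N \<subseteq> Y - {u} \<Longrightarrow> (\<And>y. y \<in> N \<Longrightarrow> F u y) \<Longrightarrow> card N \<le> d u"
    "\<And>u v. u \<in> Y \<Longrightarrow> v \<in> Y \<Longrightarrow> u \<noteq> v \<Longrightarrow> card Y \<le> d u + d v \<Longrightarrow> F u v"
    "\<exists>u\<in>Y. \<exists>v\<in>Y. u \<noteq> v \<and> \<not> F u v"
proof -
  obtain F where F: "symp F" "\<And>x y. E x y \<Longrightarrow> F x y" "\<not> ham F Y"
    "\<And>u v. u \<in> Y \<Longrightarrow> v \<in> Y \<Longrightarrow> u \<noteq> v \<Longrightarrow> \<not> F u v \<Longrightarrow>
       card {y \<in> Y. F u y \<and> y \<noteq> u} + card {y \<in> Y. F v y \<and> y \<noteq> v} < card Y"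
    by (rule maximal_nonham[OF fin sym no]) blast
  define d where "d u = card {y \<in> Y. F u y \<and> y \<noteq> u}" for u
  show thesis
  proof (rule that[of F d])
    show "card N \<le> d u" if "N \<subseteq> Y - {u}" "\<And>y. y \<in> N \<Longrightarrow> F u y" for u N
      unfolding d_def using that fin by (intro card_mono) auto
    show "F u v" if "u \<in> Y" "v \<in> Y" "u \<noteq> v" "card Y \<le> d u + d v" for u v
      using F(4)[OF that(1-3)] that(4) by (auto simp: d_def)
    show "\<exists>u\<in>Y. \<exists>v\<in>Y. u \<noteq> v \<and> \<not> F u v"
      using ham_complete[OF fin assms(4), of F] F(3) by blast
  qed (use F in auto)
qed

lemma alternating_path_bipartite:
  assumes "finite A" "finite B" "A \<inter> B = {}" "1 \<le> t" "t \<le> card A" "t - 1 \<le> card B"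
    and E: "\<And>a b. a \<in> A \<Longrightarrow> b \<in> B \<Longrightarrow> E a b" "\<And>a b. a \<in> A \<Longrightarrow> b \<in> B \<Longrightarrow> E b a"
  shows "\<exists>ys. successively E ys \<and> distinct ys \<and> set ys \<subseteq> A \<union> B \<and> ys \<noteq> [] \<and> hd ys \<in> A \<and> last ys \<in> A
    \<and> length ys = 2 * t - 1"
  using assms(4,1-3,5-)
proof (induction t arbitrary: A B rule: dec_induct)
  case base
  then obtain a where "a \<in> A" by fastforce
  then show ?case by (intro exI[of _ "[a]"]) auto
next
  case (step t)
  obtain a where a: "a \<in> A" using step.prems(4) by fastforce
  have "B \<noteq> {}" using step.prems(5) step.hyps by auto
  then obtain b where b: "b \<in> B" by blast
  have "\<exists>ys. successively E ys \<and> distinct ys \<and> set ys \<subseteq> (A - {a}) \<union> (B - {b}) \<and> ys \<noteq> [] \<and> hd ys \<in> A - {a}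
      \<and> last ys \<in> A - {a} \<and> length ys = 2 * t - 1"
  proof (rule step.IH)
    show "t \<le> card (A - {a})" "t - 1 \<le> card (B - {b})" using a b step.prems by auto
    show "(A - {a}) \<inter> (B - {b}) = {}" using step.prems(3) by blast
  qed (use step.prems in auto)
  then obtain ys where ys: "successively E ys" "distinct ys" "set ys \<subseteq> (A - {a}) \<union> (B - {b})" "ys \<noteq> []"
    "hd ys \<in> A - {a}" "last ys \<in> A - {a}" "length ys = 2 * t - 1" by blast
  have "a \<notin> set ys" "b \<notin> set ys" "a \<noteq> b" using ys(3) a b step.prems(3) by auto
  then show ?case
    using ys a b step.prems(6,7) step.hyps
    by (intro exI[of _ "a # b # ys"]) (auto simp: successively_Cons)
qed

context bicol
begin

lemma part_self: "x \<in> V \<Longrightarrow> x \<in> part x" using irr by (simp add: part_def)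

lemma part_sub: "part x \<subseteq> V" by (auto simp: part_def)

lemma fin_part: "finite (part x)" using fin part_sub finite_subset by blast

lemma part_twin:
  assumes "x \<in> V" "y \<in> part x" "z \<in> V"
  shows "red x z \<longleftrightarrow> red y z" "blue x z \<longleftrightarrow> blue y z" "red z x \<longleftrightarrow> red z y" "blue z x \<longleftrightarrow> blue z y"
proof -
  show *: "red x z \<longleftrightarrow> red y z" "blue x z \<longleftrightarrow> blue y z" using twin[of x y z] assms by (auto simp: part_def)
  show "red z x \<longleftrightarrow> red z y" "blue z x \<longleftrightarrow> blue z y" using * symr symb by blast+
qed

lemma part_eq: "x \<in> V \<Longrightarrow> y \<in> part x \<Longrightarrow> part y = part x"
  using part_twin[of x y] unfolding part_def by blast

lemma cases_part: "x \<in> V \<Longrightarrow> y \<in> V \<Longrightarrow> y \<in> part x \<or> red x y \<or> blue x y" by (auto simp: part_def)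

lemma part_not: "y \<in> part x \<Longrightarrow> \<not> red x y" "y \<in> part x \<Longrightarrow> \<not> blue x y" by (auto simp: part_def)

end

section \<open>The red and blue neighbourhoods of a part of size \<open>m\<close>\<close>

locale hub = bicol +
  fixes p m
  assumes p: "p \<in> V" and card_P: "card (part p) = m" and m2: "2 \<le> m" and nom: "\<not> mono_cyc (2 * m + 2)"
begin

definition R where "R = {x \<in> V. red p x}"
definition B where "B = {x \<in> V. blue p x}"

lemma RB: "R \<inter> B = {}" "R \<inter> part p = {}" "B \<inter> part p = {}" "part p \<union> R \<union> B = V" "finite R" "finite B"
proof -
  show "R \<inter> B = {}" using disj by (auto simp: R_def B_def)
  show "R \<inter> part p = {}" "B \<inter> part p = {}" by (auto simp: R_def B_def part_def)
  show "part p \<union> R \<union> B = V" by (auto simp: R_def B_def part_def)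
  show "finite R" "finite B" using fin by (auto simp: R_def B_def)
qed

lemma card_RB: "card V = m + card R + card B"
proof -
  have "card (part p \<union> R \<union> B) = card (part p \<union> R) + card B"
    using RB(1,3,5,6) fin_part by (intro card_Un_disjoint) auto
  also have "card (part p \<union> R) = m + card R"
    using RB fin_part card_P by (subst card_Un_disjoint) auto
  finally show ?thesis unfolding RB(4) .
qed

lemma P_R: "q \<in> part p \<Longrightarrow> x \<in> R \<Longrightarrow> red q x" "q \<in> part p \<Longrightarrow> x \<in> R \<Longrightarrow> red x q"
  using part_twin(1)[OF p] symr by (auto simp: R_def)

lemma path_P:
  assumes "X \<subseteq> R" "m - 1 \<le> card X"
  obtains ys where "successively red ys" "distinct ys" "set ys \<subseteq> part p \<union> X" "ys \<noteq> []"
    "hd ys \<in> part p" "last ys \<in> part p" "length ys = 2 * m - 1"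
proof -
  have X: "finite X" "part p \<inter> X = {}" using assms RB finite_subset by auto
  have m: "1 \<le> m" "m \<le> card (part p)" using m2 card_P by auto
  have E: "red q x" "red x q" if "q \<in> part p" "x \<in> X" for q x using P_R that assms(1) by blast+
  show thesis using alternating_path_bipartite[of "part p" X m red] fin_part X m assms(2) E that by blast
qed

text \<open>The red path \<open>r1, x, r2\<close> is closed up by a red path that alternates between
  the \<open>m\<close> vertices of \<open>part p\<close> and \<open>m - 1\<close> further vertices
  of \<open>R\<close>; together these are \<open>2 * m + 2\<close> vertices.\<close>

lemma no_path2:
  assumes x: "x \<in> V - part p" "red x r1" "red x r2" and r: "r1 \<in> R" "r2 \<in> R" "r1 \<noteq> r2"
    and c: "m - 1 \<le> card (R - {r1, r2, x})"
  shows False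
proof -
  obtain ys where ys: "successively red ys" "distinct ys" "set ys \<subseteq> part p \<union> (R - {r1, r2, x})" "ys \<noteq> []"
    "hd ys \<in> part p" "last ys \<in> part p" "length ys = 2 * m - 1"
    by (rule path_P[OF Diff_subset c])
  have ne: "x \<noteq> r1" "x \<noteq> r2" using x irr by auto
  have n: "r1 \<notin> part p" "r2 \<notin> part p" "x \<notin> part p" using r x RB by auto
  have "cyc red (r1 # x # r2 # ys)"
  proof (rule cycI)
    show "distinct (r1 # x # r2 # ys)" using ys(2,3) ne r(3) n by auto
    show "successively red (r1 # x # r2 # ys)"
      using ys(1,5) x(2,3) symr P_R(2)[of "hd ys" r2] r by (auto simp: successively_Cons)
    show "red (last (r1 # x # r2 # ys)) (hd (r1 # x # r2 # ys))"
      using ys(4,6) P_R(1)[of "last ys" r1] r by simp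
  qed simp
  moreover have "set (r1 # x # r2 # ys) \<subseteq> V" using ys(3) x r RB(4) by auto
  moreover have "length (r1 # x # r2 # ys) = 2 * m + 2" using ys(7) m2 by simp
  ultimately show False using monoI(1)[of "r1 # x # r2 # ys"] nom by metis
qed

lemma part_in:
  assumes "x \<in> R" shows "part x \<subseteq> R"
proof
  fix y assume "y \<in> part x"
  moreover from this have "red p y" using part_twin(3)[of x y p] assms p by (auto simp: R_def)
  ultimately show "y \<in> R" using part_sub by (auto simp: R_def)
qed

lemma part_in_B:
  assumes "x \<in> B" shows "part x \<subseteq> B"
proof
  fix y assume "y \<in> part x"
  moreover from this have "blue p y" using part_twin(4)[of x y p] assms p by (auto simp: B_def)
  ultimately show "y \<in> B" using part_sub by (auto simp: B_def)
qed

text \<open>By \<open>no_path2\<close> each vertex of \<open>R \<union> B\<close> has at most one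
  red neighbour in \<open>R\<close>. So blue is dense on these \<open>2 * m + 2\<close> vertices,
  and the closure argument asks for degree \<open>m + 1\<close> everywhere.\<close>

lemma large_contra:
  assumes V: "card V = 3 * m + 2" and c: "m + 2 \<le> card R" and small: "\<And>x. x \<in> V \<Longrightarrow> card (part x) \<le> m"
  shows False
proof -
  note [simp] = RB(5,6) fin_part
  define Y where "Y = R \<union> B"
  have fY: "finite Y" using RB by (simp add: Y_def)
  have cRB: "card R + card B = 2 * m + 2" using card_RB V by simp
  have cY: "card Y = 2 * m + 2" using cRB RB by (simp add: Y_def card_Un_disjoint)
  have YV: "Y \<subseteq> V - part p" using RB by (auto simp: Y_def)
  have at_most_1: "r1 = r2" if "x \<in> Y" "red x r1" "red x r2" "r1 \<in> R" "r2 \<in> R" for x r1 r2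
  proof (rule ccontr)
    assume ne: "r1 \<noteq> r2"
    have "card {r1, r2, x} \<le> 3" by (simp add: card_insert_if)
    then have "card R \<le> card (R - {r1, r2, x}) + 3"
      using diff_card_le_card_Diff[of "{r1, r2, x}" R] by simp
    then have "m - 1 \<le> card (R - {r1, r2, x})" using c by simp
    then show False using no_path2[of x r1 r2] that ne YV by blast
  qed
  have noham: "\<not> ham blue Y"
  proof
    assume "ham blue Y"
    then obtain xs where "cyc blue xs" "set xs = Y" unfolding ham_def by blast
    then show False using monoI(2)[of xs] nom cY YV distinct_card[OF cycD(1)] by (metis Diff_subset subset_trans)
  qed
  have Y3: "3 \<le> card Y" using cY m2 by simp
  obtain F d where F: "symp F" "\<And>x y. blue x y \<Longrightarrow> F x y"
    "\<And>u N. N \<subseteq> Y - {u} \<Longrightarrow> (\<And>y. y \<in> N \<Longrightarrow> F u y) \<Longrightarrow> card N \<le> d u"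
    "\<And>u v. u \<in> Y \<Longrightarrow> v \<in> Y \<Longrightarrow> u \<noteq> v \<Longrightarrow> card Y \<le> d u + d v \<Longrightarrow> F u v"
    "\<exists>u\<in>Y. \<exists>v\<in>Y. u \<noteq> v \<and> \<not> F u v"
    by (rule maximal_nonham_degrees[OF fY sympb noham Y3]) blast
  have deg: "card Y - card N \<le> d u" if "finite N" "u \<in> N" "\<And>y. y \<in> Y \<Longrightarrow> y \<notin> N \<Longrightarrow> F u y" for u N
  proof -
    have "card (Y - N) \<le> d u" using that(2,3) by (intro F(3)) auto
    then show ?thesis using diff_card_le_card_Diff[OF that(1), of Y] by simp
  qed
  have FB: "F u y" if "u \<in> V" "y \<in> Y" "y \<notin> part u" "\<not> red u y" for u y
    using that cases_part[of u y] F(2) YV by blast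
  have degB: "m + 1 \<le> d x" if x: "x \<in> B" for x
  proof -
    let ?N = "B \<union> {r \<in> R. red x r}"
    have xY: "x \<in> Y" "x \<in> V" using x RB(4) by (auto simp: Y_def)
    have "card {r \<in> R. red x r} \<le> Suc 0"
      using at_most_1[OF xY(1)] RB(5) by (intro card_le_Suc0_iff_eq[THEN iffD2]) auto
    then have "card ?N \<le> m + 1" using card_Un_le[of B "{r \<in> R. red x r}"] c cRB by linarith
    moreover have "card Y - card ?N \<le> d x"
      using x part_in_B[OF x] FB[OF xY(2)] by (intro deg) (auto simp: Y_def)
    ultimately show ?thesis using cY by simp
  qed
  have degR: "m + 1 \<le> d r" if r: "r \<in> R" for r
  proof (cases "part r = {r}")
    case False
    have rV: "r \<in> V" using r RB(4) by auto
    then obtain r' where r': "r' \<in> part r" "r' \<noteq> r" using False part_self by blast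
    \<comment> \<open>A red neighbour of \<open>r\<close> is also red to the twin \<open>r'\<close>
      and would have two red neighbours in \<open>R\<close>.\<close>
    have "\<not> red r y" if "y \<in> Y" for y
    proof
      assume "red r y"
      moreover from this have "red r' y" using part_twin(1)[OF rV r'(1)] that YV by blast
      ultimately show False
        using at_most_1[OF that, of r r'] symr r r' part_in[OF r] by blast
    qed
    then have "card Y - card (part r) \<le> d r" using part_self rV FB[OF rV] by (intro deg) auto
    then show ?thesis using small[OF rV] cY by simp
  next
    case True
    have rY: "r \<in> Y" "r \<in> V" using r RB(4) by (auto simp: Y_def)
    let ?N1 = "{y \<in> R. red r y}" and ?N2 = "{y \<in> B. red r y}"
    have fN: "finite ?N1" "finite ?N2" using RB by auto
    have N1: "card ?N1 \<le> Suc 0"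
      using at_most_1[OF rY(1)] RB(5) by (intro card_le_Suc0_iff_eq[THEN iffD2]) auto
    have N2: "card ?N2 \<le> card B" using RB(6) by (intro card_mono) auto
    have d1: "card Y - card (insert r (?N1 \<union> ?N2)) \<le> d r"
      using True FB[OF rY(2)] by (intro deg) (auto simp: Y_def)
    have le: "card (insert r (?N1 \<union> ?N2)) \<le> Suc (card ?N1 + card ?N2)"
      using card_Un_le[of ?N1 ?N2] fN by (auto simp: card_insert_if)
    show ?thesis
    proof (rule ccontr)
      \<comment> \<open>The one deficient case: \<open>r\<close> is red to one \<open>r'\<close> in
        \<open>R\<close> and to all of \<open>B\<close>, with \<open>card B = m\<close>. Then
        \<open>r'\<close> has no red neighbour in \<open>Y\<close> but \<open>r\<close>, so the
        degree sum puts \<open>r\<close> and \<open>r'\<close> together in \<open>F\<close>, and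
        this edge is the missing one at \<open>r\<close>.\<close>
      assume small_d: "\<not> ?thesis"
      then have "card ?N1 = 1" and N2m: "card ?N2 = card B" "card B = m"
        using d1 le N1 N2 cRB c cY by linarith+
      then obtain r' where "?N1 = {r'}" by (meson card_1_singletonE)
      then have r': "r' \<in> R" "red r r'" by auto
      have "?N2 = B" using N2m RB(6) by (intro card_subset_eq) auto
      then have allB: "red r y" if "y \<in> B" for y using that by blast
      have r'Y: "r' \<in> Y" "r' \<in> V" using r' RB(4) by (auto simp: Y_def)
      have ne: "r \<noteq> r'" using r' irr by auto
      have rr: "y = r" if "y \<in> Y" "red r' y" for y
      proof (cases "y \<in> R")
        case True
        then show ?thesis using at_most_1[OF r'Y(1) that(2), of r] symr r' r by blast
      next
        case False
        then have "y \<in> B" using that by (auto simp: Y_def)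
        then show ?thesis using at_most_1[OF that(1), of r r'] allB symr that r r' ne by blast
      qed
      have "part r' = {r'}"
      proof (rule ccontr)
        assume "part r' \<noteq> {r'}"
        then obtain s where s: "s \<in> part r'" "s \<noteq> r'" using part_self[OF r'Y(2)] by blast
        have "red r s" using part_twin(3)[OF r'Y(2) s(1) rY(2)] r' by simp
        then show False using at_most_1[OF rY(1) r'(2), of s] s r' part_in[OF r'(1)] by blast
      qed
      then have "card Y - card {r, r'} \<le> d r'" using rr FB[OF r'Y(2)] by (intro deg) auto
      then have d': "2 * m \<le> d r'" using cY ne by simp
      have "m \<le> d r" using d1 le N1 N2m cY by linarith
      then have F': "F r r'" using F(4)[OF rY(1) r'Y(1) ne] d' cY m2 by linarith
      have "card Y - card (insert r ?N2) \<le> d r"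
      proof (rule deg)
        show "F r y" if "y \<in> Y" "y \<notin> insert r ?N2" for y
          using that \<open>?N1 = {r'}\<close> F' FB[OF rY(2)] True by (cases "y = r'") (auto simp: Y_def)
      qed simp_all
      moreover have "card (insert r ?N2) \<le> m + 1" using fN N2m by (simp add: card_insert_if)
      ultimately show False using small_d cY by linarith
    qed
  qed
  have "F u v" if "u \<in> Y" "v \<in> Y" "u \<noteq> v" for u v
  proof (rule F(4)[OF that])
    have "m + 1 \<le> d w" if "w \<in> Y" for w using degB degR that by (auto simp: Y_def)
    from this[OF \<open>u \<in> Y\<close>] this[OF \<open>v \<in> Y\<close>] show "card Y \<le> d u + d v" using cY by linarith
  qed
  then show False using F(5) by blast
qed

text \<open>As \<open>x\<close> lies outside \<open>R\<close>, the path \<open>r1, x, r2\<close>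
  uses up only two vertices of \<open>R\<close>; this is why \<open>m + 1\<close> suffices
  here.\<close>

lemma equal_le_1:
  assumes c: "m + 1 \<le> card R" and x: "x \<in> B" and r: "r1 \<in> R" "r2 \<in> R" "red x r1" "red x r2"
  shows "r1 = r2"
proof (rule ccontr)
  assume ne: "r1 \<noteq> r2"
  have "x \<notin> R" using x RB(1) by auto
  then have "R - {r1, r2, x} = R - {r1, r2}" by auto
  also have "card \<dots> = card R - 2" using r ne RB(5) by (subst card_Diff_subset) auto
  finally have "m - 1 \<le> card (R - {r1, r2, x})" using c by simp
  then show False using no_path2[of x r1 r2] x r ne RB by blast
qed

end

context bicol
begin

text \<open>\<open>large_contra\<close> leaves only the case that both neighbourhoods have
  \<open>m + 1\<close> vertices. Then \<open>r1\<close> and \<open>r2\<close> are blue to at most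
  one vertex of \<open>H.B\<close> each, so some \<open>x\<close> in \<open>H.B\<close> is red to
  both, against \<open>equal_le_1\<close>.\<close>

lemma big_part_aux:
  assumes V: "card V = 3 * m + 2" "2 \<le> m" and p: "p \<in> V" "card (part p) = m"
    and small: "\<And>x. x \<in> V \<Longrightarrow> card (part x) \<le> m"
    and ge: "card {x \<in> V. blue p x} \<le> card {x \<in> V. red p x}"
  shows "mono_cyc (2 * m + 2)"
proof (rule ccontr)
  assume no: "\<not> ?thesis"
  interpret H: hub V red blue p m by unfold_locales (use no V p in auto)
  interpret S: bicol V blue red by (rule swap)
  interpret HS: hub V blue red p m by unfold_locales (use no V p in \<open>auto simp: swap_part swap_mono\<close>)
  have eq: "HS.R = H.B" "HS.B = H.R" by (auto simp: H.R_def HS.R_def H.B_def HS.B_def)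
  have sum: "card H.R + card H.B = 2 * m + 2" using H.card_RB V by simp
  have "card H.R < m + 2" using H.large_contra[OF V(1) _ small] by (meson not_le)
  moreover have "card H.B \<le> card H.R" using ge by (simp add: H.R_def H.B_def)
  ultimately have c: "card H.R = m + 1" "card H.B = m + 1" using sum by linarith+
  have "2 \<le> card H.R" using c V(2) by linarith
  then obtain r1 r2 where r: "r1 \<in> H.R" "r2 \<in> H.R" "r1 \<noteq> r2" by (rule ex_two_if_card_ge_2)
  let ?N = "\<lambda>r. {x \<in> H.B. blue r x}"
  have N: "card (?N s) \<le> Suc 0" if "s \<in> H.R" for s
    using HS.equal_le_1[of s] c eq that H.RB(6) by (intro card_le_Suc0_iff_eq[THEN iffD2]) auto
  have "card (?N r1 \<union> ?N r2) \<le> 2" using N[OF r(1)] N[OF r(2)] card_Un_le[of "?N r1" "?N r2"] by linarith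
  then have "card (?N r1 \<union> ?N r2) < card H.B" using c V by simp
  then obtain x where x: "x \<in> H.B" "x \<notin> ?N r1 \<union> ?N r2"
    by (metis (no_types, lifting) H.RB(6) card_mono finite_Un finite_subset mem_Collect_eq not_le subsetI)
  have "red r x" if "r \<in> H.R" "\<not> blue r x" for r
    using cases_part[of r x] that x H.part_in[OF that(1)] H.RB(1) H.RB(4) by blast
  then have "red x r1" "red x r2" using x r symr by blast+
  then show False using H.equal_le_1[of x r1 r2] x(1) r c by simp
qed

theorem big_part:
  assumes V: "card V = 3 * m + 2" "2 \<le> m" and p: "p \<in> V" "card (part p) = m"
    and small: "\<And>x. x \<in> V \<Longrightarrow> card (part x) \<le> m"
  shows "mono_cyc (2 * m + 2)"
proof -
  interpret S: bicol V blue red by (rule swap)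
  show ?thesis
    using big_part_aux[OF assms] S.big_part_aux[of m p] assms swap_part swap_mono by fastforce
qed

end

section \<open>A cycle avoiding a nontrivial part\<close>

text \<open>The cycle comes from the induction hypothesis on \<open>V\<close> without \<open>p'\<close> and without one
  neighbour of \<open>p\<close> in each color; this is the origin of \<open>PZ\<close> and \<open>nbr\<close>.\<close>

locale twin_cycle = redcycle +
  fixes m :: nat and p p' :: 'a
  assumes m3: "3 \<le> m" and cV: "card V = 3 * m + 2" and L: "length zs = 2 * m"
    and nom: "\<not> mono_cyc (2 * m + 2)" and small: "x \<in> V \<Longrightarrow> card (part x) \<le> m - 1"
    and p: "p \<in> V" "p' \<in> part p" "p \<noteq> p'" and PZ: "part p \<inter> set zs = {}"
    and nbr: "S p = {} \<or> (\<exists>y\<in>V - set zs. red p y)"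
begin

abbreviation W where "W \<equiv> V - set zs"

text \<open>\<open>Om\<close> is the union of the parts that are split by the cycle. Inserting a red path of
  two vertices shows that its vertices are blue to everything outside the cycle and their own part.\<close>

definition Om where "Om = {x \<in> V. part x \<inter> set zs \<noteq> {} \<and> part x \<inter> W \<noteq> {}}"

definition G where "G = Om \<inter> set zs"

text \<open>For \<open>u\<close> and \<open>v\<close> outside the cycle these are common blue
  neighbours: a cycle vertex in the part of \<open>u\<close> is split, so a cycle vertex outside
  \<open>Om\<close> that is not red to \<open>u\<close> is blue to it.\<close>

definition D where "D u v = set zs - Om - (S u \<union> S v)"

lemma card_zs: "card (set zs) = 2 * m" using cycD(1)[OF cz] distinct_card L by metis

lemma card_W: "card W = m + 2" using fin zV cV card_zs by (simp add: card_Diff_subset)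

lemma finG: "finite G" by (simp add: G_def)

lemma finD: "finite (D u v)" by (simp add: D_def)

lemma Om_sub: "Om \<subseteq> V" by (auto simp: Om_def)

lemma S_twin: "x \<in> V \<Longrightarrow> y \<in> part x \<Longrightarrow> S y = S x"
  using part_twin(1)[of x y] zV by (auto simp: S_def)

lemma p_W: "p \<in> W" "p' \<in> W" "part p \<subseteq> W" "p' \<in> V" "S p' = S p"
proof -
  show "part p \<subseteq> W" using PZ part_sub by blast
  then show "p \<in> W" "p' \<in> W" "p' \<in> V" using p part_self by blast+
  show "S p' = S p" using S_twin p by blast
qed

lemma part_p_Om: "part p \<inter> Om = {}"
  using part_eq[OF p(1)] PZ by (auto simp: Om_def)

lemma nxt_zs: "v \<in> set zs \<Longrightarrow> nxt zs v \<in> set zs" "v \<in> set zs \<Longrightarrow> red v (nxt zs v)"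
  using cyc_nxt[OF cz] bij_nxt[OF cycD(1)[OF cz]] by (auto simp: bij_betw_def)

text \<open>If \<open>u\<close> and \<open>q\<close> were joined in red, they could be inserted
  behind the twin \<open>z\<close> of \<open>q\<close>: \<open>u\<close> is red to \<open>z\<close>,
  and \<open>q\<close> is red to the successor of \<open>z\<close>.\<close>

lemma split_blue:
  assumes "z \<in> set zs" "q \<in> W" "z \<in> part q" "u \<in> W" "u \<notin> part q"
  shows "blue q u"
proof (rule ccontr)
  assume "\<not> ?thesis"
  then have r: "red u q" using cases_part[of q u] assms symr by blast
  have "z \<in> S u" using part_twin(3)[of q z u] r assms by (auto simp: S_def)
  moreover have "nxt zs z \<in> S q"
    using part_twin(1)[of q z "nxt zs z"] nxt_zs[OF assms(1)] assms zV by (auto simp: S_def)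
  ultimately show False using insert_edge[of u q z] r assms by blast
qed

lemma Om_part: "x \<in> Om \<Longrightarrow> y \<in> part x \<Longrightarrow> y \<in> Om"
  using part_eq[of x y] part_sub by (auto simp: Om_def)

lemma Om_blue:
  assumes x: "x \<in> Om" and u: "u \<in> W \<or> u \<in> Om" "u \<notin> part x"
  shows "blue x u" "blue u x"
proof -
  have b: "blue x u" if "u \<in> W" "u \<notin> part x" for u
  proof -
    obtain q z where q: "q \<in> part x" "q \<in> W" "z \<in> part x" "z \<in> set zs" using x by (auto simp: Om_def)
    have xV: "x \<in> V" using x Om_sub by auto
    have "part q = part x" using part_eq[OF xV q(1)] .
    then have "blue q u" using split_blue[of z q u] q that by simp
    then show ?thesis using part_twin(2)[OF xV q(1)] that by blast
  qed
  show "blue x u"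
  proof (cases "u \<in> W")
    case True
    then show ?thesis using b u by blast
  next
    case False
    then have uO: "u \<in> Om" using u by blast
    then obtain u' where u': "u' \<in> part u" "u' \<in> W" by (auto simp: Om_def)
    have V: "u \<in> V" "x \<in> V" using uO x Om_sub by auto
    have "u' \<notin> part x"
    proof
      assume "u' \<in> part x"
      then have "part x = part u" using part_eq[OF V(1) u'(1)] part_eq[OF V(2)] by simp
      then show False using u(2) part_self[OF V(1)] by simp
    qed
    then have "blue x u'" using b u' by blast
    then show ?thesis using part_twin(4)[OF V(1) u'(1) V(2)] by simp
  qed
  then show "blue u x" by (rule symb)
qed

text \<open>Consecutive vertices of the cycle are joined in red, so by \<open>Om_blue\<close> they
  are not both split.\<close>

lemma card_G: "card G \<le> m"
proof (rule ccontr)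
  assume "\<not> ?thesis"
  then have "length zs + 1 \<le> 2 * card G" using L by simp
  then have "1 \<le> card {v \<in> G. nxt zs v \<in> G}"
    by (rule consecutive_pairs[OF cycD(1)[OF cz], rotated]) (simp add: G_def)
  then have "{v \<in> G. nxt zs v \<in> G} \<noteq> {}" by force
  then obtain v where v: "v \<in> Om" "nxt zs v \<in> Om" "v \<in> set zs" by (auto simp: G_def)
  have r: "red v (nxt zs v)" using nxt_zs v by blast
  then have "nxt zs v \<notin> part v" using part_not by blast
  then show False using Om_blue[OF v(1)] v(2) r disj by blast
qed

lemma D_blue:
  assumes "u \<in> W" "v \<in> W" "x \<in> D u v" shows "blue u x" "blue x v"
proof -
  have b: "blue u x" if "u \<in> W" "x \<in> set zs" "x \<notin> Om" "x \<notin> S u" for u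
  proof -
    have "x \<notin> part u"
    proof
      assume a: "x \<in> part u"
      then have "part x = part u" using part_eq that(1) by blast
      then show False using that a part_self[of u] zV by (auto simp: Om_def)
    qed
    then show ?thesis using cases_part[of u x] that zV by (auto simp: S_def)
  qed
  show "blue u x" "blue x v" using b[of u] b[of v] assms symb by (auto simp: D_def)
qed

lemma card_D: "u \<in> W \<Longrightarrow> v \<in> W \<Longrightarrow> 2 * m \<le> card (D u v) + card G + card (S u \<union> S v)"
proof -
  assume uv: "u \<in> W" "v \<in> W"
  have "set zs = D u v \<union> G \<union> (S u \<union> S v)" using S_sub by (auto simp: D_def G_def)
  from arg_cong[OF this, of card] have "card (set zs) \<le> card (D u v) + card G + card (S u \<union> S v)"
    using card_Un_le[of "D u v \<union> G" "S u \<union> S v"] card_Un_le[of "D u v" G] by linarith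
  then show ?thesis using card_zs by simp
qed

text \<open>If \<open>v\<close> and the vertex two steps behind it are both in \<open>S p\<close>,
  the path \<open>p, y, p'\<close> can replace the vertex between them. By \<open>cross_le_1\<close>
  for the twins, at most one consecutive pair lies in \<open>S p\<close>. So \<open>S p\<close> and
  its two shifts are nearly disjoint, and \<open>3 * card (S p) \<le> 2 * m + 2\<close>.\<close>

lemma card_S_p: "card (S p) \<le> m - 1"
proof -
  let ?f = "nxt zs" and ?U = "S p"
  have bij: "bij_betw ?f (set zs) (set zs)" using cycD(1)[OF cz] by (rule bij_nxt)
  then have inj: "inj_on ?f (set zs)" and im: "?f ` set zs = set zs" by (auto simp: bij_betw_def)
  have fU: "finite ?U" "finite (?f ` ?U)" "finite (?f ` ?f ` ?U)" using finS by auto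
  have sub: "?U \<subseteq> set zs" "?f ` ?U \<subseteq> set zs" "?f ` ?f ` ?U \<subseteq> set zs" using S_sub[of p] im by blast+
  have c: "card (?f ` ?U) = card ?U" "card (?f ` ?f ` ?U) = card ?U"
    using inj sub by (auto simp: card_image inj_on_subset)
  have gap: False if "v \<in> ?U" "?f (?f v) \<in> ?U" for v
  proof -
    have "\<exists>y\<in>W. red p y" using nbr that(1) by blast
    then obtain y where y: "y \<in> W" "red p y" by blast
    have "red y p'" using part_twin(1)[OF p(1,2), of y] y symr by auto
    have "red p' (?f (?f v))" using that(2) p_W(5) by (auto simp: S_def)
    have d: "distinct [p, y, p']" using p(3) y irr \<open>red y p'\<close> by auto
    have len: "4 \<le> length zs" using L m3 by simp
    have v: "v \<in> set zs" "red v p" using that(1) symr by (auto simp: S_def)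
    have n: "p \<notin> set zs" "y \<notin> set zs" "p' \<notin> set zs" using y p_W by auto
    obtain ys where "cyc red ys" "set ys \<subseteq> {p, y, p'} \<union> set zs" "length ys = length zs + 2"
      by (rule cyc_replace[where E=red, OF cz v(1) n d v(2) y(2) \<open>red y p'\<close> \<open>red p' (?f (?f v))\<close> len])
    then show False using no2[of ys] y p_W p zV by auto
  qed
  have one: "card (?U \<inter> ?f ` ?U) \<le> 1"
  proof -
    have "?U \<inter> ?f ` ?U \<subseteq> ?f ` {v \<in> S p. ?f v \<in> S p'}" using p_W(5) by auto
    then have "card (?U \<inter> ?f ` ?U) \<le> card (?f ` {v \<in> S p. ?f v \<in> S p'})"
      using finS by (intro card_mono) auto
    also have "\<dots> \<le> card {v \<in> S p. ?f v \<in> S p'}" using finS by (intro card_image_le) auto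
    also have "\<dots> \<le> 1" using cross_le_1 p_W p(3) by blast
    finally show ?thesis .
  qed
  have "(?U \<union> ?f ` ?U) \<inter> ?f ` ?f ` ?U \<subseteq> ?f ` (?U \<inter> ?f ` ?U)"
  proof
    fix x assume "x \<in> (?U \<union> ?f ` ?U) \<inter> ?f ` ?f ` ?U"
    then obtain v where v: "v \<in> ?U" "x = ?f (?f v)" "x \<in> ?U \<or> x \<in> ?f ` ?U" by blast
    then obtain u where u: "u \<in> ?U" "?f u = ?f (?f v)" using gap by auto
    then have "u = ?f v" using inj sub v(1) by (meson image_eqI inj_onD subsetD)
    then show "x \<in> ?f ` (?U \<inter> ?f ` ?U)" using u v by auto
  qed
  then have "card ((?U \<union> ?f ` ?U) \<inter> ?f ` ?f ` ?U) \<le> card (?f ` (?U \<inter> ?f ` ?U))"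
    using fU by (intro card_mono) auto
  also have "\<dots> \<le> 1" using one card_image_le[of "?U \<inter> ?f ` ?U" ?f] fU by simp
  finally have two: "card ((?U \<union> ?f ` ?U) \<inter> ?f ` ?f ` ?U) \<le> 1" .
  have "card (?U \<union> ?f ` ?U \<union> ?f ` ?f ` ?U) \<le> card (set zs)" using sub by (intro card_mono) auto
  then have "3 * card ?U \<le> 2 * m + 2"
    using card_Un_Int[OF fU(1,2)] card_Un_Int[of "?U \<union> ?f ` ?U" "?f ` ?f ` ?U"] fU one two c card_zs by simp
  then show ?thesis using m3 by simp
qed

text \<open>Two vertices with insertion places at different cycle edges would extend the cycle by two, so
  apart from one vertex \<open>w\<close> all insertion places are the same edge, the one starting at \<open>e\<close>.\<close>

lemma exceptional:
  obtains w e where "w \<in> W" "w \<notin> part p"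
    "\<And>u v. u \<in> W \<Longrightarrow> u \<noteq> w \<Longrightarrow> v \<in> S u \<Longrightarrow> nxt zs v \<in> S u \<Longrightarrow> v = e"
proof -
  let ?c = "\<lambda>u v. v \<in> S u \<and> nxt zs v \<in> S u"
  have "card (part p) < card W" using small[OF p(1)] card_W by linarith
  then have "\<not> W \<subseteq> part p" using fin_part card_mono by (metis not_le)
  then obtain w0 where w0: "w0 \<in> W" "w0 \<notin> part p" by blast
  show thesis
  proof (cases "\<exists>u\<in>W. \<exists>v v'. ?c u v \<and> ?c u v' \<and> v \<noteq> v'")
    case True
    then obtain u v v' where u: "u \<in> W" "?c u v" "?c u v'" "v \<noteq> v'" by blast
    have none: False if "u' \<in> W" "u' \<noteq> u" "?c u' x" for u' x
      using insert_same[of u u' v x] insert_same[of u u' v' x] u that by metis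
    \<comment> \<open>\<open>u\<close> has two insertion places and so is the only vertex with any;
      within \<open>part p\<close> it would share them with a twin.\<close>
    have "u \<notin> part p"
    proof
      assume a: "u \<in> part p"
      have "\<exists>u'. u' \<in> W \<and> u' \<noteq> u \<and> S u' = S u"
        using a S_twin[OF p(1) a] p_W p(3) by metis
      then show False using none[of _ v] u(2) by auto
    qed
    \<comment> \<open>No insertion places remain besides those of \<open>u\<close>, so
      \<open>e\<close> is arbitrary.\<close>
    then show thesis using that[of u undefined] u(1) none by blast
  next
    case False
    show thesis
    proof (cases "\<exists>u\<in>W. \<exists>v. ?c u v")
      case True
      then obtain u v where u: "u \<in> W" "?c u v" by blast
      have "x = v" if "u' \<in> W" "?c u' x" for u' x
        using insert_same[of u u' v x] u that False by metis
      then show thesis using that[of w0 v] w0 by blast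
    next
      case False
      then show thesis using that[of w0 undefined] w0 by blast
    qed
  qed
qed

end

section \<open>Counting blue neighbours with the exceptional vertex set apart\<close>

locale twin_cycle_exc = twin_cycle +
  fixes w e
  assumes w: "w \<in> W" "w \<notin> part p"
    and we: "u \<in> W \<Longrightarrow> u \<noteq> w \<Longrightarrow> v \<in> S u \<Longrightarrow> nxt zs v \<in> S u \<Longrightarrow> v = e"
begin

lemma w_p: "p \<noteq> w" "p' \<noteq> w" using w p part_self by auto

lemma card_S: "u \<in> W \<Longrightarrow> u \<noteq> w \<Longrightarrow> card (S u) \<le> m"
proof (rule ccontr)
  assume u: "u \<in> W" "u \<noteq> w" and "\<not> card (S u) \<le> m"
  then have "length zs + 2 \<le> 2 * card (S u)" using L by simp
  then have "2 \<le> card {v \<in> S u. nxt zs v \<in> S u}"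
    by (rule consecutive_pairs[OF cycD(1)[OF cz] S_sub])
  then obtain v v' where "v \<in> {v \<in> S u. nxt zs v \<in> S u}" "v' \<in> {v \<in> S u. nxt zs v \<in> S u}" "v \<noteq> v'"
    by (rule ex_two_if_card_ge_2)
  then show False using we u by blast
qed

lemma card_union:
  assumes "u \<in> W" "u \<noteq> w" "u' \<in> W" "u' \<noteq> w" "u \<noteq> u'" shows "card (S u \<union> S u') \<le> m + 1"
proof -
  have "{v \<in> set zs. v \<in> S u \<and> nxt zs v \<in> S u \<or> v \<in> S u' \<and> nxt zs v \<in> S u'} \<subseteq> {e}"
    using we assms by blast
  then have "card {v \<in> set zs. v \<in> S u \<and> nxt zs v \<in> S u \<or> v \<in> S u' \<and> nxt zs v \<in> S u'} \<le> 1"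
    using card_mono[of "{e}"] by simp
  from card_union_S[OF assms(1,3,5) this] show ?thesis using L by simp
qed

lemma card_D_ge:
  assumes "u \<in> W" "u \<noteq> w" "u' \<in> W" "u' \<noteq> w" "u \<noteq> u'" shows "m - 1 \<le> card (D u u') + card G"
  using card_D[of u u'] card_union[OF assms] assms by linarith

text \<open>Two better than \<open>card_D_ge\<close>, because the twins share their red neighbours.
  This makes \<open>p, p'\<close> the rich pair of every cyclic order used below.\<close>

lemma card_D_p: "m + 1 \<le> card (D p p') + card G" "D p' p = D p p'"
  using card_D[of p p'] card_S_p p_W m3 by (simp_all add: D_def Un_commute)

text \<open>The rich pair alone meets the demand of all \<open>m + 1\<close> pairs, so Hall's
  condition can only fail on the other \<open>m\<close> pairs, where \<open>hall_deficit_one\<close>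
  applies.\<close>

lemma Hall_order:
  assumes Om: "Om = {}" and us: "distinct us" "set us \<subseteq> W - {w}" "length us = m + 1" "us ! 0 = p" "us ! 1 = p'"
  shows "D (us ! 1) (us ! 2) = D (us ! 2) (us ! 3)" "card (D (us ! 1) (us ! 2)) = m - 1"
proof -
  let ?A = "\<lambda>i. D (us ! i) (us ! (Suc i mod (m + 1)))"
  have G0: "card G = 0" using Om by (simp add: G_def)
  have in_W: "us ! i \<in> W - {w}" if "i < m + 1" for i using us(2) nth_mem[of i us] that unfolding us(3) by blast
  have md: "Suc i mod (m + 1) < m + 1" for i by simp
  have ge: "m - 1 \<le> card (?A i)" if "i < m + 1" for i
  proof -
    have "Suc i mod (m + 1) \<noteq> i" using that m3 by (cases "i = m") auto
    then have "us ! i \<noteq> us ! (Suc i mod (m + 1))" using us(1,3) that md[of i] by (simp add: nth_eq_iff_index_eq)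
    then show ?thesis using card_D_ge[of "us ! i" "us ! (Suc i mod (m + 1))"] in_W[OF that] in_W[OF md[of i]] G0 by auto
  qed
  have A0: "m + 1 \<le> card (?A 0)" using card_D_p us(4,5) G0 m3 by simp
  have TD: "?A i \<subseteq> {x \<in> set zs. blue (us ! i) x \<and> blue x (us ! (Suc i mod (m + 1)))}" if "i < m + 1" for i
    using D_blue[of "us ! i" "us ! (Suc i mod (m + 1))"] in_W[OF that] in_W[OF md[of i]] by (auto simp: D_def)
  have "D (us ! 1) (us ! 2) = D (us ! 2) (us ! 3) \<and> card (D (us ! 1) (us ! 2)) = m - 1"
  proof (rule ccontr)
    assume neg: "\<not> ?thesis"
    have d: "set us \<inter> set zs = {}" using us by auto
    have m1: "2 \<le> m + 1" using m3 by simp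
    obtain ys where "cyc blue ys" "set ys \<subseteq> set us \<union> set zs" "length ys = 2 * (m + 1)"
    proof (rule hall_cycle[OF us(1,3) m1 finite_set d, of blue])
      fix J assume J: "J \<subseteq> {..<m + 1}" "J \<noteq> {}"
      have fJ: "finite J" using J(1) finite_subset by blast
      have "card (\<Union>(?A ` J)) \<le> card (\<Union>i\<in>J. {x \<in> set zs. blue (us ! i) x \<and> blue x (us ! (Suc i mod (m + 1)))})"
      proof (rule card_mono)
        show "finite (\<Union>i\<in>J. {x \<in> set zs. blue (us ! i) x \<and> blue x (us ! (Suc i mod (m + 1)))})" using fJ by auto
      qed (use TD J(1) in blast)
      moreover have "card J \<le> card (\<Union>(?A ` J))"
      proof (cases "0 \<in> J")
        case True
        then have "card (?A 0) \<le> card (\<Union>(?A ` J))" using fJ finD by (intro card_mono) auto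
        moreover have "card J \<le> m + 1" using J(1) card_mono[of "{..<m + 1}" J] by simp
        ultimately show ?thesis using A0 by linarith
      next
        case False
        then have J1: "J \<subseteq> {1..<m + 1}" using J(1) by (auto simp: Suc_le_eq intro: gr0I)
        have cJ: "card J \<le> m" using card_mono[OF _ J1] by simp
        show ?thesis
        proof (rule ccontr)
          assume "\<not> ?thesis"
          then have v: "card (\<Union>(?A ` J)) < card J" by simp
          have geJ: "m - 1 \<le> card (?A i)" if "i \<in> J" for i using ge that J(1) by auto
          have "card J = m" by (rule hall_deficit_one(1)[OF fJ J(2) finD geJ cJ v])
          then have "J = {1..<m + 1}" using J1 by (intro card_subset_eq) auto
          then have J01: "1 \<in> J" "2 \<in> J" using m3 by auto
          have "?A 1 = ?A 2 \<and> card (?A 1) = m - 1"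
            by (rule hall_deficit_one(2)[OF fJ J(2) finD geJ cJ v J01])
          moreover have "?A 1 = D (us ! 1) (us ! 2)" "?A 2 = D (us ! 2) (us ! 3)"
            using m3 by (simp_all add: numeral_2_eq_2 numeral_3_eq_3)
          ultimately show False using neg by metis
        qed
      qed
      ultimately show "card J \<le> card (\<Union>i\<in>J. {x \<in> set zs. blue (us ! i) x \<and> blue x (us ! (Suc i mod (m + 1)))})"
        by linarith
    qed
    then show False using nom monoI(2)[of ys] us zV by auto
  qed
  then show "D (us ! 1) (us ! 2) = D (us ! 2) (us ! 3)" "card (D (us ! 1) (us ! 2)) = m - 1" by auto
qed

text \<open>Exchanging \<open>u\<close> and \<open>v\<close> shows that the red neighbourhoods of
  \<open>p'\<close>, \<open>u\<close> and \<open>v\<close> cover, in pairs, the same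
  \<open>m + 1\<close> cycle vertices. These contain two consecutive pairs, one of which does not
  start at \<open>e\<close>.\<close>

lemma unsplit_contra:
  assumes Om: "Om = {}" shows False
proof -
  have "card (W - {w, p, p'}) = card W - card {w, p, p'}"
    using w p_W by (intro card_Diff_subset) auto
  then have le: "m - 1 \<le> card (W - {w, p, p'})" using card_W w_p p(3) by simp
  have fW: "finite (W - {w, p, p'})" using fin by simp
  obtain us where us: "distinct us" "set us \<subseteq> W - {w, p, p'}" "length us = m - 1"
    by (rule distinct_list_in[OF fW le])
  have "Suc (Suc 0) \<le> length us" using us m3 by simp
  then obtain u v rest where u: "us = u # v # rest" by (auto simp: Suc_le_length_iff)
  let ?p = "p # p' # u # v # rest" and ?q = "p # p' # v # u # rest"
  have d: "distinct ?p" "set ?p \<subseteq> W - {w}" "length ?p = m + 1" "distinct ?q" "set ?q \<subseteq> W - {w}" "length ?q = m + 1"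
    using us u m3 p(3) p_W w_p by auto
  have P: "D p' u = D u v" "card (D p' u) = m - 1"
    using Hall_order[OF Om d(1-3)] by (simp_all add: numeral_2_eq_2 numeral_3_eq_3)
  have Q: "D p' v = D v u"
    using Hall_order[OF Om d(4-6)] by (simp_all add: numeral_2_eq_2 numeral_3_eq_3)
  let ?U = "set zs - D p' u"
  have DS: "S x \<union> S y = set zs - D x y" for x y using Om S_sub by (auto simp: D_def)
  have eq: "S p' \<union> S u = ?U" "S u \<union> S v = ?U" "S p' \<union> S v = ?U"
    using DS P(1) Q DS[of u v] DS[of v u] by (auto simp: Un_commute)
  have "card ?U = 2 * m - (m - 1)" using P(2) card_zs finD by (subst card_Diff_subset) (auto simp: D_def)
  then have "length zs + 2 \<le> 2 * card ?U" using L m3 by simp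
  then have "2 \<le> card {v \<in> ?U. nxt zs v \<in> ?U}"
    by (rule consecutive_pairs[OF cycD(1)[OF cz] Diff_subset])
  then obtain a b where ab: "a \<in> {v \<in> ?U. nxt zs v \<in> ?U}" "b \<in> {v \<in> ?U. nxt zs v \<in> ?U}" "a \<noteq> b"
    by (rule ex_two_if_card_ge_2)
  have fal: False if "a \<in> ?U" "nxt zs a \<in> ?U" "a \<noteq> e" for a
    by (rule three_cover[OF eq that(1,2)]) (use we that(3) d(2) in auto)
  show False using fal[of a] fal[of b] ab by blast
qed

text \<open>With many split vertices on the cycle, \<open>W \<union> G\<close> is so dense in blue that its closure in the
  sense of Bondy and Chvatal is complete; if it has only \<open>2 m + 1\<close> vertices, one vertex of the cycle
  is added.\<close>

lemma large_split_contra: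
  assumes a: "m - 1 \<le> card G" shows False
proof -
  have GO: "G \<subseteq> Om" "G \<subseteq> set zs" by (auto simp: G_def)
  have fO: "finite Om" using Om_sub fin finite_subset by blast
  have "G \<noteq> {}" using a m3 by auto
  then obtain z0 where z0: "z0 \<in> Om" "z0 \<in> set zs" using GO by blast
  have ex_W: "\<exists>q. q \<in> part x \<and> q \<in> W" if "x \<in> Om" for x using that by (auto simp: Om_def)
  obtain q0 where q0: "q0 \<in> part z0" "q0 \<in> W" using ex_W z0 by blast
  \<comment> \<open>A part has at most \<open>m - 1\<close> vertices, and here one of them is
    \<open>q0\<close> outside the cycle. So a second part is split, and \<open>Om\<close> has at
    least two vertices in \<open>W\<close>.\<close>
  have "\<not> G \<subseteq> part z0 - {q0}"
  proof
    assume "G \<subseteq> part z0 - {q0}"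
    then have "card G \<le> card (part z0 - {q0})" using fin_part by (intro card_mono) auto
    moreover have "card (part z0 - {q0}) < m - 1"
      using small[of z0] q0 z0 Om_sub fin_part[of z0] m3 card_gt_0_iff[of "part z0"]
      by (auto simp: card_Diff_singleton)
    ultimately show False using a by simp
  qed
  moreover have "q0 \<notin> G" using q0 by (auto simp: G_def)
  ultimately obtain z1 where z1: "z1 \<in> Om" "z1 \<notin> part z0" using GO by blast
  obtain q1 where q1: "q1 \<in> part z1" "q1 \<in> W" using ex_W z1 by blast
  have V01: "z0 \<in> V" "z1 \<in> V" using z0 z1 Om_sub by auto
  have ne: "q0 \<noteq> q1" using part_eq[OF V01(1) q0(1)] part_eq[OF V01(2) q1(1)] z1 part_self[OF V01(2)] by auto
  have qO: "q0 \<in> Om" "q1 \<in> Om" using Om_part z0 z1 q0 q1 by blast+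
  have "card {q0, q1} \<le> card (Om \<inter> W)" using qO q0 q1 fO by (intro card_mono) auto
  then have sig: "2 \<le> card (Om \<inter> W)" using ne by simp
  obtain q where q: "q \<in> Om" "q \<in> W" "q \<noteq> w" using qO q0 q1 ne by metis
  have cOm: "card Om = card (Om \<inter> W) + card G"
  proof -
    have "Om = (Om \<inter> W) \<union> G" using Om_sub by (auto simp: G_def)
    then have "card Om = card ((Om \<inter> W) \<union> G)" by simp
    also have "\<dots> = card (Om \<inter> W) + card G" using fO finG by (intro card_Un_disjoint) (auto simp: G_def)
    finally show ?thesis .
  qed
  \<comment> \<open>\<open>W \<union> G\<close> has \<open>m + 2 + card G\<close> vertices, at most
    one short of \<open>2 * m + 2\<close>. A vertex that fills the gap needs two blue neighbours in
    \<open>Om\<close>. The part of \<open>q\<close> provides them, with \<open>q\<close> different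
    from \<open>w\<close> so that \<open>S q\<close> is bounded.\<close>
  have "\<exists>X. X \<subseteq> set zs - Om \<and> card X = m - card G \<and> (\<forall>x\<in>X. \<exists>N. N \<subseteq> Om \<and> 2 \<le> card N \<and> (\<forall>y\<in>N. blue x y))"
  proof (cases "card G = m")
    case True
    then show ?thesis by (intro exI[of _ "{}"]) auto
  next
    case False
    then have cG: "card G = m - 1" using a card_G by linarith
    have "card (set zs - G) = m + 1" using GO cG card_zs m3 finG by (subst card_Diff_subset) auto
    moreover have "card (S q) \<le> m" using card_S q by blast
    ultimately have "\<not> set zs - G \<subseteq> S q" using card_mono[OF finS] by (metis Suc_eq_plus1 not_less_eq_eq order_trans)
    then obtain x where x: "x \<in> set zs" "x \<notin> Om" "x \<notin> S q" by (auto simp: G_def)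
    obtain z where z: "z \<in> part q" "z \<in> set zs" using q(1) by (auto simp: Om_def)
    have qV: "q \<in> V" using q by blast
    have "card {z, q} \<le> card (part q)" using z part_self[OF qV] fin_part by (intro card_mono) auto
    moreover have "z \<noteq> q" using z q by auto
    ultimately have c2: "2 \<le> card (part q)" by simp
    have "blue q x" using D_blue(1)[of q q x] q x by (auto simp: D_def)
    then have "blue x y" if "y \<in> part q" for y using part_twin(2)[OF qV that, of x] x zV symb by blast
    then show ?thesis
      using x cG m3 c2 Om_part[OF q(1)] by (intro exI[of _ "{x}"]) (auto intro!: exI[of _ "part q"])
  qed
  then obtain X where X: "X \<subseteq> set zs - Om" "card X = m - card G"
    "\<And>x. x \<in> X \<Longrightarrow> \<exists>N. N \<subseteq> Om \<and> 2 \<le> card N \<and> (\<forall>y\<in>N. blue x y)" by blast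
  define Y where "Y = (W \<union> G) \<union> X"
  have fX: "finite X" using X(1) finite_subset by blast
  have fY: "finite Y" using fX fin finG by (auto simp: Y_def)
  have cWG: "card (W \<union> G) = m + 2 + card G" using fin finG card_W GO by (subst card_Un_disjoint) auto
  have cY: "card Y = 2 * m + 2"
    using fX fin finG X(1,2) cWG card_G unfolding Y_def by (subst card_Un_disjoint) (auto simp: G_def)
  have YV: "Y \<subseteq> V" using X(1) zV GO by (auto simp: Y_def)
  have OY: "Om \<subseteq> W \<union> G" using Om_sub by (auto simp: G_def)
  have noham: "\<not> ham blue Y"
  proof
    assume "ham blue Y"
    then obtain xs where xs: "cyc blue xs" "set xs = Y" unfolding ham_def by blast
    then have "length xs = 2 * m + 2" using cY distinct_card[OF cycD(1)[OF xs(1)]] by simp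
    then show False using monoI(2)[of xs] xs nom YV by metis
  qed
  have Y3: "3 \<le> card Y" using cY m3 by simp
  obtain F d where F: "symp F" "\<And>x y. blue x y \<Longrightarrow> F x y"
    "\<And>u N. N \<subseteq> Y - {u} \<Longrightarrow> (\<And>y. y \<in> N \<Longrightarrow> F u y) \<Longrightarrow> card N \<le> d u"
    "\<And>u v. u \<in> Y \<Longrightarrow> v \<in> Y \<Longrightarrow> u \<noteq> v \<Longrightarrow> card Y \<le> d u + d v \<Longrightarrow> F u v"
    "\<exists>u\<in>Y. \<exists>v\<in>Y. u \<noteq> v \<and> \<not> F u v"
    by (rule maximal_nonham_degrees[OF fY sympb noham Y3]) blast
  \<comment> \<open>The closure works in rounds: degree \<open>m + 2\<close> makes \<open>Om\<close>
    a clique, its degree then rises to \<open>2 * m\<close>, which joins it to \<open>X\<close>, and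
    finally every vertex outside \<open>Om\<close> is adjacent to the at least \<open>m + 1\<close>
    vertices of \<open>Om\<close>.\<close>
  have dO: "m + 2 \<le> d x" if x: "x \<in> Om" for x
  proof -
    have xV: "x \<in> V" using x Om_sub by auto
    have "card (W \<union> G) - card (part x) \<le> card ((W \<union> G) - part x)" using fin_part by (rule diff_card_le_card_Diff)
    also have "\<dots> \<le> d x"
    proof (rule F(3))
      show "(W \<union> G) - part x \<subseteq> Y - {x}" using part_self[OF xV] by (auto simp: Y_def)
      show "F x y" if "y \<in> (W \<union> G) - part x" for y
        using Om_blue(1)[OF x] that GO F(2) by blast
    qed
    finally show ?thesis using cWG small[OF xV] a m3 by linarith
  qed
  have FO: "F x y" if "x \<in> Om" "y \<in> W \<union> G" "x \<noteq> y" for x y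
  proof (cases "y \<in> Om")
    case True
    then show ?thesis
      using F(4)[of x y] dO[of x] dO[of y] that OY cY by (auto simp: Y_def)
  next
    case False
    then show ?thesis using Om_blue(1)[of x y] that Om_part[of x y] GO F(2) by blast
  qed
  have dO': "2 * m \<le> d x" if x: "x \<in> Om" for x
  proof -
    have "card (W \<union> G) - 1 = card ((W \<union> G) - {x})" using x OY fin finG by auto
    also have "\<dots> \<le> d x" using FO x by (intro F(3)) (auto simp: Y_def)
    finally show ?thesis using cWG a by linarith
  qed
  have FX: "F x y" if "x \<in> Om" "y \<in> X" for x y
  proof (rule F(4))
    obtain N where N: "N \<subseteq> Om" "2 \<le> card N" "\<forall>z\<in>N. blue y z" using X(3) \<open>y \<in> X\<close> by blast
    have "card N \<le> d y" using N X(1) OY that F(2) by (intro F(3)) (auto simp: Y_def)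
    then show "card Y \<le> d x + d y" using dO'[OF that(1)] N(2) cY by linarith
  qed (use that X(1) OY in \<open>auto simp: Y_def\<close>)
  have FOY: "F x y" if "x \<in> Om" "y \<in> Y" "x \<noteq> y" for x y using FO FX that by (auto simp: Y_def)
  have dY: "m + 1 \<le> d y" if y: "y \<in> Y" for y
  proof (cases "y \<in> Om")
    case True
    then show ?thesis using dO' m3 by fastforce
  next
    case False
    have "F y x" if "x \<in> Om" for x using FOY[OF that y] F(1) False that by (metis sympD)
    then have "card Om \<le> d y" using False OY by (intro F(3)) (auto simp: Y_def)
    then show ?thesis using cOm sig a by linarith
  qed
  have "F u v" if "u \<in> Y" "v \<in> Y" "u \<noteq> v" for u v
    using F(4)[OF that] dY[OF that(1)] dY[OF that(2)] cY by linarith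
  then show False using F(5) by blast
qed

end

section \<open>Few split vertices on the cycle\<close>

text \<open>With few split vertices on the cycle, Hall's theorem applies to the cyclic order \<open>us\<close> of the
  vertices outside the cycle except \<open>d\<close>. Each split part is an interval of \<open>us\<close>, so that the number of
  consecutive pairs meeting the part exceeds its number of vertices in \<open>us\<close> by at most one.\<close>

locale split_order = twin_cycle_exc +
  fixes d us
  assumes G1: "1 \<le> card G" and Gm: "card G \<le> m - 2"
    and d: "d \<in> Om" "d \<in> W" and dw: "w \<in> Om \<Longrightarrow> d = w"
    and us: "distinct us" "set us = W - {d}"
    and us0: "us ! 0 = p'" "us ! 1 = p" and us2: "w \<in> W - {d} \<Longrightarrow> us ! 2 = w"
    and cont: "i \<le> j \<Longrightarrow> j \<le> k \<Longrightarrow> k < m + 1 \<Longrightarrow> us ! i \<in> Om \<Longrightarrow> us ! k \<in> part (us ! i) \<Longrightarrow> us ! j \<in> part (us ! i)"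
    and last: "i \<le> j \<Longrightarrow> j < m + 1 \<Longrightarrow> us ! i \<in> Om \<Longrightarrow> us ! j \<in> Om"
begin

abbreviation nx where "nx i \<equiv> Suc i mod (m + 1)"

text \<open>The vertex \<open>d\<close> leaves the cyclic order and joins the other side. The sets
  \<open>D\<close> may fall below \<open>m - 1\<close> by \<open>card G\<close>; the
  \<open>card G + 1\<close> vertices of \<open>K\<close>, blue to all of \<open>W\<close> outside
  their own parts, make up for this and gain one.\<close>

definition K where "K = insert d G"

definition A where "A i = {x \<in> insert d (set zs). blue (us ! i) x \<and> blue x (us ! nx i)}"

lemma len: "length us = m + 1"
proof -
  have "length us = card (W - {d})" using us distinct_card by metis
  then show ?thesis using card_W d fin by simp
qed

lemma us_in: "i < m + 1 \<Longrightarrow> us ! i \<in> W" "i < m + 1 \<Longrightarrow> us ! i \<noteq> d"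
  using us(2) nth_mem[of i us] unfolding len by blast+

lemma us_eq: "i < m + 1 \<Longrightarrow> j < m + 1 \<Longrightarrow> us ! i = us ! j \<longleftrightarrow> i = j"
  using us(1) len by (simp add: nth_eq_iff_index_eq)

lemma nx: "nx i < m + 1" "i < m + 1 \<Longrightarrow> nx i \<noteq> i" "i < m \<Longrightarrow> nx i = Suc i"
proof -
  show "nx i \<noteq> i" if "i < m + 1"
    using that m3 by (cases "i = m") auto
qed auto

lemma w_Om: "i < m + 1 \<Longrightarrow> us ! i = w \<Longrightarrow> w \<notin> Om \<and> i = 2"
proof -
  assume i: "i < m + 1" "us ! i = w"
  then have "w \<in> W - {d}" using us_in[OF i(1)] by simp
  moreover from this have "us ! 2 = w" by (rule us2)
  then have "i = 2" using us_eq[OF i(1), of 2] i m3 by simp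
  ultimately show ?thesis using dw by blast
qed

lemma K_Om: "K \<subseteq> Om" "finite K" "card K = card G + 1" "K \<inter> (W - {d}) = {}"
proof -
  have "d \<notin> G" using d by (simp add: G_def)
  then show "card K = card G + 1" using finG by (simp add: K_def)
  show "K \<subseteq> Om" "finite K" "K \<inter> (W - {d}) = {}" using d finG by (auto simp: K_def G_def)
qed

lemma finA: "finite (A i)" by (simp add: A_def)

lemma p_Om: "p \<notin> Om" "p' \<notin> Om" using part_p_Om part_self p by blast+

lemma K_A:
  assumes i: "i < m + 1" and x: "x \<in> K" "us ! i \<notin> part x" "us ! nx i \<notin> part x"
  shows "x \<in> A i"
proof -
  have "x \<in> Om" using K_Om x by blast
  then have "blue (us ! i) x" "blue x (us ! nx i)"
    using Om_blue us_in[OF i] us_in[OF nx(1)] x by blast+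
  then show ?thesis using x(1) by (auto simp: A_def K_def G_def)
qed

lemma D_A: "i < m + 1 \<Longrightarrow> D (us ! i) (us ! nx i) \<subseteq> A i"
  using D_blue[OF us_in(1) us_in(1)[OF nx(1)]] by (auto simp: A_def D_def)

lemma D_K: "D u v \<inter> K = {}" using K_Om by (auto simp: D_def)

lemma card_D_slot:
  assumes "i < m + 1" "us ! i \<noteq> w" "us ! nx i \<noteq> w"
  shows "m - 1 \<le> card (D (us ! i) (us ! nx i)) + card G"
  using card_D_ge us_in[OF assms(1)] us_in[OF nx(1)] us_eq[OF assms(1) nx(1)] nx(2)[OF assms(1)] assms by metis

lemma card_U:
  assumes "i < m + 1" "i \<in> J" "finite J" "K' \<subseteq> K" "K' \<subseteq> (\<Union>(A ` J))"
  shows "card (D (us ! i) (us ! nx i)) + card K' \<le> card (\<Union>(A ` J))"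
proof -
  have "card (D (us ! i) (us ! nx i)) + card K' = card (D (us ! i) (us ! nx i) \<union> K')"
    using D_K[of "us ! i" "us ! nx i"] assms(4) finD K_Om(2) finite_subset by (subst card_Un_disjoint) auto
  also have "\<dots> \<le> card (\<Union>(A ` J))"
    using D_A[OF assms(1)] assms finA by (intro card_mono) auto
  finally show ?thesis .
qed

text \<open>Every pair in \<open>J\<close> meets the part of the uncovered \<open>x\<close>, so
  \<open>card J\<close> exceeds the number of positions of this part by at most one. If a pair in
  \<open>J\<close> avoids \<open>w\<close> and the other split parts, its candidates include its set
  \<open>D\<close> and all of \<open>K - part x\<close>, and the bound on \<open>part x\<close>
  settles the count. Otherwise only the two boundary pairs of the interval can be in
  \<open>J\<close>.\<close>

lemma Hall_uncovered:
  assumes J: "J \<subseteq> {..<m + 1}" "J \<noteq> {}" and x: "x \<in> K" "x \<notin> (\<Union>(A ` J))"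
  shows "card J \<le> card (\<Union>(A ` J))"
proof -
  let ?U = "\<Union>(A ` J)"
  define I where "I = {i. i < m + 1 \<and> us ! i \<in> part x}"
  have fJ: "finite J" using J(1) finite_subset by blast
  have fU: "finite ?U" using fJ finA by auto
  have fI: "finite I" by (simp add: I_def)
  have xO: "x \<in> Om" "x \<in> V" using K_Om x Om_sub by auto
  have Q_Om: "part x \<subseteq> Om" using Om_part[OF xO(1)] by auto
  have Jlt: "i < m + 1" if "i \<in> J" for i using J(1) that by auto
  have touch: "i \<in> I \<or> nx i \<in> I" if "i \<in> J" for i
    using K_A[OF Jlt[OF that] x(1)] x(2) that Jlt[OF that] nx(1) by (auto simp: I_def)
  have I2: "2 \<le> i" if "i \<in> I" for i
  proof (rule ccontr)
    assume "\<not> ?thesis"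
    then have "i = 0 \<or> i = 1" by auto
    then have "us ! i \<notin> Om" using p_Om us0 by auto
    then show False using that Q_Om by (auto simp: I_def)
  qed
  have "I \<noteq> {}" using J(2) touch by blast
  define l where "l = Min I"
  define r where "r = Max I"
  have lI: "l \<in> I" "r \<in> I" "l \<le> r" using fI \<open>I \<noteq> {}\<close> by (auto simp: l_def r_def intro: order_trans[OF Min_le Max_ge])
  have plx: "part (us ! l) = part x" "part (us ! r) = part x"
    using part_eq[OF xO(2)] lI by (auto simp: I_def)
  have lr: "r < m + 1" "2 \<le> l" using lI I2 by (auto simp: I_def)
  have Ieq: "I = {l..r}"
  proof
    show "I \<subseteq> {l..r}" using fI by (auto simp: l_def r_def)
    have usl: "us ! l \<in> part x" "us ! r \<in> part x" using lI by (auto simp: I_def)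
    show "{l..r} \<subseteq> I"
    proof
      fix j assume j: "j \<in> {l..r}"
      then have "us ! j \<in> part (us ! l)" using usl Q_Om plx lr by (intro cont[of l j r]) auto
      then show "j \<in> I" using plx j lr by (auto simp: I_def)
    qed
  qed
  have Jsub: "J \<subseteq> {l - 1..r}"
  proof
    fix i assume i: "i \<in> J"
    consider "i \<in> I" | "nx i \<in> I" using touch[OF i] by blast
    then show "i \<in> {l - 1..r}"
    proof cases
      case 2
      then have "i \<noteq> m" using I2[of "nx i"] by auto
      then have "nx i = Suc i" using nx(3)[of i] Jlt[OF i] by simp
      then show ?thesis using 2 Ieq by auto
    qed (use Ieq in auto)
  qed
  have "card J \<le> card {l - 1..r}" using Jsub by (intro card_mono) auto
  then have cJ: "card J \<le> card I + 1" using Ieq lI lr by simp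
  show ?thesis
  proof (cases "\<exists>i\<in>J. us ! i \<noteq> w \<and> us ! nx i \<noteq> w \<and> us ! i \<in> part x \<union> - Om \<and> us ! nx i \<in> part x \<union> - Om")
    case True
    then obtain i where i: "i \<in> J" "us ! i \<noteq> w" "us ! nx i \<noteq> w" "us ! i \<in> part x \<union> - Om" "us ! nx i \<in> part x \<union> - Om"
      by blast
    have out: "u \<notin> part y" if "y \<in> K - part x" "u \<in> part x \<union> - Om" for u y
    proof
      assume u: "u \<in> part y"
      have y: "y \<in> Om" "y \<in> V" using that(1) K_Om Om_sub by auto
      then have "u \<in> part x" using Om_part[OF y(1) u] that(2) by blast
      then have "part y = part x" using part_eq[OF y(2) u] part_eq[OF xO(2), of u] by simp
      then show False using part_self[OF y(2)] that(1) by blast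
    qed
    have "K - part x \<subseteq> A i" using K_A[OF Jlt[OF i(1)]] out i(4,5) by blast
    then have 1: "card (D (us ! i) (us ! nx i)) + card (K - part x) \<le> card ?U"
      using i(1) by (intro card_U[OF Jlt[OF i(1)] i(1) fJ]) auto
    have 2: "m - 1 \<le> card (D (us ! i) (us ! nx i)) + card G" using card_D_slot[OF Jlt[OF i(1)]] i by blast
    have "card I = card ((!) us ` I)" by (rule card_image[symmetric]) (auto simp: inj_on_def I_def us_eq)
    also have "\<dots> + card (K \<inter> part x) = card ((!) us ` I \<union> (K \<inter> part x))"
      using fI K_Om(2,4) us_in by (subst card_Un_disjoint) (auto simp: I_def)
    also have "\<dots> \<le> card (part x)" using fin_part by (intro card_mono) (auto simp: I_def)
    also have "\<dots> \<le> m - 1" using small xO by blast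
    finally have "card I + card (K \<inter> part x) \<le> m - 1" .
    moreover have "card K = card (K \<inter> part x) + card (K - part x)"
      using K_Om(2) by (metis card_Diff_subset_Int card_mono finite_Int inf_le1 le_add_diff_inverse)
    ultimately show ?thesis using 1 2 cJ K_Om(3) m3 by linarith
  next
    case False
    then have other: "us ! i = w \<or> us ! nx i = w \<or> us ! i \<in> Om - part x \<or> us ! nx i \<in> Om - part x" if "i \<in> J" for i
      using that by blast
    have notw: "us ! i \<noteq> w" if "i \<in> I" for i using w_Om[of i] that Q_Om by (auto simp: I_def)
    have Dne: "\<exists>t. t \<in> ?U \<and> t \<notin> Om" if "i \<in> J" "us ! i \<noteq> w" "us ! nx i \<noteq> w" for i
    proof -
      have "m - 1 \<le> card (D (us ! i) (us ! nx i)) + card G" using card_D_slot[OF Jlt[OF that(1)]] that by blast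
      then have "card (D (us ! i) (us ! nx i)) \<noteq> 0" using Gm m3 by linarith
      then obtain t where "t \<in> D (us ! i) (us ! nx i)" by (metis card.empty equals0I)
      then show ?thesis using D_A[OF Jlt[OF that(1)]] that(1) by (auto simp: D_def)
    qed
    have Jlr: "J \<subseteq> {l - 1, r}"
    proof
      fix i assume i: "i \<in> J"
      show "i \<in> {l - 1, r}"
      proof (rule ccontr)
        assume n: "i \<notin> {l - 1, r}"
        then have "l \<le> i" "i < r" using Jsub i by force+
        then have "i \<in> I" "nx i \<in> I" using Ieq nx(3)[of i] lr by auto
        then show False using other[OF i] notw[of i] notw[of "nx i"] by (auto simp: I_def)
      qed
    qed
    have right: "Suc r < m + 1 \<and> us ! Suc r \<in> Om - part x \<and> us ! nx r \<noteq> w \<and> us ! r \<noteq> w" if r: "r \<in> J"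
    proof -
      have rI: "us ! r \<in> part x" using lI by (simp add: I_def)
      then have rO: "us ! r \<in> Om" using Q_Om by blast
      have rm: "r \<noteq> m"
      proof
        assume "r = m"
        then have "us ! nx r = p'" using us0 by simp
        then show False using other[OF r] notw[OF lI(2)] rI p_Om w_p by auto
      qed
      then have n: "nx r = Suc r" "Suc r < m + 1" using nx(3)[of r] lr by auto
      then have "us ! Suc r \<in> Om" using last[of r "Suc r"] rO by simp
      then have "us ! Suc r \<noteq> w" using w_Om[of "Suc r"] n by auto
      then show ?thesis using other[OF r] notw[OF lI(2)] rI n by auto
    qed
    have exG: "\<exists>k. k \<in> G \<and> k \<in> part y" if "y \<in> Om" for y
      using that Om_part[OF that] by (auto simp: Om_def G_def)
    show ?thesis
    proof (cases "l - 1 \<in> J \<and> r \<in> J")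
      case True
      then have r: "r \<in> J" and l: "l - 1 \<in> J" by auto
      \<comment> \<open>Two pairs ask for two vertices: \<open>k\<close> in \<open>Om\<close>, from
        the split part behind the interval, serves the left pair and \<open>t\<close> outside
        \<open>Om\<close> the right one.\<close>
      let ?y = "us ! Suc r"
      have y: "Suc r < m + 1" "?y \<in> Om" "?y \<notin> part x" "us ! nx r \<noteq> w" "us ! r \<noteq> w" using right[OF r] by auto
      have yV: "?y \<in> V" using y(2) Om_sub by auto
      obtain k where k: "k \<in> G" "k \<in> part ?y" using exG[OF y(2)] by blast
      have pk: "part k = part ?y" using part_eq[OF yV k(2)] .
      have n: "nx (l - 1) = l" using nx(3)[of "l - 1"] lr lI by simp
      have "us ! l \<notin> part k"
        using part_eq[OF yV, of "us ! l"] plx pk y(3) part_self[OF yV] by auto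
      moreover have "us ! (l - 1) \<notin> part k"
      proof
        assume u: "us ! (l - 1) \<in> part k"
        then have e: "part (us ! (l - 1)) = part ?y" using part_eq[OF yV] pk by simp
        have "us ! (l - 1) \<in> Om" using Om_part[OF y(2)] u pk by simp
        then have "us ! r \<in> part ?y"
          using cont[of "l - 1" r "Suc r"] y(1) lI(3) e part_self[OF yV] by simp
        then show False using part_eq[OF yV, of "us ! r"] plx y(3) part_self[OF yV] by simp
      qed
      ultimately have "k \<in> A (l - 1)" using K_A[OF Jlt[OF l], of k] k(1) n by (auto simp: K_def)
      then have kU: "k \<in> ?U" "k \<in> Om" using l k(1) by (auto simp: G_def)
      obtain t where t: "t \<in> ?U" "t \<notin> Om" using Dne[OF r] y by blast
      have "card {k, t} \<le> card ?U" using kU t fU by (intro card_mono) auto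
      moreover have "k \<noteq> t" using kU t by auto
      moreover have "card J \<le> card {l - 1, r}" using Jlr by (intro card_mono) auto
      ultimately show ?thesis by (simp add: card_insert_if split: if_splits)
    next
      case False
      then obtain i where Ji: "J = {i}" using Jlr J(2) by blast
      have "?U \<noteq> {}"
      proof (cases "us ! i = w \<or> us ! nx i = w")
        case False
        then show ?thesis using Dne[of i] Ji by auto
      next
        case True
        have "i \<noteq> r" using right True Ji by auto
        then have i: "i = l - 1" using Jlr Ji by auto
        then have ni: "nx i = l" using nx(3)[of "l - 1"] lr lI by simp
        then have iw: "us ! i = w" using True notw[OF lI(1)] by simp
        have im: "i < m + 1" using Ji J by auto
        have wO: "w \<notin> Om" "i = 2" using w_Om[OF im iw] by auto
        then have l3: "l = 3" using i by simp
        \<comment> \<open>Otherwise \<open>Om\<close> would be a single part, although the positions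
          3 to \<open>m\<close> and \<open>K\<close> supply \<open>m - 2 + card K \<ge> m\<close>
          vertices of it.\<close>
        have "\<not> G \<subseteq> part x"
        proof
          assume Gx: "G \<subseteq> part x"
          have "Om \<subseteq> part x"
          proof
            fix y assume y: "y \<in> Om"
            then have yV: "y \<in> V" using Om_sub by auto
            obtain k where k: "k \<in> G" "k \<in> part y" using exG[OF y] by blast
            then have "part x = part y" using part_eq[OF xO(2), of k] part_eq[OF yV, of k] Gx by auto
            then show "y \<in> part x" using part_self[OF yV] by simp
          qed
          then have "card Om \<le> m - 1" using card_mono[OF fin_part, of Om x] small[OF xO(2)] by linarith
          moreover have "us ! 3 \<in> Om" using lI(1) l3 Q_Om by (auto simp: I_def)
          then have "us ! j \<in> Om" if "j \<in> {3..m}" for j using last[of 3 j] that by simp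
          then have "(!) us ` {3..m} \<union> K \<subseteq> Om" using K_Om(1) by blast
          then have "card ((!) us ` {3..m} \<union> K) \<le> card Om"
            using Om_sub fin finite_subset by (intro card_mono) auto
          moreover have "card ((!) us ` {3..m} \<union> K) = card ((!) us ` {3..m}) + card K"
          proof (rule card_Un_disjoint)
            have "us ! j \<notin> K" if "j \<in> {3..m}" for j using K_Om(4) us_in[of j] that by force
            then show "(!) us ` {3..m} \<inter> K = {}" by blast
          qed (use K_Om(2) in auto)
          moreover have "card ((!) us ` {3..m}) = card {3..m}"
            by (rule card_image) (auto simp: inj_on_def us_eq)
          ultimately show False using K_Om(3) G1 m3 by simp
        qed
        then obtain k where k: "k \<in> G" "k \<notin> part x" by blast
        have kO: "k \<in> Om" "k \<in> V" using k Om_sub by (auto simp: G_def)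
        have "us ! i \<notin> part k" using Om_part[OF kO(1)] iw wO by blast
        moreover have "us ! l \<notin> part k"
          using part_eq[OF kO(2), of "us ! l"] plx k(2) part_self[OF kO(2)] by auto
        ultimately have "k \<in> A i" using K_A[OF im, of k] k(1) ni by (auto simp: K_def)
        then show ?thesis using Ji by auto
      qed
      then have "1 \<le> card ?U" using fU by (simp add: Suc_le_eq card_gt_0_iff)
      then show ?thesis using Ji by simp
    qed
  qed
qed

text \<open>The rich pair 0 is untouched by split parts, and its candidates \<open>D\<close> and
  \<open>K\<close> number at least \<open>m + 2\<close>. Without it \<open>card J \<le> m\<close>;
  if \<open>K\<close> is covered, one pair avoiding \<open>w\<close> gives \<open>m\<close>
  candidates, and else \<open>J\<close> has at most the two pairs at \<open>w\<close>, for which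
  \<open>K\<close> suffices.\<close>

lemma Hall:
  assumes J: "J \<subseteq> {..<m + 1}" "J \<noteq> {}"
  shows "card J \<le> card (\<Union>(A ` J))"
proof -
  have fJ: "finite J" using J(1) finite_subset by blast
  have Jlt: "i < m + 1" if "i \<in> J" for i using J(1) that by auto
  have fU: "finite (\<Union>(A ` J))" using fJ finA by auto
  have cJ: "card J \<le> m + 1" using card_mono[OF _ J(1)] by simp
  show ?thesis
  proof (cases "0 \<in> J")
    case True
    have n0: "us ! nx 0 = p" using us0 m3 by simp
    have "K \<subseteq> A 0"
    proof
      fix x assume x: "x \<in> K"
      then have "x \<in> Om" using K_Om by blast
      then have "p \<notin> part x" "p' \<notin> part x" using Om_part p_Om by blast+
      then show "x \<in> A 0" using K_A[of 0 x] x n0 us0 by simp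
    qed
    then have "card (D (us ! 0) (us ! nx 0)) + card K \<le> card (\<Union>(A ` J))"
      using True by (intro card_U[OF _ True fJ]) auto
    then show ?thesis using card_D_p K_Om(3) n0 us0 cJ by simp
  next
    case False
    then have "J \<subseteq> {1..<m + 1}" using J(1) by (auto simp: Suc_le_eq intro: gr0I)
    then have cJ: "card J \<le> m" using card_mono[of "{1..<m + 1}" J] by simp
    show ?thesis
    proof (cases "K \<subseteq> (\<Union>(A ` J))")
      case KU: True
      show ?thesis
      proof (cases "\<exists>i\<in>J. us ! i \<noteq> w \<and> us ! nx i \<noteq> w")
        case True
        then obtain i where i: "i \<in> J" "us ! i \<noteq> w" "us ! nx i \<noteq> w" by blast
        have "card (D (us ! i) (us ! nx i)) + card K \<le> card (\<Union>(A ` J))"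
          using KU by (intro card_U[OF Jlt[OF i(1)] i(1) fJ]) auto
        then show ?thesis using card_D_slot[OF Jlt[OF i(1)] i(2,3)] K_Om(3) cJ by linarith
      next
        case False
        have "J \<subseteq> {1, 2}"
        proof
          fix i assume i: "i \<in> J"
          consider "us ! i = w" | "us ! nx i = w" using False i by blast
          then show "i \<in> {1, 2}"
          proof cases
            case 1
            then show ?thesis using w_Om[OF Jlt[OF i]] by simp
          next
            case 2
            then have "nx i = 2" using w_Om[OF nx(1)] by blast
            moreover have "i \<noteq> m" using calculation by auto
            ultimately show ?thesis using nx(3)[of i] Jlt[OF i] by simp
          qed
        qed
        then have "card J \<le> card {1::nat, 2}" by (intro card_mono) auto
        moreover have "card K \<le> card (\<Union>(A ` J))" using KU fU by (intro card_mono) auto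
        ultimately show ?thesis using K_Om(3) G1 by simp
      qed
    next
      case False
      then show ?thesis using Hall_uncovered[OF J] by blast
    qed
  qed
qed

lemma contra: False
proof -
  have d': "set us \<inter> insert d (set zs) = {}" using us by auto
  have m1: "2 \<le> m + 1" using m3 by simp
  have fX: "finite (insert d (set zs))" by simp
  obtain ys where "cyc blue ys" "set ys \<subseteq> set us \<union> insert d (set zs)" "length ys = 2 * (m + 1)"
    by (rule hall_cycle[OF us(1) len m1 fX d', of blue]) (use Hall in \<open>simp_all add: A_def\<close>)
  then show False using nom monoI(2)[of ys] us zV d by auto
qed

end

context twin_cycle_exc
begin

lemma small_split_contra:
  assumes a: "Om \<noteq> {}" "card G \<le> m - 2" shows False
proof -
  \<comment> \<open>A split \<open>w\<close> is itself taken as \<open>d\<close>, so that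
    \<open>w\<close> occurs in the order only if it is unsplit and can stand near the front.\<close>
  have ex: "\<exists>d. d \<in> Om \<and> d \<in> W \<and> (w \<in> Om \<longrightarrow> d = w)"
  proof (cases "w \<in> Om")
    case True
    then show ?thesis using w by blast
  next
    case False
    obtain x where "x \<in> Om" using a by blast
    moreover from this obtain q where "q \<in> part x" "q \<in> W" by (auto simp: Om_def)
    ultimately show ?thesis using False Om_part by blast
  qed
  then obtain d where d: "d \<in> Om" "d \<in> W" "w \<in> Om \<Longrightarrow> d = w" by blast
  have "finite (part ` V)" using fin by simp
  then obtain g :: "'a set \<Rightarrow> nat" where g: "inj_on g (part ` V)"
    using finite_imp_inj_to_nat_seg by meson
  define f where "f x = (if x \<in> Om then Suc (g (part x)) else 0)" for x
  have fin': "finite (W - {d} - Om - {p, p', w})" "finite ((W - {d}) \<inter> Om)" using fin by auto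
  obtain qs where qs: "set qs = W - {d} - Om - {p, p', w}" "distinct qs"
    using finite_distinct_list[OF fin'(1)] by blast
  obtain ss where ss: "set ss = (W - {d}) \<inter> Om" "distinct ss"
    using finite_distinct_list[OF fin'(2)] by blast
  define ws where "ws = (if w \<in> W - {d} then [w] else [])"
  \<comment> \<open>\<open>p'\<close> and \<open>p\<close> form the rich pair 0. The pairs
    containing \<open>w\<close> have no lower bound on \<open>D\<close>, so \<open>w\<close> comes
    next and spoils only the pairs 1 and 2. The key \<open>f\<close> moves split vertices to the end
    and keeps each split part together.\<close>
  define us where "us = p' # p # ws @ qs @ sort_key f ss"
  have pO: "p \<notin> Om" "p' \<notin> Om" using part_p_Om part_self p by blast+
  have ws: "x \<in> set ws \<Longrightarrow> x = w \<and> x \<in> W - {d} \<and> x \<notin> Om" for x using d(3) by (auto simp: ws_def split: if_splits)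
  have dws: "distinct ws" by (simp add: ws_def)
  have srt: "sorted (map f us)"
  proof -
    have f0: "f x = 0" if "x \<in> set (p' # p # ws @ qs)" for x
      using that pO ws qs(1) by (auto simp: f_def)
    then have "map f (p' # p # ws @ qs) = map (\<lambda>_. 0) (p' # p # ws @ qs)" by (intro map_cong) auto
    then have "sorted (map f (p' # p # ws @ qs))" by (simp only: map_replicate_const sorted_replicate)
    then have "sorted (map f ((p' # p # ws @ qs) @ sort_key f ss))"
      unfolding map_append sorted_append using f0 by auto
    then show ?thesis by (simp add: us_def)
  qed
  have dus: "distinct us"
    using dws qs ss ws pO p(3) w_p by (auto simp: us_def)
  have sus: "set us = W - {d}"
    using p_W pO d w_p qs(1) ss(1) by (auto simp: us_def ws_def)
  have len: "length us = m + 1"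
  proof -
    have "length us = card (W - {d})" using dus sus distinct_card by metis
    then show ?thesis using card_W d fin by simp
  qed
  have mono: "f (us ! i) \<le> f (us ! j)" if "i \<le> j" "j < m + 1" for i j
    using sorted_nth_mono[OF srt that(1)] that len by simp
  have last: "us ! j \<in> Om" if "i \<le> j" "j < m + 1" "us ! i \<in> Om" for i j
    using mono[OF that(1,2)] that(3) by (auto simp: f_def split: if_splits)
  have cont: "us ! j \<in> part (us ! i)"
    if h: "i \<le> j" "j \<le> k" "k < m + 1" "us ! i \<in> Om" "us ! k \<in> part (us ! i)" for i j k
  proof -
    have O: "us ! j \<in> Om" "us ! k \<in> Om" using last[of i j] last[of i k] h by auto
    have V: "us ! i \<in> V" "us ! j \<in> V" using O h Om_sub by auto
    have "part (us ! k) = part (us ! i)" using part_eq[OF V(1) h(5)] .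
    then have "g (part (us ! j)) = g (part (us ! i))"
      using mono[of i j] mono[of j k] h O by (auto simp: f_def)
    then have "part (us ! j) = part (us ! i)" using g V by (auto dest: inj_onD)
    then show ?thesis using part_self[OF V(2)] by simp
  qed
  obtain x where x: "x \<in> Om" using a(1) by blast
  then obtain z where "z \<in> part x" "z \<in> set zs" by (auto simp: Om_def)
  then have "G \<noteq> {}" using Om_part[OF x] by (auto simp: G_def)
  then have G1: "1 \<le> card G" using finG by (simp add: Suc_le_eq card_gt_0_iff)
  have u2: "us ! 2 = w" if "w \<in> W - {d}" using that by (simp add: us_def ws_def)
  interpret split_order V red blue zs m p p' w e d us
    by unfold_locales (use G1 a(2) d dus sus u2 cont last in \<open>auto simp: us_def\<close>)
  show False by (rule contra)
qed

lemma contra: False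
proof (cases "m - 1 \<le> card G")
  case False
  then have "card G \<le> m - 2" by linarith
  then show ?thesis using unsplit_contra small_split_contra by blast
qed (rule large_split_contra)

end

context twin_cycle
begin

lemma contra: False
proof -
  obtain w e where "w \<in> W" "w \<notin> part p"
    "\<And>u v. u \<in> W \<Longrightarrow> u \<noteq> w \<Longrightarrow> v \<in> S u \<Longrightarrow> nxt zs v \<in> S u \<Longrightarrow> v = e"
    by (rule exceptional) blast
  then interpret twin_cycle_exc V red blue zs m p p' w e by unfold_locales
  show False by (rule contra)
qed

end

section \<open>Monochromatic cycles in two-colorings by induction\<close>

context bicol
begin

text \<open>If a twin \<open>q\<close> of \<open>p\<close> were on the cycle, some \<open>y\<close>
  in \<open>Y\<close> and \<open>p'\<close> could be inserted behind \<open>q\<close>; so the cycle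
  avoids all of \<open>part p\<close>.\<close>

lemma twin_red_contra:
  assumes m3: "3 \<le> m" and cV: "card V = 3 * m + 2" and nom: "\<not> mono_cyc (2 * m + 2)"
    and small: "\<And>x. x \<in> V \<Longrightarrow> card (part x) \<le> m - 1"
    and p: "p \<in> V" "p' \<in> part p" "p \<noteq> p'"
    and Y: "Y \<subseteq> V" "\<And>y. y \<in> Y \<Longrightarrow> red p y" "\<And>x. x \<in> V \<Longrightarrow> red p x \<Longrightarrow> Y \<noteq> {}"
    and zs: "cyc red zs" "set zs \<subseteq> V" "length zs = 2 * m" "p' \<notin> set zs" "Y \<inter> set zs = {}"
  shows False
proof -
  have no2: False if "cyc red ys" "set ys \<subseteq> V" "length ys = length zs + 2" for ys
    using monoI(1)[OF that(1,2)] that(3) zs(3) nom by simp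
  have PZ: "part p \<inter> set zs = {}"
  proof (rule ccontr)
    assume "\<not> ?thesis"
    then obtain q where q: "q \<in> part p" "q \<in> set zs" by blast
    have n: "red q (nxt zs q)" "nxt zs q \<in> V"
      using cyc_nxt[OF zs(1) q(2)] bij_nxt[OF cycD(1)[OF zs(1)]] q(2) zs(2) by (auto simp: bij_betw_def)
    then have "red p (nxt zs q)" "red p' (nxt zs q)"
      using part_twin(1)[OF p(1) q(1)] part_twin(1)[OF p(1,2)] by blast+
    then obtain y where y: "y \<in> Y" using Y(3) n(2) by blast
    have yp: "red q y" "red y p'"
      using part_twin(1)[OF p(1) q(1), of y] part_twin(1)[OF p(1,2), of y] Y y symr by blast+
    have ne: "y \<notin> set zs" "y \<noteq> p'" using y zs(5) yp irr by auto
    obtain ys where ys: "cyc red ys" "set ys = insert y (insert p' (set zs))" "length ys = length zs + 2"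
      by (rule cyc_insert_edge[OF zs(1) q(2) ne(1) zs(4) ne(2) yp \<open>red p' (nxt zs q)\<close>])
    have "p' \<in> V" using p part_sub by blast
    then show False using no2[of ys] ys y Y(1) zs(2) by auto
  qed
  interpret redcycle V red blue zs by unfold_locales (fact zs no2)+
  have "S p = {} \<or> (\<exists>y\<in>V - set zs. red p y)"
  proof (cases "S p = {}")
    case False
    then obtain x where "x \<in> V" "red p x" using zs(2) by (auto simp: S_def)
    then obtain y where "y \<in> Y" using Y(3) by blast
    then show ?thesis using Y(1,2) zs(5) by blast
  qed simp
  then interpret twin_cycle V red blue zs m p p'
    by unfold_locales (use m3 cV nom small p PZ zs in auto)
  show False by (rule contra)
qed

lemma bicol_subset: "V' \<subseteq> V \<Longrightarrow> bicol V' red blue"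
proof -
  assume V': "V' \<subseteq> V"
  show "bicol V' red blue"
  proof unfold_locales
    show "finite V'" using V' fin by (rule finite_subset)
    show "red x z = red y z \<and> blue x z = blue y z"
      if "x \<in> V'" "y \<in> V'" "\<not> red x y" "\<not> blue x y" "z \<in> V'" for x y z
      using twin that V' by blast
  qed (fact symr symb irr disj)+
qed

lemma key_step:
  assumes m2: "2 \<le> m" and cV: "card V = 3 * m + 2" and small: "\<And>x. x \<in> V \<Longrightarrow> card (part x) \<le> m"
    and IH: "\<And>V'. 3 \<le> m \<Longrightarrow> V' \<subseteq> V \<Longrightarrow> 3 * m - 1 \<le> card V' \<Longrightarrow> (\<And>x. x \<in> V' \<Longrightarrow> card (part x \<inter> V') \<le> m - 1) \<Longrightarrow>
      \<exists>xs. set xs \<subseteq> V' \<and> length xs = 2 * m \<and> (cyc red xs \<or> cyc blue xs)"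
  shows "mono_cyc (2 * m + 2)"
proof (cases "\<exists>p\<in>V. card (part p) = m")
  case True
  then show ?thesis using big_part[OF cV m2 _ _ small] by blast
next
  case False
  then have small': "card (part x) \<le> m - 1" if "x \<in> V" for x using small[OF that] that by force
  show ?thesis
  proof (cases "\<exists>p\<in>V. \<exists>p'\<in>part p. p \<noteq> p'")
    case False
    have pure: "red x y \<or> blue x y" if "x \<in> V" "y \<in> V" "x \<noteq> y" for x y
      using cases_part[OF that(1,2)] False that by blast
    have "mono_cyc (2 * m)"
    proof (cases "m = 2")
      case True
      \<comment> \<open>The base of the induction.\<close>
      then show ?thesis using mono4[OF pure] cV by auto
    next
      case False
      then have m3: "3 \<le> m" using m2 by simp
      have "card (part x \<inter> V) \<le> m - 1" if "x \<in> V" for x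
        using small'[OF that] part_sub by (simp add: Int_absorb2)
      then show ?thesis using IH[OF m3, of V] cV unfolding mono_cyc_def by auto
    qed
    then show ?thesis using pure_step[OF pure cV m2] by blast
  next
    case True
    then obtain p p' where p: "p \<in> V" "p' \<in> part p" "p \<noteq> p'" by blast
    have p'V: "p' \<in> V" using p part_sub by blast
    have "card {p, p'} \<le> card (part p)" using p part_self fin_part by (intro card_mono) auto
    then have m3: "3 \<le> m" using small'[OF p(1)] p(3) by simp
    have ex: "\<exists>Y. Y \<subseteq> V \<and> card Y \<le> 1 \<and> (\<forall>y\<in>Y. E p y) \<and> ((\<exists>x\<in>V. E p x) \<longrightarrow> Y \<noteq> {})" for E :: "'a \<Rightarrow> 'a \<Rightarrow> bool"
    proof (cases "\<exists>x\<in>V. E p x")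
      case True
      then obtain x where "x \<in> V" "E p x" by blast
      then show ?thesis by (intro exI[of _ "{x}"]) auto
    next
      case False
      then show ?thesis by (intro exI[of _ "{}"]) auto
    qed
    obtain Y where Y: "Y \<subseteq> V" "card Y \<le> 1" "\<forall>y\<in>Y. red p y" "(\<exists>x\<in>V. red p x) \<longrightarrow> Y \<noteq> {}" using ex by blast
    obtain Y' where Y': "Y' \<subseteq> V" "card Y' \<le> 1" "\<forall>y\<in>Y'. blue p y" "(\<exists>x\<in>V. blue p x) \<longrightarrow> Y' \<noteq> {}" using ex by blast
    \<comment> \<open>The color of the cycle to come is not yet known, so a neighbour of
      \<open>p\<close> is set aside in each color. At least
      \<open>3 * m - 1 = 3 * (m - 1) + 2\<close> vertices remain.\<close>
    let ?V = "V - ({p'} \<union> (Y \<union> Y'))"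
    have fY: "finite ({p'} \<union> (Y \<union> Y'))" using Y(1) Y'(1) fin finite_subset by auto
    have "card ({p'} \<union> (Y \<union> Y')) \<le> 3"
      using card_Un_le[of "{p'}" "Y \<union> Y'"] card_Un_le[of Y Y'] Y(2) Y'(2) by simp
    then have "3 * m - 1 \<le> card ?V" using diff_card_le_card_Diff[OF fY, of V] cV by linarith
    moreover have "card (part x \<inter> ?V) \<le> m - 1" if "x \<in> ?V" for x
      using card_mono[OF fin_part, of "part x \<inter> ?V" x] small'[of x] that by auto
    ultimately obtain zs where zs: "set zs \<subseteq> ?V" "length zs = 2 * m" "cyc red zs \<or> cyc blue zs"
      using IH[OF m3 Diff_subset] by blast
    interpret S: bicol V blue red by (rule swap)
    have zs': "set zs \<subseteq> V" "p' \<notin> set zs" "Y \<inter> set zs = {}" "Y' \<inter> set zs = {}" using zs(1) by auto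
    show ?thesis
    proof (rule ccontr)
      assume no: "\<not> ?thesis"
      show False using zs(3)
      proof
        assume c: "cyc red zs"
        show False
          by (rule twin_red_contra[of m p p' Y zs]) (use m3 cV no small' p Y zs zs' c in auto)
      next
        assume c: "cyc blue zs"
        show False
          by (rule S.twin_red_contra[of m p p' Y' zs])
            (use m3 cV no small' p Y' zs zs' c in \<open>auto simp: swap_part swap_mono\<close>)
      qed
    qed
  qed
qed

end

lemma bicol_part_subset:
  assumes "bicol V red blue" "V' \<subseteq> V"
  shows "bicol.part V' red blue x = bicol.part V red blue x \<inter> V'"
  using bicol.part_def[OF assms(1)] bicol.part_def[OF bicol.bicol_subset[OF assms]] assms(2) by auto

theorem bicol_mono_cyc:
  assumes "2 \<le> m" "bicol V red blue" "3 * m + 2 \<le> card V" "\<And>x. x \<in> V \<Longrightarrow> card (bicol.part V red blue x) \<le> m"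
  shows "\<exists>xs. set xs \<subseteq> V \<and> length xs = 2 * m + 2 \<and> (cyc red xs \<or> cyc blue xs)"
  using assms
proof (induction m arbitrary: V rule: less_induct)
  case (less m)
  obtain V0 where V0: "V0 \<subseteq> V" "card V0 = 3 * m + 2" using less.prems(3) by (rule obtain_subset_with_card_n)
  interpret B: bicol V red blue by (rule less.prems)
  interpret B0: bicol V0 red blue by (rule B.bicol_subset[OF V0(1)])
  have "B0.mono_cyc (2 * m + 2)"
  proof (rule B0.key_step[OF less.prems(1) V0(2)])
    show "card (B0.part x) \<le> m" if "x \<in> V0" for x
    proof -
      have "card (B0.part x) \<le> card (B.part x)"
        unfolding bicol_part_subset[OF B.bicol_axioms V0(1)] by (intro card_mono B.fin_part) auto
      then show ?thesis using less.prems(4)[of x] V0(1) that by fastforce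
    qed
    fix V' assume V': "3 \<le> m" "V' \<subseteq> V0" "3 * m - 1 \<le> card V'" "\<And>x. x \<in> V' \<Longrightarrow> card (B0.part x \<inter> V') \<le> m - 1"
    have "\<exists>xs. set xs \<subseteq> V' \<and> length xs = 2 * (m - 1) + 2 \<and> (cyc red xs \<or> cyc blue xs)"
      using V' B0.bicol_subset[OF V'(2)] bicol_part_subset[OF B0.bicol_axioms V'(2)]
      by (intro less.IH) auto
    moreover have "2 * (m - 1) + 2 = 2 * m" using V'(1) by simp
    ultimately show "\<exists>xs. set xs \<subseteq> V' \<and> length xs = 2 * m \<and> (cyc red xs \<or> cyc blue xs)" by metis
  qed
  then show ?case using V0(1) unfolding B0.mono_cyc_def by blast
qed

section \<open>Chords of a monochromatic cycle\<close>

lemma Theta_copy: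
  assumes m: "4 \<le> m" and ys: "cyc (\<lambda>x y. c {x, y} = j) ys" "length ys = m" "set ys \<subseteq> {..<N}"
    and ab: "a < m" "b < m" "a \<noteq> b" "{a, b} \<notin> edges (cycle_graph m)" "c {ys ! a, ys ! b} = j"
  shows "\<exists>H\<in>Theta m. has_mono_copy (complete_graph N) c H"
proof
  let ?H = "(verts (cycle_graph m), insert {a, b} (edges (cycle_graph m)))"
  let ?f = "\<lambda>e. (!) ys ` e"
  let ?S = "(set ys, ?f ` edges ?H)"
  show H: "?H \<in> Theta m" using ab by (auto simp: Theta_def cycle_graph_def)
  have bij: "bij_betw ((!) ys) {..<m} (set ys)"
    using cycD(1)[OF ys(1)] ys(2) by (intro bij_betw_nth) auto
  have "?f ` [{..<m}]\<^bsup>2\<^esup> = [set ys]\<^bsup>2\<^esup>" using bij_betw_nsets[OF bij, of 2] by (auto simp: bij_betw_def)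
  then have sub: "?f ` edges ?H \<subseteq> [set ys]\<^bsup>2\<^esup>" using Theta_wf(2)[OF m H] by blast
  have "[set ys]\<^bsup>2\<^esup> \<subseteq> [{..<N}]\<^bsup>2\<^esup>" using ys(3) by (rule nsets_mono)
  then have "subgraph ?S (complete_graph N)"
    unfolding subgraph_def complete_graph_def fst_conv snd_conv using sub[unfolded snd_conv] ys(3) by blast
  moreover have "isomorphic ?H ?S"
    unfolding isomorphic_def fst_conv using bij by (intro exI[of _ "(!) ys"]) (simp add: cycle_graph_def)
  moreover have "c e = j" if "e \<in> edges ?S" for e
  proof -
    have "e = {ys ! a, ys ! b} \<or> (\<exists>i<m. e = {ys ! i, ys ! (Suc i mod m)})"
      using that by (auto simp: cycle_graph_def)
    then show ?thesis using ab(5) ys(1,2) unfolding cyc_conv_nth by blast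
  qed
  ultimately show "has_mono_copy (complete_graph N) c ?H" unfolding has_mono_copy_def by blast
qed

lemma not_cycle_edge:
  assumes "a + 2 \<le> b" "b < m" "a = 0 \<Longrightarrow> b + 1 < m"
  shows "{a, b} \<notin> edges (cycle_graph m)"
proof
  assume "{a, b} \<in> edges (cycle_graph m)"
  then obtain i where i: "{a, b} = {i, (i + 1) mod m}" "i < m" by (auto simp: cycle_graph_def)
  then consider "i = a" "(a + 1) mod m = b" | "i = b" "(b + 1) mod m = a" by (metis doubleton_eq_iff)
  then show False
  proof cases
    case 1
    then show False using assms by simp
  next
    case 2
    then show False using assms by (cases "b + 1 = m") auto
  qed
qed

text \<open>The complement of a cycle on \<open>2 n \<ge> 6\<close> vertices is connected through triangles with one
  edge on the cycle, so in a Gallai coloring all chords have the same color, unless one has the color of the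
  cycle. The vertices in the order \<open>0, 2, \<dots>, 2 n - 2, 1, 2 n - 1, 2 n - 3, \<dots>, 3\<close> then form a
  cycle with chord \<open>{0, 4}\<close> in that color.\<close>

lemma Theta_if_mono_cycle:
  fixes c :: "nat set \<Rightarrow> nat"
  assumes n: "3 \<le> n" and xs: "cyc (\<lambda>x y. c {x, y} = i) xs" "length xs = 2 * n" "set xs \<subseteq> {..<N}"
    and nr: "\<And>x y z. x < N \<Longrightarrow> y < N \<Longrightarrow> z < N \<Longrightarrow> x \<noteq> y \<Longrightarrow> y \<noteq> z \<Longrightarrow> x \<noteq> z \<Longrightarrow>
      c {x, y} = c {y, z} \<or> c {y, z} = c {x, z} \<or> c {x, y} = c {x, z}"
  shows "\<exists>H\<in>Theta (2 * n). has_mono_copy (complete_graph N) c H"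
proof (rule ccontr)
  assume no: "\<not> ?thesis"
  let ?m = "2 * n"
  define C where "C a b = c {xs ! a, xs ! b}" for a b
  have C_sym: "C a b = C b a" for a b by (simp add: C_def insert_commute)
  have m4: "4 \<le> ?m" using n by simp
  have C_edge: "C a (Suc a) = i" if "Suc a < ?m" for a
    using xs(1,2) that unfolding cyc_conv_nth C_def by (metis Suc_lessD mod_less)
  have ne: "xs ! a \<noteq> xs ! b" "xs ! a < N" if "a < ?m" "b < ?m" "a \<noteq> b" for a b
  proof -
    show "xs ! a \<noteq> xs ! b" using cycD(1)[OF xs(1)] xs(2) that by (simp add: nth_eq_iff_index_eq)
    have "xs ! a \<in> set xs" using xs(2) that by simp
    then show "xs ! a < N" using xs(3) by auto
  qed
  have tri: "C a b = C b d \<or> C b d = C a d \<or> C a b = C a d"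
    if "a < ?m" "b < ?m" "d < ?m" "a \<noteq> b" "b \<noteq> d" "a \<noteq> d" for a b d
    using nr[of "xs ! a" "xs ! b" "xs ! d"] ne that unfolding C_def by blast
  have chord: "C a b \<noteq> i" if "a + 2 \<le> b" "b < ?m" "a = 0 \<Longrightarrow> b + 1 < ?m" for a b
    using Theta_copy[OF m4 xs, of a b] not_cycle_edge[OF that] no that unfolding C_def by auto
  \<comment> \<open>In the triangle \<open>a\<close>, \<open>b\<close>, \<open>b + 1\<close> only
    the edge of the cycle has color \<open>i\<close>, so the two chords agree.\<close>
  have s1: "C a b = C a (b + 1)" if "a + 2 \<le> b" "b + 1 < ?m" "a = 0 \<Longrightarrow> b + 2 < ?m" for a b
    using tri[of a b "b + 1"] chord[of a b] chord[of a "b + 1"] C_edge[of b] that by simp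
  have s2: "C a b = C (a + 1) b" if "a + 3 \<le> b" "b < ?m" "a = 0 \<Longrightarrow> b + 1 < ?m" for a b
    using tri[of a "a + 1" b] chord[of a b] chord[of "a + 1" b] C_edge[of a] that by simp
  have z: "C 0 b = C 0 2" if "2 \<le> b" "b + 1 < ?m" for b
    using that
  proof (induction b rule: dec_induct)
    case (step b)
    then show ?case using s1[of 0 b] by simp
  qed simp
  have in_range: "C a b = C 0 2" if "a + 2 \<le> b" "b + 1 < ?m" for a b
    using that
  proof (induction a)
    case (Suc a)
    then show ?case using s2[of a b] by simp
  qed (use z[of b] in simp)
  have at_end: "C a (?m - 1) = C 0 2" if "1 \<le> a" "a + 3 < ?m" for a
    using s1[of a "?m - 2"] in_range[of a "?m - 2"] that by (simp add: Suc_diff_Suc numeral_2_eq_2)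
  have all: "C a b = C 0 2" if "a + 2 \<le> b" "b < ?m" "a = 0 \<Longrightarrow> b + 1 < ?m" for a b
  proof (cases "b + 1 < ?m")
    case True
    then show ?thesis by (rule in_range[OF that(1)])
  next
    case False
    then have b: "b = ?m - 1" using that(2) by simp
    show ?thesis
    proof (cases "a + 3 < ?m")
      case True
      then show ?thesis using at_end[of a] that(3) b False by (cases "a = 0") auto
    next
      case False
      \<comment> \<open>For this chord from \<open>2 * n - 3\<close> to \<open>2 * n - 1\<close> the
        upper end cannot be moved, since \<open>2 * n - 3\<close> and \<open>2 * n - 2\<close> are
        adjacent on the cycle; the lower end is moved instead.\<close>
      then have a: "a = ?m - 4 + 1" using that(1) b n by arith
      have "C (?m - 4) b = C a b" unfolding a using b n by (intro s2) auto
      then show ?thesis using at_end[of "?m - 4"] b n by simp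
    qed
  qed
  define ev where "ev = map (\<lambda>k. 2 * k) [0..<n]"
  define od where "od = map (\<lambda>k. 2 * n - 1 - 2 * k) [0..<n - 1]"
  let ?ks = "ev @ [1] @ od"
  let ?ys = "map ((!) xs) ?ks"
  have len: "length ?ks = ?m" using n by (simp add: ev_def od_def)
  have ne': "ev \<noteq> []" "od \<noteq> []" using n by (auto simp: ev_def od_def)
  have range: "k < ?m" if "k \<in> set ?ks" for k using that n by (auto simp: ev_def od_def)
  have dist: "distinct ?ks"
  proof -
    have "distinct ev" by (simp add: ev_def distinct_map inj_on_def)
    have "distinct od" unfolding od_def distinct_map by (auto simp: inj_on_def)
    have e: "even k" if "k \<in> set ev" for k using that by (auto simp: ev_def)
    have o: "odd k \<and> 1 < k" if "k \<in> set od" for k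
    proof -
      obtain l where l: "k = 2 * n - 1 - 2 * l" "l < n - 1" using \<open>k \<in> set od\<close> by (auto simp: od_def)
      then have "k = 2 * (n - 1 - l) + 1" by simp
      then show ?thesis using l(2) by simp
    qed
    have "1 \<notin> set ev" using e[of 1] by auto
    moreover have "1 \<notin> set od" using o[of 1] by auto
    moreover have "set ev \<inter> set od = {}" using e o by blast
    ultimately show ?thesis using \<open>distinct ev\<close> \<open>distinct od\<close> by simp
  qed
  have inj: "inj_on ((!) xs) (set ?ks)"
    using ne range unfolding inj_on_def by blast
  have hl: "hd ev = 0" "last ev = 2 * n - 2" "hd od = 2 * n - 1" "last od = 3"
    using n by (auto simp: ev_def od_def hd_map last_map)
  have suc: "successively (\<lambda>a b. C a b = C 0 2) ?ks"
  proof -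
    have "C (2 * k) (2 * Suc k) = C 0 2" if "Suc k < n" for k
      using that by (intro all) auto
    then have 1: "successively (\<lambda>a b. C a b = C 0 2) ev" by (auto simp: ev_def successively_conv_nth)
    have "C (2 * n - 1 - 2 * k) (2 * n - 1 - 2 * Suc k) = C 0 2" if "Suc k < n - 1" for k
      using that by (subst C_sym, intro all) auto
    then have 2: "successively (\<lambda>a b. C a b = C 0 2) od" by (auto simp: od_def successively_conv_nth)
    have "C (2 * n - 2) 1 = C 0 2" using n by (subst C_sym, intro all) auto
    moreover have "C 1 (2 * n - 1) = C 0 2" using n by (intro all) auto
    ultimately show ?thesis
      using 1 2 hl ne' by (simp add: successively_append_iff successively_Cons)
  qed
  have "cyc (\<lambda>x y. c {x, y} = C 0 2) ?ys"
  proof (rule cycI)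
    show "distinct ?ys" using dist inj by (simp only: distinct_map)
    show "successively (\<lambda>x y. c {x, y} = C 0 2) ?ys"
      using suc by (simp only: successively_map C_def)
    have "C 3 0 = C 0 2" using n by (subst C_sym, intro all) auto
    moreover have "last ?ys = xs ! 3" "hd ?ys = xs ! 0" using ne' hl by (simp_all add: last_map hd_map hd_append)
    ultimately show "c {last ?ys, hd ?ys} = C 0 2" by (simp add: C_def)
  qed (use len n in simp)
  moreover have "xs ! l < N" if "l \<in> set ?ks" for l
  proof -
    have "xs ! l \<in> set xs" using range[OF that] xs(2) by simp
    then show ?thesis using xs(3) by auto
  qed
  then have "set ?ys \<subseteq> {..<N}" by auto
  moreover have "?ys ! 0 = xs ! 0" "?ys ! 2 = xs ! 4" using n by (simp_all add: nth_append ev_def)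
  then have "c {?ys ! 0, ?ys ! 2} = C 0 2" using z[of 4] n by (simp add: C_def)
  moreover have "{0, 2} \<notin> edges (cycle_graph ?m)" using n by (intro not_cycle_edge) auto
  ultimately show False using Theta_copy[OF m4, of c "C 0 2" ?ys N 0 2] len no n by (simp only: length_map) auto
qed

section \<open>Reduction of Gallai colorings to two colors\<close>

locale rainbow_free =
  fixes V :: "'a set" and col :: "'a \<Rightarrow> 'a \<Rightarrow> nat" and k :: nat
  assumes finV: "finite V" and col_sym: "col x y = col y x"
    and col_k: "x \<in> V \<Longrightarrow> y \<in> V \<Longrightarrow> x \<noteq> y \<Longrightarrow> col x y \<in> {1..k}" and k2: "2 \<le> k"
    and nr: "x \<in> V \<Longrightarrow> y \<in> V \<Longrightarrow> z \<in> V \<Longrightarrow> x \<noteq> y \<Longrightarrow> y \<noteq> z \<Longrightarrow> x \<noteq> z \<Longrightarrow>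
      col x y = col y z \<or> col y z = col x z \<or> col x y = col x z"
begin

text \<open>The connected component of \<open>x\<close> in the graph on \<open>U\<close> formed by
  the colors outside \<open>P\<close>. For two colors \<open>P\<close> the components contain the
  parts of the reduced coloring.\<close>

definition comp :: "'a set \<Rightarrow> nat set \<Rightarrow> 'a \<Rightarrow> 'a set" where
  "comp U P x = {y. (x, y) \<in> {(u, v). u \<in> U \<and> v \<in> U \<and> u \<noteq> v \<and> col u v \<notin> P}\<^sup>*}"

lemma comp_self: "x \<in> comp U P x" by (simp add: comp_def)

lemma comp_step: "y \<in> comp U P x \<Longrightarrow> y \<in> U \<Longrightarrow> z \<in> U \<Longrightarrow> y \<noteq> z \<Longrightarrow> col y z \<notin> P \<Longrightarrow> z \<in> comp U P x"
  unfolding comp_def mem_Collect_eq by (erule rtrancl_into_rtrancl) auto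

lemma comp_sym: "y \<in> comp U P x \<Longrightarrow> x \<in> comp U P y"
proof -
  have "sym {(u, v). u \<in> U \<and> v \<in> U \<and> u \<noteq> v \<and> col u v \<notin> P}" using col_sym by (auto intro: symI)
  then show "y \<in> comp U P x \<Longrightarrow> x \<in> comp U P y"
    unfolding comp_def mem_Collect_eq by (rule symD[OF sym_rtrancl])
qed

lemma comp_trans: "y \<in> comp U P x \<Longrightarrow> z \<in> comp U P y \<Longrightarrow> z \<in> comp U P x"
  unfolding comp_def mem_Collect_eq by (rule rtrancl_trans)

lemma comp_closed:
  assumes "x \<in> A" "\<And>u v. u \<in> A \<Longrightarrow> v \<in> U - A \<Longrightarrow> u \<noteq> v \<Longrightarrow> col u v \<in> P"
  shows "comp U P x \<subseteq> A"
proof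
  fix y assume "y \<in> comp U P x"
  then have "(x, y) \<in> {(u, v). u \<in> U \<and> v \<in> U \<and> u \<noteq> v \<and> col u v \<notin> P}\<^sup>*" by (simp add: comp_def)
  then show "y \<in> A"
    by (induction rule: rtrancl_induct) (use assms in auto)
qed

lemma comp_sub: "x \<in> U \<Longrightarrow> comp U P x \<subseteq> U" by (rule comp_closed) auto

lemma comp_out:
  assumes "x \<in> U" "z \<in> U" "z \<notin> comp U P x" "y \<in> comp U P x"
  shows "col y z \<in> P" "col z y \<in> P"
proof -
  show "col y z \<in> P" using comp_step[OF assms(4), of z] comp_sub[OF assms(1)] assms by blast
  then show "col z y \<in> P" by (simp add: col_sym)
qed

text \<open>A step \<open>u\<close>, \<open>v\<close> inside the component has a color outside
  \<open>P\<close>, while both edges to \<open>z\<close> have colors in \<open>P\<close>. As the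
  triangle is not rainbow, these two colors are equal.\<close>

lemma comp_hom:
  assumes U: "U \<subseteq> V" and x: "x \<in> U" "z \<in> U" "z \<notin> comp U P x" and y: "y \<in> comp U P x"
  shows "col z y = col z x"
proof -
  have "(x, y) \<in> {(u, v). u \<in> U \<and> v \<in> U \<and> u \<noteq> v \<and> col u v \<notin> P}\<^sup>*" using y by (simp add: comp_def)
  then show ?thesis
  proof (induction rule: rtrancl_induct)
    case (step u v)
    then have c: "u \<in> comp U P x" "u \<in> U" "v \<in> U" "u \<noteq> v" "col u v \<notin> P" by (auto simp: comp_def)
    then have "v \<in> comp U P x" using comp_step by blast
    then have "col z u \<in> P" "col z v \<in> P" "z \<noteq> u" "z \<noteq> v" using comp_out(2)[OF x] c(1) x(3) by auto
    then have "col z u = col z v" using nr[of z u v] c U x(2) by force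
    then show ?case using step.IH by simp
  qed simp
qed

text \<open>Gallai's theorem: the vertex removed in the induction is either isolated in the graph of the
  remaining colors, up to exchanging one of the two colors, or misses one of the components.\<close>

lemma Gallai_cut:
  assumes "U \<subseteq> V" "2 \<le> card U"
  obtains r b A where "r \<in> {1..k}" "b \<in> {1..k}" "r \<noteq> b" "A \<noteq> {}" "A \<subset> U"
    "\<And>x y. x \<in> A \<Longrightarrow> y \<in> U - A \<Longrightarrow> col x y \<in> {r, b}"
proof -
  have other: "\<exists>b\<in>{1..k}. b \<noteq> r" for r
    using k2 by (cases "r = 1") (auto intro: bexI[of _ 1] bexI[of _ 2])
  let ?Q = "\<lambda>U. \<exists>r\<in>{1..k}. \<exists>b\<in>{1..k}. \<exists>A. r \<noteq> b \<and> A \<noteq> {} \<and> A \<subset> U \<and> (\<forall>x\<in>A. \<forall>y\<in>U - A. col x y \<in> {r, b})"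
  have pair: "?Q U" if "card U = 2" "U \<subseteq> V" for U
  proof -
    obtain u v where U: "U = {u, v}" "u \<noteq> v" using \<open>card U = 2\<close> by (metis card_2_iff)
    then have r: "col u v \<in> {1..k}" using that(2) col_k by auto
    obtain b where b: "b \<in> {1..k}" "b \<noteq> col u v" using other by blast
    have "\<forall>x\<in>{u}. \<forall>y\<in>U - {u}. col x y \<in> {col u v, b}" "{u} \<subset> U" using U by auto
    then show ?thesis using r b by (metis insert_not_empty)
  qed
  have extend: "?Q U" if "U \<subseteq> V" "v \<in> U" "?Q (U - {v})" for U v
  proof -
    note v = that(2) and Q = that(3)
    let ?U = "U - {v}"
    have UV: "?U \<subseteq> V" "v \<in> V" using that by auto
    obtain r b A where rb: "r \<in> {1..k}" "b \<in> {1..k}" "r \<noteq> b" and A: "A \<noteq> {}" "A \<subset> ?U"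
      "\<forall>x\<in>A. \<forall>y\<in>?U - A. col x y \<in> {r, b}" using Q by blast
    let ?C = "comp ?U {r, b}"
    note self = comp_self[of _ ?U "{r, b}"]
    have two: "\<exists>z\<in>?U. z \<notin> ?C x" if x: "x \<in> ?U" for x
    proof (cases "x \<in> A")
      case True
      then have "?C x \<subseteq> A" using A(3) by (intro comp_closed) auto
      then show ?thesis using A(2) by blast
    next
      case False
      have "?C x \<subseteq> ?U - A"
      proof (rule comp_closed)
        show "col y z \<in> {r, b}" if "y \<in> ?U - A" "z \<in> ?U - (?U - A)" for y z
          using A(3) that col_sym[of y z] by auto
      qed (use x False in simp)
      then show ?thesis using A(1,2) by blast
    qed
    show ?thesis
    proof (cases "\<exists>x\<in>?U. \<forall>y\<in>?C x. col v y \<in> {r, b}")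
      case True
      then obtain x where x: "x \<in> ?U" "\<And>y. y \<in> ?C x \<Longrightarrow> col v y \<in> {r, b}" by blast
      have "?C x \<subset> U" using comp_sub[OF x(1)] v by blast
      have "col u y \<in> {r, b}" if "u \<in> ?C x" "y \<in> U - ?C x" for u y
        using comp_out(1)[OF x(1), of y "{r, b}" u] x(2)[OF that(1)] that col_sym[of v u] by (cases "y = v") auto
      then have "\<forall>u\<in>?C x. \<forall>y\<in>U - ?C x. col u y \<in> {r, b}" by blast
      moreover have "?C x \<noteq> {}" using self[of x] by blast
      ultimately show ?thesis using rb \<open>?C x \<subset> U\<close>
        by (intro bexI[of _ r] bexI[of _ b] exI[of _ "?C x"] conjI)
    next
      case False
      then have meets: "\<exists>y\<in>?C x. col v y \<notin> {r, b}" if "x \<in> ?U" for x using that by blast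
      have tri: "col v x = col v y \<or> col x y = col v x \<or> col x y = col v y" if "x \<in> ?U" "y \<in> ?U" "x \<noteq> y" for x y
      proof -
        have "x \<in> V" "y \<in> V" "v \<noteq> x" "v \<noteq> y" using that UV by blast+
        then show ?thesis using nr[of v x y] that(3) UV(2) by auto
      qed
      have sep: "col v x = col v y" if "x \<in> ?U" "y \<in> ?U" "y \<notin> ?C x" "col v x \<notin> {r, b}" "col v y \<notin> {r, b}" for x y
      proof -
        have "x \<noteq> y" using that(3) self by auto
        moreover have "col x y \<in> {r, b}" using comp_out(1)[OF that(1-3)] self by blast
        ultimately show ?thesis using tri[of x y] that by metis
      qed
      have "?U \<noteq> {}" using A by blast
      then obtain x0 where x0: "x0 \<in> ?U" by blast
      obtain u0 where u0': "u0 \<in> ?C x0" "col v u0 \<notin> {r, b}" using meets[OF x0] by blast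
      then have u0: "u0 \<in> ?U" "col v u0 \<notin> {r, b}" using comp_sub[OF x0] by blast+
      define g where "g = col v u0"
      \<comment> \<open>Vertices in different components are compared by \<open>sep\<close>. For
        \<open>x\<close> in the component of \<open>u0\<close>, a vertex of another component serves
        as intermediary.\<close>
      have g: "col v x = g" if x: "x \<in> ?U" "col v x \<notin> {r, b}" for x
      proof (cases "x \<in> ?C u0")
        case False
        then show ?thesis using sep[OF u0(1) x(1) False u0(2) x(2)] g_def by simp
      next
        case True
        obtain z where z: "z \<in> ?U" "z \<notin> ?C u0" using two u0 by blast
        obtain y where y: "y \<in> ?C z" "col v y \<notin> {r, b}" using meets[OF z(1)] by blast
        have yU: "y \<in> ?U" using y comp_sub[OF z(1)] by blast
        have "y \<notin> ?C u0" using y(1) z(2) comp_sym comp_trans by blast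
        moreover from this have "y \<notin> ?C x" using True comp_trans by blast
        ultimately have "col v u0 = col v y" "col v x = col v y"
          using sep[OF u0(1) yU _ u0(2) y(2)] sep[OF x(1) yU _ x(2) y(2)] by blast+
        then show ?thesis by (simp add: g_def)
      qed
      have g_rb: "g \<notin> {r, b}" "g \<in> {1..k}" using u0 UV col_k[of v u0] by (auto simp: g_def)
      have exg: "\<exists>y. y \<in> ?C x \<and> y \<in> ?U \<and> col v y = g" if "x \<in> ?U" for x
        using meets[OF that] g comp_sub[OF that] by blast
      have away: "col x z = col v x" if "x \<in> ?U" "col v x \<in> {r, b}" "z \<in> ?U" "z \<notin> ?C x" "col v z = g" for x z
      proof -
        have "x \<noteq> z" using that(4) self by auto
        moreover have "col x z \<in> {r, b}" using comp_out(1)[OF that(1,3,4)] self by blast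
        ultimately show ?thesis using tri[of x z] that g_rb by metis
      qed
      \<comment> \<open>By triangles with \<open>v\<close>, the vertex \<open>x\<close> sends
        \<open>r\<close>, and \<open>y\<close> sends \<open>b\<close>, to vertices of color
        \<open>g\<close> in other components. By \<open>comp_hom\<close> the two colors would
        agree.\<close>
      have not_both: False if x: "x \<in> ?U" "col v x = r" and y: "y \<in> ?U" "col v y = b" for x y
      proof (cases "y \<in> ?C x")
        case True
        obtain z where z: "z \<in> ?U" "z \<notin> ?C x" using two x by blast
        obtain z' where z': "z' \<in> ?C z" "z' \<in> ?U" "col v z' = g" using exg[OF z(1)] by blast
        have nx: "z' \<notin> ?C x" using z' z(2) comp_sym comp_trans by blast
        then have ny: "z' \<notin> ?C y" using True comp_trans by blast
        have "col x z' = r" "col y z' = b" using away[of x z'] away[of y z'] x y z' nx ny by auto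
        moreover have "col z' y = col z' x" by (rule comp_hom[OF UV(1) x(1) z'(2) nx True])
        ultimately show False using rb col_sym by metis
      next
        case False
        then have F': "x \<notin> ?C y" using comp_sym by blast
        obtain zx where zx: "zx \<in> ?C x" "zx \<in> ?U" "col v zx = g" using exg[OF x(1)] by blast
        obtain zy where zy: "zy \<in> ?C y" "zy \<in> ?U" "col v zy = g" using exg[OF y(1)] by blast
        have "zy \<notin> ?C x" "zx \<notin> ?C y" using zx zy False F' comp_sym comp_trans by blast+
        then have "col x zy = r" "col y zx = b" using away[of x zy] away[of y zx] x y zx zy by auto
        moreover have "col x zy = col x y" by (rule comp_hom[OF UV(1) y(1) x(1) F' zy(1)])
        moreover have "col y zx = col y x" by (rule comp_hom[OF UV(1) x(1) y(1) False zx(1)])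
        ultimately show False using rb col_sym by metis
      qed
      have "\<exists>s\<in>{r, b}. \<forall>y\<in>?U. col v y \<in> {g, s}"
      proof (cases "\<exists>x\<in>?U. col v x = r")
        case True
        then have "\<forall>y\<in>?U. col v y \<in> {g, r}" using not_both g by blast
        then show ?thesis by blast
      next
        case False
        then have "\<forall>y\<in>?U. col v y \<in> {g, b}" using g by blast
        then show ?thesis by blast
      qed
      then obtain s where s: "s \<in> {r, b}" "\<forall>y\<in>?U. col v y \<in> {g, s}" by blast
      \<comment> \<open>Only \<open>g\<close> and one of \<open>r\<close> and \<open>b\<close> occur
        at \<open>v\<close>, so \<open>v\<close> alone is a cut in two colors.\<close>
      have "{v} \<subset> U" using v \<open>?U \<noteq> {}\<close> by blast
      moreover have "\<forall>x\<in>{v}. \<forall>y\<in>U - {v}. col x y \<in> {g, s}" using s by blast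
      moreover have "g \<noteq> s" "s \<in> {1..k}" using s g_rb rb by auto
      ultimately show ?thesis using g_rb(2)
        by (intro bexI[of _ g] bexI[of _ s] exI[of _ "{v}"] conjI insert_not_empty)
    qed
  qed
  have "?Q U" using assms
  proof (induction "card U" arbitrary: U rule: less_induct)
    case less
    show ?case
    proof (cases "card U = 2")
      case True
      then show ?thesis using pair less.prems(1) by blast
    next
      case False
      have fU: "finite U" using less.prems(1) finV finite_subset by blast
      obtain v where v: "v \<in> U" using less.prems(2) by fastforce
      have "?Q (U - {v})"
        using v fU less.prems False by (intro less.hyps) (auto simp: card_Diff_singleton)
      then show ?thesis by (rule extend[OF less.prems(1) v])
    qed
  qed
  then show thesis using that by blast
qed

theorem mono_cycle:
  assumes m: "2 \<le> m" and cV: "m * k + m + 2 \<le> card V"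
  shows "\<exists>i xs. cyc (\<lambda>x y. col x y = i) xs \<and> set xs \<subseteq> V \<and> length xs = 2 * m + 2"
proof (rule ccontr)
  assume no: "\<not> ?thesis"
  let ?P = "\<lambda>R. R \<subseteq> V \<and> m + 1 \<le> card R \<and> (\<forall>x\<in>V - R. \<forall>u\<in>R. \<forall>u'\<in>R. col x u = col x u')"
  have "?P V" using cV by auto
  then have "\<exists>R. ?P R \<and> (\<forall>R'. ?P R' \<longrightarrow> card R \<le> card R')" by (rule ex_has_least_nat)
  then obtain R where R: "R \<subseteq> V" "m + 1 \<le> card R" "\<And>x u u'. x \<in> V - R \<Longrightarrow> u \<in> R \<Longrightarrow> u' \<in> R \<Longrightarrow> col x u = col x u'"
    and least: "\<And>R'. ?P R' \<Longrightarrow> card R \<le> card R'" by blast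
  have fR: "finite R" using R(1) finV finite_subset by blast
  have R2: "2 \<le> card R" using R(2) m by simp
  obtain r b A where rb: "r \<in> {1..k}" "b \<in> {1..k}" "r \<noteq> b" and A: "A \<noteq> {}" "A \<subset> R"
    "\<And>x y. x \<in> A \<Longrightarrow> y \<in> R - A \<Longrightarrow> col x y \<in> {r, b}" by (rule Gallai_cut[OF R(1) R2]) blast
  obtain \<rho> where \<rho>: "\<rho> \<in> R" using A by blast
  define X where "X i = {x \<in> V - R. col x \<rho> = i}" for i
  have XR: "col x u = i" "col u x = i" if "x \<in> X i" "u \<in> R" for x u i
  proof -
    show "col x u = i" using R(3)[of x u \<rho>] that \<rho> by (auto simp: X_def)
    then show "col u x = i" by (simp add: col_sym)
  qed
  have fX: "finite (X i)" for i using finV by (simp add: X_def)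
  have cX: "card (X i) \<le> m" for i
  proof (rule ccontr)
    assume "\<not> ?thesis"
    then have c: "m + 1 \<le> card (X i)" by simp
    have d: "X i \<inter> R = {}" by (auto simp: X_def)
    have m1: "2 \<le> m + 1" using m by simp
    obtain ys where "cyc (\<lambda>x y. col x y = i) ys" "set ys \<subseteq> X i \<union> R" "length ys = 2 * (m + 1)"
      by (rule cyc_complete_bipartite[OF fX fR d c R(2) m1, of "\<lambda>x y. col x y = i"]) (use XR in auto)
    moreover from this have "set ys \<subseteq> V" using R(1) by (auto simp: X_def)
    ultimately show False using no by auto
  qed
  define W where "W = R \<union> (X r \<union> X b)"
  have WV: "W \<subseteq> V" using R(1) by (auto simp: W_def X_def)
  have cW: "3 * m + 2 \<le> card W"
  proof -
    let ?I = "{1..k} - {r, b}"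
    have "x \<in> W \<or> x \<in> (\<Union>i\<in>?I. X i)" if "x \<in> V" for x
      using that \<rho> R(1) col_k[of x \<rho>] by (auto simp: W_def X_def)
    then have "card V \<le> card (W \<union> (\<Union>i\<in>?I. X i))"
      using finite_subset[OF WV finV] fX by (intro card_mono) (simp, blast)
    also have "\<dots> \<le> card W + card (\<Union>i\<in>?I. X i)" by (rule card_Un_le)
    also have "card (\<Union>i\<in>?I. X i) \<le> (\<Sum>i\<in>?I. card (X i))" by (rule card_UN_le) simp
    also have "\<dots> \<le> (\<Sum>i\<in>?I. m)" by (intro sum_mono cX)
    also have "\<dots> = (k - 2) * m" using rb by (simp add: card_Diff_subset numeral_2_eq_2)
    finally have "card V \<le> card W + (k - 2) * m" by simp
    moreover have "m * k = (k - 2) * m + 2 * m"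
      using k2 by (metis add_mult_distrib le_add_diff_inverse2 mult.commute)
    ultimately show ?thesis using cV by linarith
  qed
  let ?C = "comp W {r, b}"
  \<comment> \<open>Pairs inside a component stay uncolored even if their color is \<open>r\<close>
    or \<open>b\<close>; this makes the vertices of a component twins.\<close>
  let ?E = "\<lambda>i x y. x \<in> W \<and> y \<in> W \<and> y \<notin> ?C x \<and> col x y = i"
  have hom: "col z y = col z x" if "x \<in> W" "z \<in> W" "z \<notin> ?C x" "y \<in> ?C x" for x y z
    using comp_hom[OF WV that] .
  \<comment> \<open>In the triangle with \<open>\<rho>\<close> the other two edges have the colors
    \<open>r\<close> and \<open>b\<close>.\<close>
  have colX: "col x y \<in> {r, b}" if "x \<in> X r" "y \<in> X b" for x y
  proof -
    have "x \<in> V" "y \<in> V" "\<rho> \<in> V" "x \<noteq> y" "x \<noteq> \<rho>" "y \<noteq> \<rho>" using that \<rho> R(1) rb by (auto simp: X_def)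
    then show ?thesis using nr[of x y \<rho>] XR[OF that(1) \<rho>] XR[OF that(2) \<rho>] rb by auto
  qed
  have sizes: "card (?C x) \<le> m" if x: "x \<in> W" for x
  proof -
    consider "x \<in> X r" | "x \<in> X b" | "x \<in> R" using x by (auto simp: W_def)
    then show ?thesis
    proof cases
      case 1
      then have "?C x \<subseteq> X r"
      proof (rule comp_closed)
        show "col u v \<in> {r, b}" if "u \<in> X r" "v \<in> W - X r" for u v
          using that XR(1)[OF that(1), of v] colX[OF that(1), of v] by (auto simp: W_def)
      qed
      then show ?thesis using card_mono[OF fX] cX order_trans by blast
    next
      case 2
      then have "?C x \<subseteq> X b"
      proof (rule comp_closed)
        show "col u v \<in> {r, b}" if "u \<in> X b" "v \<in> W - X b" for u v
          using that XR(1)[OF that(1), of v] colX[OF _ that(1), of v] col_sym[of u v] by (auto simp: W_def)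
      qed
      then show ?thesis using card_mono[OF fX] cX order_trans by blast
    next
      case 3
      have toX: "col u v \<in> {r, b}" if "u \<in> R" "v \<in> W - R" for u v
        using that XR(2)[OF _ that(1), of v r] XR(2)[OF _ that(1), of v b] by (auto simp: W_def)
      have sub: "?C x \<subset> R"
      proof (cases "x \<in> A")
        case True
        then have "?C x \<subseteq> A"
        proof (rule comp_closed)
          show "col u v \<in> {r, b}" if "u \<in> A" "v \<in> W - A" for u v
            using that A(2) A(3)[OF that(1), of v] toX[of u v] by blast
        qed
        then show ?thesis using A(2) by blast
      next
        case False
        then have "x \<in> R - A" using 3 by blast
        then have "?C x \<subseteq> R - A"
        proof (rule comp_closed)
          show "col u v \<in> {r, b}" if "u \<in> R - A" "v \<in> W - (R - A)" for u v
            using that A(2) A(3)[OF _ that(1), of v] toX[of u v] col_sym[of u v] by auto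
        qed
        then show ?thesis using A(1,2) by blast
      qed
      show ?thesis
      proof (rule ccontr)
        assume "\<not> ?thesis"
        then have "m + 1 \<le> card (?C x)" by simp
        \<comment> \<open>A component inside \<open>R\<close> is again joined in a single color to
          each outside vertex, by \<open>comp_hom\<close> within \<open>W\<close> and as a subset of
          \<open>R\<close> elsewhere. The cut \<open>A\<close> makes it smaller than
          \<open>R\<close>, so minimality bounds its size.\<close>
        moreover have "col z u = col z u'" if z: "z \<in> V - ?C x" "u \<in> ?C x" "u' \<in> ?C x" for z u u'
        proof (cases "z \<in> W")
          case True
          then show ?thesis using hom[OF x, of z u] hom[OF x, of z u'] z by auto
        next
          case False
          then have "z \<in> V - R" using z(1) by (auto simp: W_def)
          then show ?thesis using R(3)[of z u u'] sub z by blast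
        qed
        ultimately have "?P (?C x)" using sub R(1) by blast
        then have "card R \<le> card (?C x)" by (rule least)
        then show False using psubset_card_mono[OF fR sub] by simp
      qed
    qed
  qed
  have C_sym: "y \<in> ?C x \<longleftrightarrow> x \<in> ?C y" for x y using comp_sym by blast
  interpret B: bicol W "?E r" "?E b"
  proof
    show "finite W" using WV finV by (rule finite_subset)
    show "?E i y x" if "?E i x y" for i x y using that C_sym[of x y] col_sym[of y x] by simp
    show "?E i y x" if "?E i x y" for i x y using that C_sym[of x y] col_sym[of y x] by simp
    show "\<not> ?E i x x" for i x using comp_self by blast
    show "\<not> ?E i x x" for i x using comp_self by blast
    show "\<not> ?E b x y" if "?E r x y" for x y using that rb by blast
    show "?E r x z = ?E r y z \<and> ?E b x z = ?E b y z"
      if "x \<in> W" "y \<in> W" "\<not> ?E r x y" "\<not> ?E b x y" "z \<in> W" for x y z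
    proof -
      have y: "y \<in> ?C x" using comp_out(1)[OF that(1,2) _ comp_self] that by blast
      then have "z \<in> ?C x \<longleftrightarrow> z \<in> ?C y" using comp_trans comp_sym by blast
      moreover have "col x z = col y z" if "z \<notin> ?C x"
        using hom[OF \<open>x \<in> W\<close> \<open>z \<in> W\<close> that y] col_sym by metis
      ultimately show ?thesis using that(1,2,5) by (cases "z \<in> ?C x") auto
    qed
  qed
  have "card (B.part x) \<le> m" if x: "x \<in> W" for x
  proof -
    have "B.part x \<subseteq> ?C x"
    proof
      fix y assume "y \<in> B.part x"
      then have "y \<in> W" "\<not> ?E r x y" "\<not> ?E b x y" by (auto simp: B.part_def)
      then show "y \<in> ?C x" using comp_out(1)[OF x _ _ comp_self, of y] x by blast
    qed
    moreover have "finite (?C x)" using comp_sub[OF x] B.fin finite_subset by blast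
    ultimately show ?thesis using card_mono sizes[OF x] order_trans by blast
  qed
  then obtain xs where xs: "set xs \<subseteq> W" "length xs = 2 * m + 2" "cyc (?E r) xs \<or> cyc (?E b) xs"
    using bicol_mono_cyc[OF m B.bicol_axioms cW] by blast
  have "cyc (\<lambda>x y. col x y = i) xs" if "cyc (?E i) xs" for i
    using that unfolding cyc_conv_nth by blast
  then show False using no xs WV by blast
qed

end

section \<open>The lower bound and the theorem\<close>

lemma gallai_arrows_Theta:
  assumes k: "2 \<le> k" and n: "3 \<le> n"
  shows "gallai_arrows ((n - 1) * k + n + 1) k (Theta (2 * n))"
  unfolding gallai_arrows_def
proof (intro allI impI)
  let ?N = "(n - 1) * k + n + 1"
  fix c assume c: "gallai_coloring k (complete_graph ?N) c"
  have nr: "c {x, y} = c {y, z} \<or> c {y, z} = c {x, z} \<or> c {x, y} = c {x, z}"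
    if "x < ?N" "y < ?N" "z < ?N" "x \<noteq> y" "y \<noteq> z" "x \<noteq> z" for x y z
  proof -
    have "{x, y} \<in> edges (complete_graph ?N)" "{y, z} \<in> edges (complete_graph ?N)"
      "{x, z} \<in> edges (complete_graph ?N)"
      using that by (simp_all add: complete_graph_def)
    then show ?thesis using c that(4-6) unfolding gallai_coloring_def by blast
  qed
  interpret rainbow_free "{..<?N}" "\<lambda>x y. c {x, y}" k
  proof
    show "c {x, y} \<in> {1..k}" if "x \<in> {..<?N}" "y \<in> {..<?N}" "x \<noteq> y" for x y
    proof -
      have "{x, y} \<in> edges (complete_graph ?N)" using that by (simp add: complete_graph_def)
      then show ?thesis using c unfolding gallai_coloring_def by blast
    qed
  qed (use k nr in \<open>auto simp: insert_commute\<close>)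
  have "2 \<le> n - 1" "(n - 1) * k + (n - 1) + 2 \<le> card {..<?N}" using n by auto
  then obtain i xs where "cyc (\<lambda>x y. c {x, y} = i) xs" "set xs \<subseteq> {..<?N}" "length xs = 2 * (n - 1) + 2"
    using mono_cycle by blast
  then show "\<exists>H\<in>Theta (2 * n). has_mono_copy (complete_graph ?N) c H"
    using n nr by (intro Theta_if_mono_cycle[of n c i xs ?N]) auto
qed

text \<open>A clique on \<open>2 n - 1\<close> vertices in color \<open>1\<close>, extended by blocks of \<open>n - 1\<close> vertices, one
  for each further color; an edge gets the color of the block of its larger vertex.\<close>

definition block_color :: "nat \<Rightarrow> nat \<Rightarrow> nat" where
  "block_color n M = (if M < 2 * n - 1 then 1 else (M - (2 * n - 1)) div (n - 1) + 2)"

lemma block_color_eq_1: "block_color n M = 1 \<longleftrightarrow> M < 2 * n - 1"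
  by (simp add: block_color_def)

text \<open>Color 1 occurs only among \<open>2 * n - 1\<close> vertices. In any other color every
  edge has its larger end in a block of \<open>n - 1\<close> vertices, but \<open>n\<close> disjoint
  edges of the cycle have \<open>n\<close> different larger ends.\<close>

lemma no_block_colored_cycle:
  assumes n: "3 \<le> n" and f: "inj_on f {..<2 * n}"
    and j: "\<And>i. i < 2 * n \<Longrightarrow> block_color n (max (f i) (f ((i + 1) mod (2 * n)))) = j"
  shows False
proof (cases "j = 1")
  case True
  have "f i < 2 * n - 1" if "i < 2 * n" for i
  proof -
    have "max (f i) (f ((i + 1) mod (2 * n))) < 2 * n - 1"
      using j[OF that] unfolding True block_color_eq_1 .
    then show ?thesis by (simp only: max_less_iff_conj)
  qed
  then have "f ` {..<2 * n} \<subseteq> {..<2 * n - 1}" by blast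
  then have "card (f ` {..<2 * n}) \<le> 2 * n - 1" using card_mono[OF finite_lessThan] by fastforce
  then show False using card_image[OF f] n by simp
next
  case False
  define g where "g t = max (f (2 * t)) (f (2 * t + 1))" for t
  let ?s = "2 * n - 1 + (j - 2) * (n - 1)"
  have g: "g t \<in> {?s..<?s + (n - 1)}" if "t < n" for t
  proof -
    have "block_color n (g t) = j" using j[of "2 * t"] that by (simp add: g_def)
    then have M: "2 * n - 1 \<le> g t" "(g t - (2 * n - 1)) div (n - 1) = j - 2"
      using False block_color_eq_1[of n "g t"] by (auto simp: block_color_def)
    have "(j - 2) * (n - 1) \<le> g t - (2 * n - 1)" "g t - (2 * n - 1) < (j - 2) * (n - 1) + (n - 1)"
      using div_mult_mod_eq[of "g t - (2 * n - 1)" "n - 1"] mod_less_divisor[of "n - 1" "g t - (2 * n - 1)"] n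
      unfolding M(2) by linarith+
    then show ?thesis using M(1) unfolding atLeastLessThan_iff by linarith
  qed
  have ex: "\<exists>a<2 * n. a div 2 = t \<and> g t = f a" if "t < n" for t
  proof (cases "f (2 * t) \<le> f (2 * t + 1)")
    case True
    then show ?thesis using that by (intro exI[of _ "2 * t + 1"]) (simp add: g_def)
  next
    case False
    then show ?thesis using that by (intro exI[of _ "2 * t"]) (simp add: g_def)
  qed
  have "inj_on g {..<n}"
  proof (rule inj_onI)
    fix s t assume st: "s \<in> {..<n}" "t \<in> {..<n}" "g s = g t"
    obtain a where a: "a < 2 * n" "a div 2 = s" "g s = f a" using ex[of s] st by blast
    obtain b where b: "b < 2 * n" "b div 2 = t" "g t = f b" using ex[of t] st by blast
    have "a = b" by (rule inj_onD[OF f]) (use a b st in simp_all)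
    then show "s = t" using a b by simp
  qed
  then have "card (g ` {..<n}) = n" by (simp add: card_image)
  moreover have "card (g ` {..<n}) \<le> card {?s..<?s + (n - 1)}" using g by (intro card_mono) auto
  ultimately show False using n by simp
qed

lemma not_gallai_arrows_Theta:
  assumes k: "2 \<le> k" and n: "3 \<le> n" and N: "N \<le> (n - 1) * k + n"
  shows "\<not> gallai_arrows N k (Theta (2 * n))"
proof
  assume arr: "gallai_arrows N k (Theta (2 * n))"
  define c where "c e = block_color n (Max e)" for e
  have c2: "c {x, y} = block_color n (max x y)" for x y by (simp add: c_def)
  have "gallai_coloring k (complete_graph N) c"
    unfolding gallai_coloring_def
  proof
    have "block_color n M \<in> {1..k}" if M: "M < N" for M
    proof (cases "M < 2 * n - 1")
      case False
      \<comment> \<open>So the bound on \<open>N\<close> is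
        \<open>2 * n - 1 + (n - 1) * (k - 1)\<close>, the size of the clique together with
        \<open>k - 1\<close> blocks.\<close>
      have "(n - 1) * k = (n - 1) * (k - 1) + (n - 1)" using k by (cases k) simp_all
      then have "M - (2 * n - 1) < (n - 1) * (k - 1)" using False M N n by linarith
      then have "(M - (2 * n - 1)) div (n - 1) < k - 1" using n by (simp add: less_mult_imp_div_less mult.commute)
      then show ?thesis using False by (simp add: block_color_def)
    qed (use k in \<open>simp add: block_color_def\<close>)
    moreover have "Max e < N" if "e \<in> edges (complete_graph N)" for e
    proof -
      have e: "e \<subseteq> {..<N}" "finite e" "e \<noteq> {}" using that by (auto simp: complete_graph_def nsets_def)
      then show ?thesis using Max_in by blast
    qed
    ultimately show "c \<in> edges (complete_graph N) \<rightarrow> {1..k}" unfolding c_def by blast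
    show "\<nexists>x y z. {x, y} \<in> edges (complete_graph N) \<and> {y, z} \<in> edges (complete_graph N) \<and>
        {x, z} \<in> edges (complete_graph N) \<and> x \<noteq> y \<and> y \<noteq> z \<and> x \<noteq> z \<and>
        c {x, y} \<noteq> c {y, z} \<and> c {y, z} \<noteq> c {x, z} \<and> c {x, y} \<noteq> c {x, z}"
    proof -
      have "c {x, y} = c {y, z} \<or> c {y, z} = c {x, z} \<or> c {x, y} = c {x, z}" for x y z
      proof -
        \<comment> \<open>Two of the three edges of a triangle share their larger end, so no
          triangle is rainbow.\<close>
        have "max x y = max y z \<or> max y z = max x z \<or> max x y = max x z" by linarith
        then show ?thesis unfolding c2 by presburger
      qed
      then show ?thesis by blast
    qed
  qed
  then obtain H where H: "H \<in> Theta (2 * n)" "has_mono_copy (complete_graph N) c H"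
    using arr unfolding gallai_arrows_def by blast
  then obtain S j where S: "isomorphic H S" "\<And>e. e \<in> edges S \<Longrightarrow> c e = j" unfolding has_mono_copy_def by blast
  obtain f where f: "bij_betw f (verts H) (verts S)" "edges S = (\<lambda>e. f ` e) ` edges H"
    using S(1) unfolding isomorphic_def by blast
  have vH: "verts H = {..<2 * n}" using Theta_wf(1)[OF _ H(1)] n by simp
  have "block_color n (max (f i) (f ((i + 1) mod (2 * n)))) = j" if "i < 2 * n" for i
  proof -
    have "{i, (i + 1) mod (2 * n)} \<in> edges (cycle_graph (2 * n))"
      unfolding cycle_graph_def snd_conv using that by blast
    then have "{i, (i + 1) mod (2 * n)} \<in> edges H" using H(1) unfolding Theta_def by fastforce
    then have "f ` {i, (i + 1) mod (2 * n)} \<in> edges S" unfolding f(2) by (rule imageI)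
    then have "c (f ` {i, (i + 1) mod (2 * n)}) = j" by (rule S(2))
    then show ?thesis by (simp add: c2)
  qed
  moreover have "inj_on f {..<2 * n}" using f(1) vH by (simp add: bij_betw_def)
  ultimately show False using no_block_colored_cycle[OF n] by blast
qed

theorem theorem1p7:
  fixes k n :: nat
  assumes "k \<ge> 2" and "n \<ge> 3"
  shows "GR k (Theta (2 * n)) = (n - 1) * k + n + 1"
  unfolding GR_def
proof (rule Least_equality)
  show "0 < (n - 1) * k + n + 1 \<and> gallai_arrows ((n - 1) * k + n + 1) k (Theta (2 * n))"
    using gallai_arrows_Theta assms by simp
  show "(n - 1) * k + n + 1 \<le> N" if "0 < N \<and> gallai_arrows N k (Theta (2 * n))" for N
    using not_gallai_arrows_Theta[OF assms, of N] that by (metis Suc_eq_plus1 not_less_eq_eq)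
qed

end
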